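(* Let $2<p\leq 4$ and $\alpha>0$. Then ground states of $F$ at mass $\mu$ exist if and only if $\mu>\|\phi_{\alpha^2}\|_{L^2(\mathbb{R})}^2$, where $\phi_{\alpha^2}$ is the soliton at frequency $\alpha^2$. Moreover, whenever they exist, the positive ground state is unique and coincides with the only positive bound state of mass $\mu$.
   Context: Let $\mathbb{R}^+=(0,+\infty)$. For $p\in(2,6]$ and $\alpha\in\mathbb{R}$, the energy is $$F(u)=\frac12\int_0^{+\infty}|u'|^2\,dx-\frac1p\int_0^{+\infty}|u|^p\,dx+\frac{\alpha}{2}|u(0)|^2,\qquad u\in H^1(\mathbb{R}^+),$$ where $u(0)$ is the value at $0$ of the continuous representative of $u$. For $\mu>0$, $H^1_\mu(\mathbb{R}^+):=\{u\in H^1(\mathbb{R}^+):\int_0^{+\infty}|u|^2\,dx=\mu\}$ and $\mathcal{F}(\mu):=\inf_{u\in H^1_\mu(\mathbb{R}^+)}F(u)$. A ground state of $F$ at mass $\mu$ is a function $u\in H^1_\mu(\mathbb{R}^+)$ with $F(u)=\mathcal{F}(\mu)$. Functions are real-valued (this is not restrictive). A bound state is a real-valued $u\in H^1(\mathbb{R}^+)$ which, for some $\omega>0$, solves $$-u''-|u|^{p-2}u+\omega u=0\ \text{ on }\mathbb{R}^+,\qquad u'(0)=\alpha u(0);$$ its mass is $\int_0^{+\infty}|u|^2\,dx$. For $\omega>0$, the soliton at frequency $\omega$ is $$\phi_\omega(x)=\left[\frac p2\,\omega\,\mathrm{sech}^2\left(\left(\frac p2-1\right)\sqrt{\omega}\,|x|\right)\right]^{\frac1{p-2}},\qquad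 x\in\mathbb{R}.$$ *)

theory Defs
  imports "HOL-Analysis.Analysis"
begin

text \<open>
  Elements of function spaces on the open half-line are represented by functions
  \<open>real \<Rightarrow> real\<close> whose values outside \<open>{0<..}\<close> are irrelevant, and two
  representatives are identified when they agree almost everywhere on \<open>{0<..}\<close>.
\<close>

definition ae_eq :: "(real \<Rightarrow> real) \<Rightarrow> (real \<Rightarrow> real) \<Rightarrow> bool" where
  "ae_eq u v \<longleftrightarrow> (AE x in lborel. 0 < x \<longrightarrow> u x = v x)"

definition L2_halfline :: "(real \<Rightarrow> real) \<Rightarrow> bool" where
  "L2_halfline u \<longleftrightarrow> set_borel_measurable lborel {0<..} u
     \<and> set_integrable lborel {0<..} (\<lambda>x. (u x)\<^sup>2)"

definition L1loc_halfline :: "(real \<Rightarrow> real) \<Rightarrow> bool" where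
  "L1loc_halfline u \<longleftrightarrow> (\<forall>a b. 0 < a \<longrightarrow> set_integrable lborel {a..b} u)"

text \<open>Continuously differentiable functions with compact support in \<open>{0<..}\<close>; testing
  with smooth ones would give the same weak derivatives.\<close>

definition test_function :: "(real \<Rightarrow> real) \<Rightarrow> bool" where
  "test_function \<phi> \<longleftrightarrow> \<phi> C1_differentiable_on UNIV
     \<and> (\<exists>a b. 0 < a \<and> (\<forall>x. x \<notin> {a..b} \<longrightarrow> \<phi> x = 0))"

definition has_weak_deriv :: "(real \<Rightarrow> real) \<Rightarrow> (real \<Rightarrow> real) \<Rightarrow> bool" where
  "has_weak_deriv u v \<longleftrightarrow> L1loc_halfline u \<and> L1loc_halfline v
     \<and> (\<forall>\<phi>. test_function \<phi> \<longrightarrow>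
          (LINT x:{0<..}|lborel. u x * deriv \<phi> x) = - (LINT x:{0<..}|lborel. v x * \<phi> x))"

text \<open>The weak derivative is determined almost everywhere, when it exists.\<close>

definition weak_deriv :: "(real \<Rightarrow> real) \<Rightarrow> (real \<Rightarrow> real)" where
  "weak_deriv u = (SOME v. has_weak_deriv u v)"

definition H1 :: "(real \<Rightarrow> real) set" where
  "H1 = {u. L2_halfline u \<and> (\<exists>v. has_weak_deriv u v \<and> L2_halfline v)}"

definition continuous_rep :: "(real \<Rightarrow> real) \<Rightarrow> (real \<Rightarrow> real) \<Rightarrow> bool" where
  "continuous_rep u w \<longleftrightarrow> continuous_on {0..} w \<and> ae_eq w u"

definition value_at_0 :: "(real \<Rightarrow> real) \<Rightarrow> real" where
  "value_at_0 u = (THE c. \<exists>w. continuous_rep u w \<and> w 0 = c)"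

definition positive_halfline :: "(real \<Rightarrow> real) \<Rightarrow> bool" where
  "positive_halfline u \<longleftrightarrow> (\<exists>w. continuous_rep u w \<and> (\<forall>x>0. 0 < w x))"

definition mass :: "(real \<Rightarrow> real) \<Rightarrow> real" where
  "mass u = (LINT x:{0<..}|lborel. (u x)\<^sup>2)"

definition energy :: "real \<Rightarrow> real \<Rightarrow> (real \<Rightarrow> real) \<Rightarrow> real" where
  "energy p \<alpha> u =
     1 / 2 * (LINT x:{0<..}|lborel. (weak_deriv u x)\<^sup>2)
     - 1 / p * (LINT x:{0<..}|lborel. \<bar>u x\<bar> powr p)
     + \<alpha> / 2 * (value_at_0 u)\<^sup>2"

definition H1_mass :: "real \<Rightarrow> (real \<Rightarrow> real) set" where
  "H1_mass \<mu> = {u \<in> H1. mass u = \<mu>}"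

text \<open>
  The infimum is taken in \<^typ>\<open>ereal\<close>, since the infimum of a set of reals that is
  not bounded below is unspecified.
\<close>

definition energy_level :: "real \<Rightarrow> real \<Rightarrow> real \<Rightarrow> ereal" where
  "energy_level p \<alpha> \<mu> = (INF u\<in>H1_mass \<mu>. ereal (energy p \<alpha> u))"

definition ground_state :: "real \<Rightarrow> real \<Rightarrow> real \<Rightarrow> (real \<Rightarrow> real) \<Rightarrow> bool" where
  "ground_state p \<alpha> \<mu> u \<longleftrightarrow> u \<in> H1_mass \<mu> \<and> ereal (energy p \<alpha> u) = energy_level p \<alpha> \<mu>"

text \<open>
  The differential equation \<open>- u'' - \<bar>u\<bar>\<^sup>p\<^sup>-\<^sup>2 u + \<omega> u = 0\<close> is understood
  in the sense of distributions. It forces \<open>u'\<close> to have a continuous representative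
  on \<open>{0..}\<close>, whose value at \<open>0\<close> enters the boundary condition.
\<close>

definition bound_state :: "real \<Rightarrow> real \<Rightarrow> (real \<Rightarrow> real) \<Rightarrow> bool" where
  "bound_state p \<alpha> u \<longleftrightarrow> u \<in> H1 \<and>
     (\<exists>\<omega>>0. has_weak_deriv (weak_deriv u) (\<lambda>x. \<omega> * u x - \<bar>u x\<bar> powr (p - 2) * u x)
        \<and> value_at_0 (weak_deriv u) = \<alpha> * value_at_0 u)"

definition sech :: "real \<Rightarrow> real" where
  "sech x = 1 / cosh x"

definition soliton :: "real \<Rightarrow> real \<Rightarrow> real \<Rightarrow> real" where
  "soliton p \<omega> x =
     (p / 2 * \<omega> * (sech ((p / 2 - 1) * sqrt \<omega> * \<bar>x\<bar>))\<^sup>2) powr (1 / (p - 2))"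

end

theory Submission
  imports Defs
begin

text \<open>
  Fix \<open>u\<close> of mass \<open>\<mu>\<close> and choose the frequency \<open>\<omega> = k\<^sup>2\<close> whose soliton has the same maximum as \<open>\<bar>u\<bar>\<close>.
  Completing the square in the action \<open>u'\<^sup>2 + \<omega> u\<^sup>2 - 2/p \<bar>u\<bar>\<^sup>p\<close> on both sides of a maximum point bounds
  \<open>2 F(u) + \<omega> \<mu>\<close> from below by a function of \<open>\<omega>\<close> and \<open>u(0)\<close>. Parametrizing \<open>u(0)\<close> by
  \<open>t\<close> with \<open>u(0)\<^sup>2 = A (\<omega> - t\<^sup>2)\<^sup>q\<close>, \<open>q = 2/(p-2)\<close>, \<open>A = (p/2)\<^sup>q\<close>, this function is least at \<open>t = \<alpha>\<close>,
  where it equals \<open>A\<close> times the integral of \<open>(\<omega> - s\<^sup>2)\<^sub>+\<^sup>q\<close> over \<open>[0,\<surd>\<omega>]\<close> plus that over \<open>[0,\<alpha>]\<close>.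
  For \<open>q \<ge> 1\<close>, that is \<open>p \<le> 4\<close>, the integrand is convex in \<open>\<omega>\<close>, and its tangent slope is the mass of the
  bound state of frequency \<open>\<omega>\<close> (of a full soliton if \<open>\<omega> \<le> \<alpha>\<^sup>2\<close>), which is strictly increasing in \<open>\<omega>\<close>.
  Hence the bound is least at the one frequency of mass \<open>\<mu>\<close>. It is attained, by a translated
  soliton only, if that frequency exceeds \<open>\<alpha>\<^sup>2\<close>; otherwise it is approached by solitons escaping to
  infinity and never attained. No compactness is needed.
\<close>

section \<open>Primitives of integrable functions\<close>

text \<open>The variable \<open>t\<close> is a slope: along a soliton of frequency \<omega> the
  logarithmic derivative \<open>s = w'/w\<close> satisfies \<open>w^2 = A (\<omega> - s^2)^q\<close>
  and \<open>s' = - (\<omega> - s^2) / q\<close>. With \<open>s\<close> as integration variable the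
  action becomes, up to a boundary term, \<open>A\<close> times integrals of
  \<open>(\<omega> - s^2)^q\<close>, and the mass becomes \<open>A q\<close> times integrals of
  \<open>(\<omega> - s^2)^(q-1)\<close>. Since \<open>q (\<omega> - s^2)^(q-1)\<close> is the
  derivative of the former integrand in \<omega>, tangent slopes are masses. The boundary condition
  says that \<open>s\<close> starts at \<alpha>. The delicate point is equality. A vanishing square
  leaves only \<open>w' = speed k w\<close> before and \<open>w' = - speed k w\<close> after the
  maximum, and \<open>speed k\<close> vanishes like a square root at the peak, so a solution may
  rest there for any time. The equation therefore yields just a one-sided bound: \<open>w\<close>
  lies above the soliton with the same peak and maximum point. The slope \<alpha> at 0 then makes
  that soliton at least as massive as \<open>w\<close>, and the two coincide. Energy functions are
  handled as primitives of integrable functions, so that almost everywhere derivatives never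
  occur.\<close>

definition primitive_on :: "real set \<Rightarrow> (real \<Rightarrow> real) \<Rightarrow> (real \<Rightarrow> real) \<Rightarrow> bool" where
  "primitive_on S w v \<longleftrightarrow> (\<forall>x\<in>S. \<forall>y\<in>S. x \<le> y \<longrightarrow>
     v absolutely_integrable_on {x..y} \<and> integral {x..y} v = w y - w x)"

lemma primitive_onD:
  assumes "primitive_on S w v" "x \<in> S" "y \<in> S" "x \<le> y"
  shows "v absolutely_integrable_on {x..y}" "integral {x..y} v = w y - w x"
    "v integrable_on {x..y}" "(v has_integral (w y - w x)) {x..y}"
proof -
  show 1: "v absolutely_integrable_on {x..y}" "integral {x..y} v = w y - w x"
    using assms by (auto simp: primitive_on_def)
  then show 2: "v integrable_on {x..y}"
    using absolutely_integrable_on_def by blast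
  show "(v has_integral (w y - w x)) {x..y}"
    using 1 2 by (metis has_integral_integrable_integral)
qed

lemma primitive_on_subset:
  assumes "primitive_on S w v" "T \<subseteq> S"
  shows "primitive_on T w v"
  unfolding primitive_on_def
proof (intro ballI impI)
  fix x y assume "x \<in> T" "y \<in> T" "x \<le> y"
  with assms(2) have "x \<in> S" "y \<in> S" "x \<le> y" by auto
  from primitive_onD(1,2)[OF assms(1) this]
  show "v absolutely_integrable_on {x..y} \<and> integral {x..y} v = w y - w x" ..
qed

lemma primitive_on_Icc_continuous:
  assumes "primitive_on {a..b} w v"
  shows "continuous_on {a..b} w"
proof (cases "a \<le> b")
  case True
  have "continuous_on {a..b} (\<lambda>x. w a + integral {a..x} v)"
    by (intro continuous_intros indefinite_integral_continuous_1 primitive_onD(3)[OF assms]) (use True in auto)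
  moreover have "w a + integral {a..x} v = w x" if "x \<in> {a..b}" for x
    using primitive_onD(2)[OF assms, of a x] that by auto
  ultimately show ?thesis by (rule continuous_on_eq)
qed auto

lemma primitive_on_Ici_continuous:
  assumes "primitive_on {a..} w v"
  shows "continuous_on {a..} w"
  unfolding continuous_on_eq_continuous_within
proof
  fix x assume x: "x \<in> {a..}"
  have "continuous_on {a..x+1} w"
    by (rule primitive_on_Icc_continuous, rule primitive_on_subset[OF assms]) auto
  then have "continuous (at x within {a..x+1}) w"
    using x by (simp add: continuous_on_eq_continuous_within)
  moreover have "at x within {a..} = at x within {a..x+1}"
    by (rule at_within_nhd[of x "{..<x+1}"]) (use x in auto)
  ultimately show "continuous (at x within {a..}) w" by simp
qed

lemma primitive_on_Ioi_continuous:
  assumes "primitive_on {a<..} w v"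
  shows "continuous_on {a<..} w"
proof (rule continuous_at_imp_continuous_on, rule)
  fix x assume x: "x \<in> {a<..}"
  have "continuous_on {(a+x)/2..} w"
    by (rule primitive_on_Ici_continuous, rule primitive_on_subset[OF assms]) (use x in auto)
  then show "isCont w x"
    using x by (intro continuous_on_interior[where S = "{(a+x)/2..}"]) auto
qed

text \<open>The local estimate replaces an almost everywhere derivative: \<open>D\<close> varies less than
  any multiple of a primitive, hence not at all.\<close>

lemma increment_bound_imp_eq:
  fixes D g :: "real \<Rightarrow> real"
  assumes ab: "a \<le> b" and g: "g integrable_on {a..b}"
    and loc: "\<And>e x. 0 < e \<Longrightarrow> x \<in> {a..b} \<Longrightarrow> \<exists>d>0. \<forall>s t. a \<le> s \<and> s \<le> x \<and> x \<le> t \<and> t \<le> b \<and> t - s < d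
      \<longrightarrow> \<bar>D t - D s\<bar> \<le> e * integral {s..t} g"
  shows "D b = D a"
proof -
  have bound: "\<bar>D b - D a\<bar> \<le> e * integral {a..b} g" if e: "0 < e" for e
  proof -
    have "a \<le> a \<and> a \<le> b \<and> b \<le> b \<longrightarrow> \<bar>D b - D a\<bar> \<le> e * integral {a..b} g"
    \<comment> \<open>Bisection: the estimate adds up over adjacent intervals and holds on small
      intervals around each point, hence on all of \<open>{a..b}\<close>.\<close>
    proof (rule Bolzano[OF ab, where P = "\<lambda>s t. a \<le> s \<and> s \<le> t \<and> t \<le> b \<longrightarrow> \<bar>D t - D s\<bar> \<le> e * integral {s..t} g"])
      fix r s t assume *: "a \<le> r \<and> r \<le> s \<and> s \<le> b \<longrightarrow> \<bar>D s - D r\<bar> \<le> e * integral {r..s} g"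
        "a \<le> s \<and> s \<le> t \<and> t \<le> b \<longrightarrow> \<bar>D t - D s\<bar> \<le> e * integral {s..t} g" "r \<le> s" "s \<le> t"
      show "a \<le> r \<and> r \<le> t \<and> t \<le> b \<longrightarrow> \<bar>D t - D r\<bar> \<le> e * integral {r..t} g"
      proof
        assume rt: "a \<le> r \<and> r \<le> t \<and> t \<le> b"
        have "integral {r..s} g + integral {s..t} g = integral {r..t} g"
          using * rt by (intro Henstock_Kurzweil_Integration.integral_combine integrable_subinterval_real[OF g]) auto
        then have "e * integral {r..t} g = e * integral {r..s} g + e * integral {s..t} g"
          by (metis distrib_left)
        then show "\<bar>D t - D r\<bar> \<le> e * integral {r..t} g" using * rt by linarith
      qed
    next
      fix x assume "a \<le> x" "x \<le> b"
      then obtain d where "d > 0" "\<forall>s t. a \<le> s \<and> s \<le> x \<and> x \<le> t \<and> t \<le> b \<and> t - s < d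
          \<longrightarrow> \<bar>D t - D s\<bar> \<le> e * integral {s..t} g"
        using loc[OF e, of x] by auto
      then show "\<exists>d>0. \<forall>s t. s \<le> x \<and> x \<le> t \<and> t - s < d \<longrightarrow>
          a \<le> s \<and> s \<le> t \<and> t \<le> b \<longrightarrow> \<bar>D t - D s\<bar> \<le> e * integral {s..t} g"
        by blast
    qed
    then show ?thesis using ab by simp
  qed
  \<comment> \<open>Dividing by \<open>G\<close> absorbs the integral of \<open>g\<close>; the added
    1 keeps the divisor positive.\<close>
  define G where "G = \<bar>integral {a..b} g\<bar> + 1"
  have "\<bar>D b - D a\<bar> \<le> 0 + e" if "0 < e" for e
  proof -
    have "\<bar>D b - D a\<bar> \<le> e / G * integral {a..b} g"
      using that by (intro bound) (auto simp: G_def add_nonneg_pos)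
    also have "\<dots> \<le> e / G * G"
      using that by (intro mult_left_mono) (auto simp: G_def)
    also have "\<dots> = e" by (simp add: G_def)
    finally show ?thesis by simp
  qed
  then have "\<bar>D b - D a\<bar> \<le> 0" by (rule field_le_epsilon)
  then show ?thesis by simp
qed

section \<open>Chain and product rules for primitives\<close>

lemma absolutely_integrable_continuous_mult:
  fixes h v :: "real \<Rightarrow> real"
  assumes "continuous_on {a..b} h" "v absolutely_integrable_on {a..b}"
  shows "(\<lambda>x. h x * v x) absolutely_integrable_on {a..b}"
proof (rule absolutely_integrable_bounded_measurable_product_real[OF _ _ _ assms(2)])
  show "h \<in> borel_measurable (lebesgue_on {a..b})"
    by (intro continuous_imp_measurable_on_sets_lebesgue assms) auto
  show "bounded (h ` {a..b})"
    by (intro compact_imp_bounded compact_continuous_image assms) auto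
qed auto

text \<open>The error \<open>D\<close> between \<open>F (w x)\<close> and the candidate integral
  satisfies the local estimate of \<open>increment_bound_imp_eq\<close> with \<open>g = |v|\<close>:
  by the mean value theorem \<open>F (w t) - F (w s)\<close> is \<open>f z\<close> times the
  integral of \<open>v\<close> over \<open>{s..t}\<close>, and \<open>f z\<close> is close to
  \<open>f (w y)\<close> for all \<open>y\<close> near \<open>x\<close> by continuity.\<close>

lemma primitive_on_chain_Icc:
  fixes F f w v :: "real \<Rightarrow> real"
  assumes w: "primitive_on {a..b} w v"
    and F: "\<And>r. (F has_real_derivative f r) (at r)" and f: "continuous_on UNIV f" and ab: "a \<le> b"
  shows "(\<lambda>x. f (w x) * v x) absolutely_integrable_on {a..b}"
    "integral {a..b} (\<lambda>x. f (w x) * v x) = F (w b) - F (w a)"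
proof -
  have cw: "continuous_on {a..b} w" by (rule primitive_on_Icc_continuous[OF w])
  have cfw: "continuous_on {a..b} (\<lambda>x. f (w x))"
    by (rule continuous_on_compose2[OF f cw]) auto
  show ai: "(\<lambda>x. f (w x) * v x) absolutely_integrable_on {a..b}"
    by (intro absolutely_integrable_continuous_mult cfw primitive_onD(1)[OF w]) (use ab in auto)
  then have i: "(\<lambda>x. f (w x) * v x) integrable_on {a..b}"
    using absolutely_integrable_on_def by blast
  have vi: "(\<lambda>x. \<bar>v x\<bar>) integrable_on {a..b}" "v integrable_on {a..b}"
    using primitive_onD(1)[OF w, of a b] ab by (auto simp: absolutely_integrable_on_def)
  define D where "D x = F (w x) - integral {a..x} (\<lambda>x. f (w x) * v x)" for x
  have "D b = D a"
  proof (rule increment_bound_imp_eq[OF ab vi(1)])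
    fix e x :: real assume e: "0 < e" and x: "x \<in> {a..b}"
    have "isCont f (w x)" using f by (simp add: continuous_on_eq_continuous_at)
    then obtain d1 where d1: "d1 > 0" "\<And>r. \<bar>r - w x\<bar> < d1 \<Longrightarrow> \<bar>f r - f (w x)\<bar> < e / 2"
      using e unfolding continuous_at_eps_delta by (metis dist_real_def half_gt_zero)
    obtain d where d: "d > 0" "\<And>y. y \<in> {a..b} \<Longrightarrow> \<bar>y - x\<bar> < d \<Longrightarrow> \<bar>w y - w x\<bar> < d1"
      using cw x d1(1) unfolding continuous_on_iff by (metis dist_real_def)
    show "\<exists>d>0. \<forall>s t. a \<le> s \<and> s \<le> x \<and> x \<le> t \<and> t \<le> b \<and> t - s < d
       \<longrightarrow> \<bar>D t - D s\<bar> \<le> e * integral {s..t} (\<lambda>x. \<bar>v x\<bar>)"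
    proof (intro exI[of _ d] conjI d(1) allI impI)
      fix s t assume st: "a \<le> s \<and> s \<le> x \<and> x \<le> t \<and> t \<le> b \<and> t - s < d"
      have near: "\<bar>w y - w x\<bar> < d1" if "y \<in> {s..t}" for y
        using that st by (intro d(2)) auto
      have vst: "v integrable_on {s..t}" "(\<lambda>x. \<bar>v x\<bar>) integrable_on {s..t}" "(\<lambda>x. f (w x) * v x) integrable_on {s..t}"
        using st by (auto intro: integrable_subinterval_real[OF vi(2)] integrable_subinterval_real[OF vi(1)] integrable_subinterval_real[OF i])
      have wst: "w t - w s = integral {s..t} v"
        using primitive_onD(2)[OF w, of s t] st by auto
      have "\<bar>w t - w s\<bar> \<le> integral {s..t} (\<lambda>x. \<bar>v x\<bar>)"
        unfolding wst using integral_norm_bound_integral[OF vst(1,2)] by simp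
      \<comment> \<open>The mean value theorem is applied in the variable of \<open>F\<close>,
        between the values \<open>w s\<close> and \<open>w t\<close>, which may come in either order
        or coincide.\<close>
      have "\<exists>z. \<bar>z - w x\<bar> < d1 \<and> F (w t) - F (w s) = f z * (w t - w s)"
      proof (cases "w s" "w t" rule: linorder_cases)
        case less
        obtain z where "z > w s" "z < w t" "F (w t) - F (w s) = (w t - w s) * f z"
          using MVT2[OF less, of F f] F by auto
        then show ?thesis using near[of s] near[of t] st by (intro exI[of _ z]) auto
      next
        case equal
        then show ?thesis using near[of s] st by (intro exI[of _ "w s"]) auto
      next
        case greater
        obtain z where "z > w t" "z < w s" "F (w s) - F (w t) = (w s - w t) * f z"
          using MVT2[OF greater, of F f] F by auto
        then show ?thesis using near[of s] near[of t] st
          by (intro exI[of _ z]) (auto simp: algebra_simps)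
      qed
      then obtain z where z: "\<bar>z - w x\<bar> < d1" "F (w t) - F (w s) = f z * (w t - w s)" by blast
      have eq: "integral {s..t} (\<lambda>y. (f z - f (w y)) * v y) = f z * (w t - w s) - integral {s..t} (\<lambda>x. f (w x) * v x)"
        unfolding wst left_diff_distrib using vst
        by (subst Henstock_Kurzweil_Integration.integral_diff) (auto intro!: integrable_on_mult_right)
      have "integral {a..t} (\<lambda>x. f (w x) * v x) = integral {a..s} (\<lambda>x. f (w x) * v x) + integral {s..t} (\<lambda>x. f (w x) * v x)"
        using st by (intro Henstock_Kurzweil_Integration.integral_combine[symmetric] integrable_subinterval_real[OF i]) auto
      then have "D t - D s = integral {s..t} (\<lambda>y. (f z - f (w y)) * v y)"
        unfolding D_def eq using z(2) by linarith
      also have "norm \<dots> \<le> integral {s..t} (\<lambda>y. e * \<bar>v y\<bar>)"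
      proof (rule integral_norm_bound_integral)
        show "(\<lambda>y. (f z - f (w y)) * v y) integrable_on {s..t}"
          unfolding left_diff_distrib using vst by (intro Henstock_Kurzweil_Integration.integrable_diff integrable_on_mult_right) auto
        show "(\<lambda>y. e * \<bar>v y\<bar>) integrable_on {s..t}"
          using vst by (intro integrable_on_mult_right)
        fix y assume "y \<in> {s..t}"
        then have "\<bar>f z - f (w y)\<bar> \<le> e"
          using d1(2)[OF z(1)] d1(2)[OF near[of y]] by linarith
        then show "norm ((f z - f (w y)) * v y) \<le> e * \<bar>v y\<bar>"
          by (simp add: abs_mult mult_right_mono)
      qed
      finally show "\<bar>D t - D s\<bar> \<le> e * integral {s..t} (\<lambda>x. \<bar>v x\<bar>)" by simp
    qed
  qed
  then show "integral {a..b} (\<lambda>x. f (w x) * v x) = F (w b) - F (w a)"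
    unfolding D_def by simp
qed

lemma primitive_on_chain:
  fixes F f w v :: "real \<Rightarrow> real"
  assumes "primitive_on S w v" and "is_interval S"
    and "\<And>r. (F has_real_derivative f r) (at r)" and "continuous_on UNIV f"
  shows "primitive_on S (\<lambda>x. F (w x)) (\<lambda>x. f (w x) * v x)"
  unfolding primitive_on_def
proof (intro ballI impI)
  fix x y assume xy: "x \<in> S" "y \<in> S" "x \<le> y"
  have "{x..y} \<subseteq> S" using mem_is_interval_1_I[OF assms(2) xy(1,2)] by auto
  then have "primitive_on {x..y} w v" using assms(1) primitive_on_subset by blast
  from primitive_on_chain_Icc[OF this assms(3,4) xy(3)]
  show "(\<lambda>x. f (w x) * v x) absolutely_integrable_on {x..y} \<and>
    integral {x..y} (\<lambda>x. f (w x) * v x) = F (w y) - F (w x)" by blast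
qed

lemma primitive_on_linear:
  assumes "primitive_on S w v" "primitive_on S w' v'"
  shows "primitive_on S (\<lambda>x. c * w x + d * w' x) (\<lambda>x. c * v x + d * v' x)"
  unfolding primitive_on_def
proof (intro ballI impI conjI)
  fix x y assume xy: "x \<in> S" "y \<in> S" "x \<le> y"
  note 1 = primitive_onD[OF assms(1) xy] primitive_onD[OF assms(2) xy]
  show "(\<lambda>x. c * v x + d * v' x) absolutely_integrable_on {x..y}"
    using 1 by auto
  show "integral {x..y} (\<lambda>x. c * v x + d * v' x) = c * w y + d * w' y - (c * w x + d * w' x)"
    by (rule integral_unique) (use has_integral_add[OF has_integral_mult_right[OF 1(4), of c] has_integral_mult_right[OF 1(8), of d]] in \<open>simp add: algebra_simps\<close>)
qed

lemma primitive_on_cong: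
  assumes "primitive_on S w v" "\<And>x. x \<in> S \<Longrightarrow> w' x = w x" "\<And>x. v' x = v x"
  shows "primitive_on S w' v'"
proof -
  have "v' = v" using assms(3) by blast
  then show ?thesis using assms(1,2) by (simp add: primitive_on_def)
qed

text \<open>Polarization: \<open>w w' = ((w + w')^2 - (w - w')^2) / 4\<close>, so the product rule
  follows from the chain rule for the square.\<close>

lemma primitive_on_mult:
  assumes "primitive_on S w v" "primitive_on S w' v'" "is_interval S"
  shows "primitive_on S (\<lambda>x. w x * w' x) (\<lambda>x. v x * w' x + w x * v' x)"
proof -
  have sq: "primitive_on S (\<lambda>x. (1 * w x + d * w' x)\<^sup>2) (\<lambda>x. 2 * (1 * w x + d * w' x) * (1 * v x + d * v' x))" for d
    by (rule primitive_on_chain[OF primitive_on_linear[OF assms(1,2)] assms(3), where F = "\<lambda>x. x\<^sup>2"])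
       (auto intro!: derivative_eq_intros continuous_intros)
  show ?thesis
    by (rule primitive_on_cong[OF primitive_on_linear[OF sq[of 1] sq[of "-1"], of "1/4" "-1/4"]])
       (auto simp: field_simps power2_eq_square)
qed

lemma primitive_on_C1:
  assumes "\<And>x. x \<in> S \<Longrightarrow> (w has_real_derivative v x) (at x within S)" "continuous_on S v" "is_interval S"
  shows "primitive_on S w v"
  unfolding primitive_on_def
proof (intro ballI impI conjI)
  fix x y assume xy: "x \<in> S" "y \<in> S" "x \<le> y"
  have sub: "{x..y} \<subseteq> S" using mem_is_interval_1_I[OF assms(3) xy(1,2)] by auto
  show "v absolutely_integrable_on {x..y}"
    by (intro absolutely_integrable_continuous_real continuous_on_subset[OF assms(2) sub])
  show "integral {x..y} v = w y - w x"
    by (intro integral_unique fundamental_theorem_of_calculus xy)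
       (use assms(1) sub in \<open>auto simp: has_real_derivative_iff_has_vector_derivative intro!: has_vector_derivative_within_subset[OF _ sub]\<close>)
qed

lemma primitive_on_imp_deriv:
  assumes "primitive_on S w v" "continuous_on S v" "open S" "is_interval S" "x \<in> S"
  shows "(w has_real_derivative v x) (at x)"
proof -
  obtain e where e: "e > 0" "cball x e \<subseteq> S" using assms by (meson open_contains_cball)
  then have sub: "{x-e..x+e} \<subseteq> S" by (simp add: cball_eq_atLeastAtMost)
  have "((\<lambda>y. integral {x-e..y} v) has_real_derivative v x) (at x within {x-e..x+e})"
    by (rule integral_has_real_derivative) (use e sub assms in \<open>auto intro: continuous_on_subset\<close>)
  then have "((\<lambda>y. w (x-e) + integral {x-e..y} v) has_real_derivative v x) (at x within {x-e..x+e})"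
    by (auto intro!: derivative_eq_intros)
  then have "(w has_real_derivative v x) (at x within {x-e..x+e})"
  proof (rule has_field_derivative_transform_within[OF _ e(1)])
    fix y assume "y \<in> {x - e..x + e}"
    then show "w (x - e) + integral {x - e..y} v = w y"
      using primitive_onD(2)[OF assms(1), of "x-e" y] subsetD[OF sub, of y] subsetD[OF sub, of "x-e"] e(1) by auto
  qed (use e in auto)
  moreover have "at x within {x-e..x+e} = at x"
    using e by (intro at_within_interior) auto
  ultimately show ?thesis by simp
qed

section \<open>Weak derivatives\<close>

lemma set_integrable_lborel_imp_absolutely_integrable:
  fixes f :: "real \<Rightarrow> real"
  assumes "set_integrable lborel S f"
  shows "f absolutely_integrable_on S"
  using assms integrable_completion[of "\<lambda>x. indicator S x *\<^sub>R f x" lborel]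
    borel_measurable_integrable[of lborel "\<lambda>x. indicator S x *\<^sub>R f x"]
  unfolding set_integrable_def by blast

lemma absolutely_integrable_imp_set_integrable_lborel:
  fixes f :: "real \<Rightarrow> real"
  assumes "set_borel_measurable lborel S f" "f absolutely_integrable_on S"
  shows "set_integrable lborel S f"
  using assms integrable_completion[of "\<lambda>x. indicator S x *\<^sub>R f x" lborel]
  unfolding set_integrable_def set_borel_measurable_def by blast

lemma ae_eq_iff_negligible:
  "ae_eq u v \<longleftrightarrow> (\<exists>N. negligible N \<and> (\<forall>x. 0 < x \<longrightarrow> x \<notin> N \<longrightarrow> u x = v x))"
proof -
  have "ae_eq u v \<longleftrightarrow> (AE x in lebesgue. 0 < x \<longrightarrow> u x = v x)"
    unfolding ae_eq_def AE_completion_iff by (rule refl)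
  also have "\<dots> \<longleftrightarrow> (\<exists>N. negligible N \<and> {x. \<not> (0 < x \<longrightarrow> u x = v x)} \<subseteq> N)"
    by (rule eventually_ae_filter_negligible)
  also have "\<dots> \<longleftrightarrow> (\<exists>N. negligible N \<and> (\<forall>x. 0 < x \<longrightarrow> x \<notin> N \<longrightarrow> u x = v x))"
    by (simp add: subset_iff) metis
  finally show ?thesis .
qed

lemma ae_eq_refl [simp]: "ae_eq u u" by (simp add: ae_eq_def)

lemma ae_eq_sym: "ae_eq u v \<Longrightarrow> ae_eq v u"
  unfolding ae_eq_def by (elim eventually_mono) auto

lemma ae_eq_trans: "ae_eq u v \<Longrightarrow> ae_eq v w \<Longrightarrow> ae_eq u w"
  unfolding ae_eq_def by (elim eventually_elim2) auto

lemma ae_eq_integral: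
  assumes "ae_eq u v" "S \<subseteq> {0..}"
  shows "u absolutely_integrable_on S \<longleftrightarrow> v absolutely_integrable_on S" "integral S u = integral S v"
proof -
  obtain N where N: "negligible N" "\<And>x. 0 < x \<Longrightarrow> x \<notin> N \<Longrightarrow> u x = v x"
    using assms by (auto simp: ae_eq_iff_negligible)
  \<comment> \<open>\<open>ae_eq\<close> says nothing about the point 0, which may lie in
    \<open>S\<close>, so 0 joins the exceptional set.\<close>
  have N0: "negligible (insert 0 N)" using N by simp
  have eq: "\<And>x. x \<in> S - insert 0 N \<Longrightarrow> u x = v x" 
    using N(2) assms(2) by (force simp: order_less_le)
  show "u absolutely_integrable_on S \<longleftrightarrow> v absolutely_integrable_on S"
  proof
    assume "u absolutely_integrable_on S"
    then show "v absolutely_integrable_on S" by (rule absolutely_integrable_spike[OF _ N0]) (use eq in auto)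
  next
    assume "v absolutely_integrable_on S"
    then show "u absolutely_integrable_on S" by (rule absolutely_integrable_spike[OF _ N0]) (use eq in auto)
  qed
  show "integral S u = integral S v"
    by (rule integral_spike[OF N0]) (use eq in auto)
qed

lemma ae_eq_cong:
  assumes "ae_eq u v" shows "ae_eq (\<lambda>x. f x (u x)) (\<lambda>x. f x (v x))"
  using assms unfolding ae_eq_def by (elim eventually_mono) auto

text \<open>Dynkin's argument: closed intervals are stable under intersection and generate the Borel
  sets. So the integral of \<open>f\<close>, cut off outside \<open>{a..b}\<close>, vanishes over
  every Borel set, and such a density is zero almost everywhere.\<close>

lemma AE_eq_0_if_interval_integrals_0:
  fixes f :: "real \<Rightarrow> real"
  assumes f: "set_integrable lborel {a..b} f"
    and zero: "\<And>c d. a \<le> c \<Longrightarrow> c \<le> d \<Longrightarrow> d \<le> b \<Longrightarrow> integral {c..d} f = 0"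
  shows "AE x in lborel. x \<in> {a..b} \<longrightarrow> f x = 0"
proof -
  define g where "g x = indicator {a..b} x *\<^sub>R f x" for x
  have g: "integrable lborel g" using f unfolding set_integrable_def g_def[abs_def] .
  then have gs: "set_integrable lborel A g" if "A \<in> sets lborel" for A
    using that unfolding set_integrable_def by (rule integrable_mult_indicator[rotated])
  have gI: "(LINT x:{c..d}|lborel. g x) = 0" for c d
  proof (cases "max a c \<le> min b d")
    case True
    have "(LINT x:{c..d}|lborel. g x) = (LINT x:{max a c..min b d}|lborel. f x)"
      unfolding set_lebesgue_integral_def g_def
      by (intro Bochner_Integration.integral_cong) (auto split: split_indicator)
    also have "\<dots> = integral {max a c..min b d} f"
      by (intro set_borel_integral_eq_integral set_integrable_subset[OF f]) auto
    also have "\<dots> = 0" using True by (intro zero) auto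
    finally show ?thesis .
  next
    case False
    then have "(LINT x:{c..d}|lborel. g x) = (LINT x:{c..d}|lborel. 0)"
      unfolding set_lebesgue_integral_def g_def
      by (intro Bochner_Integration.integral_cong) (auto split: split_indicator)
    then show ?thesis by simp
  qed
  let ?G = "range (\<lambda>(c, d). {c..d::real})"
  \<comment> \<open>Complements in the induction need the integral over the whole line.\<close>
  have tot: "(LINT x:UNIV|lborel. g x) = 0"
  proof -
    have "(LINT x:UNIV|lborel. g x) = (LINT x:{a..b}|lborel. g x)"
      unfolding set_lebesgue_integral_def g_def
      by (intro Bochner_Integration.integral_cong) (auto split: split_indicator)
    then show ?thesis using gI by simp
  qed
  have sig: "sets lborel = sigma_sets UNIV ?G"
    by (simp add: borel_eq_atLeastAtMost)
  have "set_lebesgue_integral lborel A g = 0" if "A \<in> sets lborel" for A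
  proof -
    have "A \<in> sigma_sets UNIV ?G" using that sig by simp
    then show ?thesis
    proof (rule sigma_sets_induct_disjoint[rotated 2])
      show "Int_stable ?G"
      proof (rule Int_stableI)
        fix X Y assume "X \<in> ?G" "Y \<in> ?G"
        then obtain c d c' d' where "X = {c..d}" "Y = {c'..d'}" by auto
        then have "X \<inter> Y = {max c c'..min d d'}" by auto
        then show "X \<inter> Y \<in> ?G" by (metis rangeI case_prod_conv)
      qed
      show "?G \<subseteq> Pow UNIV" by simp
      show "set_lebesgue_integral lborel X g = 0" if "X \<in> ?G" for X
        using that gI by auto
      show "set_lebesgue_integral lborel {} g = 0" by (simp add: set_lebesgue_integral_def)
      show "set_lebesgue_integral lborel (UNIV - X) g = 0"
        if "X \<in> sigma_sets UNIV ?G" "set_lebesgue_integral lborel X g = 0" for X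
      proof -
        have X1: "X \<in> sets lborel" unfolding sig by (rule that(1))
        have X2: "UNIV - X \<in> sets lborel" using sets.compl_sets[OF X1] by simp
        have "(LINT x:X \<union> (UNIV - X)|lborel. g x) = (LINT x:X|lborel. g x) + (LINT x:UNIV-X|lborel. g x)"
          by (rule set_integral_Un[OF _ gs[OF X1] gs[OF X2]]) simp
        moreover have "X \<union> (UNIV - X) = UNIV" by auto
        ultimately show ?thesis using tot that(2) by simp
      qed
      show "set_lebesgue_integral lborel (\<Union>i. X i) g = 0"
        if "disjoint_family X" "range X \<subseteq> sigma_sets UNIV ?G"
          "\<And>i. set_lebesgue_integral lborel (X i) g = 0" for X :: "nat \<Rightarrow> real set"
      proof -
        have X: "X i \<in> sets lborel" for i unfolding sig using that(2) by (rule subsetD) simp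
        have "set_lebesgue_integral lborel (\<Union>i. X i) g = (\<Sum>i. set_lebesgue_integral lborel (X i) g)"
        proof (rule lebesgue_integral_countable_add[OF X])
          show "X i \<inter> X j = {}" if "i \<noteq> j" for i j
            using \<open>disjoint_family X\<close> that by (simp add: disjoint_family_on_def)
          show "set_integrable lborel (\<Union>i. X i) g" by (rule gs) (use X in auto)
        qed
        then show ?thesis using that(3) by simp
      qed
    qed
  qed
  then have "AE x in lborel. g x = 0" by (rule sigma_finite_measure.density_zero[OF lborel.sigma_finite_measure_axioms g])
  then show ?thesis
    by (rule eventually_mono) (auto simp: g_def)
qed

lemma L1loc_halflineD:
  assumes "L1loc_halfline u" "0 < a"
  shows "set_integrable lborel {a..b} u" "u absolutely_integrable_on {a..b}" "u integrable_on {a..b}"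
proof -
  show 1: "set_integrable lborel {a..b} u" using assms by (simp add: L1loc_halfline_def)
  then show 2: "u absolutely_integrable_on {a..b}" by (rule set_integrable_lborel_imp_absolutely_integrable)
  then show "u integrable_on {a..b}" using absolutely_integrable_on_def by blast
qed

text \<open>Integrability is available only away from 0, so the half-line is exhausted by the
  compact intervals from \<open>1/(n+1)\<close> to \<open>n+1\<close>.\<close>

lemma ae_eq_0_if_interval_integrals_0:
  assumes f: "L1loc_halfline f"
    and zero: "\<And>c d. 0 < c \<Longrightarrow> c \<le> d \<Longrightarrow> integral {c..d} f = 0"
  shows "ae_eq f (\<lambda>_. 0)"
proof -
  have "AE x in lborel. x \<in> {1 / real (Suc n)..real (Suc n)} \<longrightarrow> f x = 0" for n
  proof (rule AE_eq_0_if_interval_integrals_0)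
    show "set_integrable lborel {1 / real (Suc n)..real (Suc n)} f" by (rule L1loc_halflineD[OF f]) simp
    fix c d assume "1 / real (Suc n) \<le> c" "c \<le> d" "d \<le> real (Suc n)"
    then show "integral {c..d} f = 0" by (intro zero) (auto intro: order.strict_trans2[rotated])
  qed
  then have "AE x in lborel. \<forall>n. x \<in> {1 / real (Suc n)..real (Suc n)} \<longrightarrow> f x = 0"
    by (subst AE_all_countable) blast
  then show ?thesis unfolding ae_eq_def
  proof (rule eventually_mono, intro impI)
    fix x :: real assume *: "\<forall>n. x \<in> {1 / real (Suc n)..real (Suc n)} \<longrightarrow> f x = 0" and x: "0 < x"
    obtain n1 where n1: "1 / real (Suc n1) < x" using x by (metis nat_approx_posE)
    obtain n2 where n2: "x < real n2" using reals_Archimedean2 by blast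
    have "1 / real (Suc (max n1 n2)) \<le> 1 / real (Suc n1)" by (intro divide_left_mono) auto
    then have "x \<in> {1 / real (Suc (max n1 n2))..real (Suc (max n1 n2))}" using n1 n2 by auto
    then show "f x = 0" using * by blast
  qed
qed

lemma L1loc_imp_measurable:
  assumes "L1loc_halfline u"
  shows "set_borel_measurable lborel {0<..} u"
  unfolding set_borel_measurable_def
proof (rule borel_measurable_LIMSEQ_metric)
  show "(\<lambda>x. indicator {1 / real (Suc n)..real (Suc n)} x *\<^sub>R u x) \<in> borel_measurable lborel" for n
    using L1loc_halflineD(1)[OF assms, of "1 / real (Suc n)" "real (Suc n)"]
    unfolding set_integrable_def by (intro borel_measurable_integrable) auto
  fix x :: real
  show "(\<lambda>n. indicator {1 / real (Suc n)..real (Suc n)} x *\<^sub>R u x) \<longlonglongrightarrow> indicator {0<..} x *\<^sub>R u x"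
  proof (cases "0 < x")
    case True
    have "eventually (\<lambda>n. 1 / real (Suc n) < x) sequentially"
      using True LIMSEQ_inverse_real_of_nat by (intro order_tendstoD[where y=0]) (auto simp: inverse_eq_divide)
    moreover have "eventually (\<lambda>n. x < real (Suc n)) sequentially"
      using filterlim_real_sequentially eventually_sequentially_Suc[of "\<lambda>n. x < real n"]
      by (simp add: filterlim_at_top_dense)
    ultimately have "eventually (\<lambda>n. indicator {1 / real (Suc n)..real (Suc n)} x *\<^sub>R u x = indicator {0<..} x *\<^sub>R u x) sequentially"
      by eventually_elim (use True in auto)
    then show ?thesis by (rule tendsto_eventually)
  next
    case False
    have "x \<notin> {1 / real (Suc n)..real (Suc n)}" for n
    proof
      assume "x \<in> {1 / real (Suc n)..real (Suc n)}"
      then have "1 / real (Suc n) \<le> x" by simp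
      moreover have "0 < 1 / real (Suc n)" by simp
      ultimately show False using False by linarith
    qed
    then show ?thesis using False by simp
  qed
qed

section \<open>Testing with C1 functions of compact support\<close>

lemma test_integral_eq:
  assumes u: "L1loc_halfline u" and h: "continuous_on UNIV h" and a: "0 < a"
    and supp: "\<And>x. x \<notin> {a..b} \<Longrightarrow> h x = 0"
  shows "(LINT x:{0<..}|lborel. u x * h x) = integral {a..b} (\<lambda>x. u x * h x)"
proof -
  have "(LINT x:{0<..}|lborel. u x * h x) = (LINT x:{a..b}|lborel. u x * h x)"
    unfolding set_lebesgue_integral_def
    by (intro Bochner_Integration.integral_cong) (use a supp in \<open>auto split: split_indicator\<close>)
  also have "\<dots> = integral {a..b} (\<lambda>x. u x * h x)"
  proof (rule set_borel_integral_eq_integral(2), rule absolutely_integrable_imp_set_integrable_lborel)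
    have "(\<lambda>x. h x * u x) absolutely_integrable_on {a..b}"
      by (intro absolutely_integrable_continuous_mult continuous_on_subset[OF h] L1loc_halflineD[OF u] a) auto
    then show "(\<lambda>x. u x * h x) absolutely_integrable_on {a..b}" by (simp add: mult.commute)
    have 1: "(\<lambda>x. indicator {a..b} x *\<^sub>R u x) \<in> borel_measurable borel"
      using borel_measurable_integrable[OF L1loc_halflineD(1)[OF u a, of b, unfolded set_integrable_def]] by simp
    have 2: "h \<in> borel_measurable borel"
      using h by (rule borel_measurable_continuous_onI)
    show "set_borel_measurable lborel {a..b} (\<lambda>x. u x * h x)"
      using borel_measurable_times[OF 1 2] by (simp add: set_borel_measurable_def mult.assoc)
  qed
  finally show ?thesis .
qed

lemma deriv_eq_0_outside:
  assumes "\<And>x. x \<notin> {a..b} \<Longrightarrow> F x = (0::real)" "x \<notin> {a..b}" "(F has_real_derivative d) (at x)"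
  shows "d = 0"
proof -
  have "open (- {a..b})" by (simp add: open_Compl)
  then have "((\<lambda>_. 0) has_real_derivative d) (at x)"
    using assms by (intro has_field_derivative_transform_within_open[OF assms(3), of "- {a..b}"]) auto
  then show ?thesis using DERIV_unique DERIV_const by blast
qed

lemma has_weak_derivD:
  assumes "has_weak_deriv u v" "\<And>x. (F has_real_derivative h x) (at x)" "continuous_on UNIV h"
    "0 < a" and supp: "\<And>x. x \<notin> {a..b} \<Longrightarrow> F x = 0"
  shows "integral {a..b} (\<lambda>x. u x * h x) = - integral {a..b} (\<lambda>x. v x * F x)"
proof -
  have "test_function F"
    unfolding test_function_def C1_differentiable_on_def
    using assms by (auto simp: has_real_derivative_iff_has_vector_derivative)
  then have "(LINT x:{0<..}|lborel. u x * deriv F x) = - (LINT x:{0<..}|lborel. v x * F x)"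
    using assms(1) by (auto simp: has_weak_deriv_def)
  moreover have "deriv F x = h x" for x using assms(2) by (rule DERIV_imp_deriv)
  moreover have "(LINT x:{0<..}|lborel. u x * h x) = integral {a..b} (\<lambda>x. u x * h x)"
    using assms deriv_eq_0_outside[of a b F] by (intro test_integral_eq) (auto simp: has_weak_deriv_def)
  moreover have "(LINT x:{0<..}|lborel. v x * F x) = integral {a..b} (\<lambda>x. v x * F x)"
  proof (rule test_integral_eq)
    show "continuous_on UNIV F"
      using assms(2) by (intro continuous_at_imp_continuous_on) (auto intro: DERIV_isCont)
  qed (use assms in \<open>auto simp: has_weak_deriv_def\<close>)
  ultimately show ?thesis by simp
qed

lemma has_weak_derivI:
  assumes "L1loc_halfline u" "L1loc_halfline v"
    and "\<And>F h a b. 0 < a \<Longrightarrow> (\<And>x. (F has_real_derivative h x) (at x)) \<Longrightarrow> continuous_on UNIV h \<Longrightarrow>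
      (\<And>x. x \<notin> {a..b} \<Longrightarrow> F x = 0) \<Longrightarrow> a \<le> b \<Longrightarrow> F a = 0 \<Longrightarrow> F b = 0 \<Longrightarrow>
      integral {a..b} (\<lambda>x. u x * h x) = - integral {a..b} (\<lambda>x. v x * F x)"
  shows "has_weak_deriv u v"
  unfolding has_weak_deriv_def
proof (intro conjI allI impI assms(1,2))
  fix F assume "test_function F"
  then obtain h a b where F: "\<And>x. (F has_real_derivative h x) (at x)" "continuous_on UNIV h" "0 < a"
    "\<And>x. x \<notin> {a..b} \<Longrightarrow> F x = 0"
    unfolding test_function_def C1_differentiable_on_def has_real_derivative_iff_has_vector_derivative by auto
  \<comment> \<open>Enlarging the support interval to \<open>{a/2..b'}\<close> makes
    \<open>F\<close> vanish at both end points and keeps the interval nonempty.\<close>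
  define b' where "b' = max a b + 1"
  have supp: "F x = 0" if "x \<notin> {a/2..b'}" for x using that F(3) by (intro F(4)) (auto simp: b'_def)
  have "deriv F x = h x" for x using F(1) by (rule DERIV_imp_deriv)
  moreover have "(LINT x:{0<..}|lborel. u x * h x) = integral {a/2..b'} (\<lambda>x. u x * h x)"
  proof (rule test_integral_eq[OF assms(1) F(2)])
    show "h x = 0" if "x \<notin> {a/2..b'}" for x by (rule deriv_eq_0_outside[OF supp that F(1)])
  qed (use F(3) in auto)
  moreover have "(LINT x:{0<..}|lborel. v x * F x) = integral {a/2..b'} (\<lambda>x. v x * F x)"
  proof (rule test_integral_eq)
    show "continuous_on UNIV F"
      using F by (intro continuous_at_imp_continuous_on) (auto intro: DERIV_isCont)
  qed (use assms F supp in auto)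
  moreover have "integral {a/2..b'} (\<lambda>x. u x * h x) = - integral {a/2..b'} (\<lambda>x. v x * F x)"
    using F(3) by (intro assms(3) F(1,2) supp F(4)) (auto simp: b'_def)
  ultimately show "(LINT x:{0<..}|lborel. u x * deriv F x) = - (LINT x:{0<..}|lborel. v x * F x)"
    by simp
qed

text \<open>Trapezoids that approximate the indicator of the open interval between \<open>a\<close>
  and \<open>b\<close>. Derivatives of test functions have to be continuous, so these stand in for
  the indicator itself.\<close>

definition plateau :: "nat \<Rightarrow> real \<Rightarrow> real \<Rightarrow> real \<Rightarrow> real" where
  "plateau n a b x = min 1 (real n * max 0 (min (x - a) (b - x)))"

lemma plateau_bounds: "0 \<le> plateau n a b x" "plateau n a b x \<le> 1"
  by (auto simp: plateau_def)

lemma plateau_eq_0: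
  assumes "x \<le> a \<or> b \<le> x" shows "plateau n a b x = 0"
proof -
  have "min (x - a) (b - x) \<le> 0" using assms by linarith
  then show ?thesis by (simp add: plateau_def max_absorb1)
qed

lemma continuous_on_plateau [continuous_intros]: "continuous_on S (plateau n a b)"
  unfolding plateau_def by (intro continuous_intros)

lemma plateau_tendsto:
  assumes "a < x" "x < b" shows "(\<lambda>n. plateau n a b x) \<longlonglongrightarrow> 1"
proof -
  define d where "d = min (x - a) (b - x)"
  have d: "d > 0" using assms by (simp add: d_def)
  obtain N where N: "1 / d < real N" using reals_Archimedean2 by blast
  have "eventually (\<lambda>n. plateau n a b x = 1) sequentially"
  proof (rule eventually_sequentiallyI[of N])
    fix n assume "N \<le> n"
    then have "1 / d \<le> real n" using N by linarith
    then have "1 \<le> real n * d" using d by (simp add: field_simps)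
    then show "plateau n a b x = 1" using d by (simp add: plateau_def d_def[symmetric])
  qed
  then show ?thesis by (rule tendsto_eventually)
qed

lemma integral_plateau_tendsto:
  assumes f: "f absolutely_integrable_on {lo..hi}" and ab: "lo \<le> a" "a \<le> b" "b \<le> hi"
  shows "(\<lambda>n. integral {lo..hi} (\<lambda>x. f x * plateau n a b x)) \<longlonglongrightarrow> integral {a..b} f"
proof -
  have "(\<lambda>n. integral {lo..hi} (\<lambda>x. f x * plateau n a b x)) \<longlonglongrightarrow>
      integral {lo..hi} (\<lambda>x. if x \<in> {a<..<b} then f x else 0)"
  proof (rule dominated_convergence(2)[where h = "\<lambda>x. norm (f x)"])
    show "(\<lambda>x. f x * plateau n a b x) integrable_on {lo..hi}" for n
      using absolutely_integrable_continuous_mult[OF continuous_on_plateau f, of n a b]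
      by (simp add: absolutely_integrable_on_def mult.commute)
    show "(\<lambda>x. norm (f x)) integrable_on {lo..hi}" using f by (simp add: absolutely_integrable_on_def)
    show "norm (f x * plateau n a b x) \<le> norm (f x)" for n x
      using plateau_bounds[of n a b x] by (simp add: abs_mult mult_left_le)
    show "(\<lambda>n. f x * plateau n a b x) \<longlonglongrightarrow> (if x \<in> {a<..<b} then f x else 0)" for x
    proof (cases "x \<in> {a<..<b}")
      case True
      then have "(\<lambda>n. f x * plateau n a b x) \<longlonglongrightarrow> f x * 1"
        by (intro tendsto_intros plateau_tendsto) auto
      then show ?thesis using True by simp
    next
      case False
      then have "plateau n a b x = 0" for n by (intro plateau_eq_0) auto
      then show ?thesis using False by auto
    qed
  qed
  also have "integral {lo..hi} (\<lambda>x. if x \<in> {a<..<b} then f x else 0) = integral ({a<..<b} \<inter> {lo..hi}) f"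
    by (rule integral_restrict_Int)
  also have "{a<..<b} \<inter> {lo..hi} = {a<..<b}" using ab by auto
  also have "integral {a<..<b} f = integral {a..b} f"
    by (rule integral_open_interval_real[symmetric])
  finally show ?thesis .
qed

lemma continuous_antiderivative:
  fixes h :: "real \<Rightarrow> real"
  assumes "continuous_on UNIV h"
  obtains F where "\<And>x. (F has_real_derivative h x) (at x)"
proof -
  have "isCont h x" for x using assms by (simp add: continuous_on_eq_continuous_at)
  then have "\<exists>F. \<forall>x::real. -\<infinity> < ereal x \<longrightarrow> ereal x < \<infinity> \<longrightarrow> (F has_vector_derivative h x) (at x)"
    by (intro einterval_antiderivative) auto
  then show ?thesis using that by (auto simp: has_real_derivative_iff_has_vector_derivative)
qed

text \<open>Two trapezoids, weighted so that their total integral is 0, combine to the derivative of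
  a compactly supported test function. Testing shows that the integral of \<open>g\<close> against a
  trapezoid is proportional to the integral of the trapezoid; letting the trapezoids tend to
  indicators passes this on to intervals. The reference interval \<open>{1..2}\<close> has length 1,
  so the integral of \<open>g\<close> over it is the constant.\<close>

lemma du_bois_reymond:
  fixes g :: "real \<Rightarrow> real"
  assumes g: "\<And>a b. 0 < a \<Longrightarrow> g absolutely_integrable_on {a..b}"
    and zero: "\<And>F h a b. 0 < a \<Longrightarrow> a \<le> b \<Longrightarrow> (\<And>x. (F has_real_derivative h x) (at x)) \<Longrightarrow> continuous_on UNIV h \<Longrightarrow>
      (\<And>x. x \<notin> {a..b} \<Longrightarrow> F x = 0) \<Longrightarrow> F a = 0 \<Longrightarrow> F b = 0 \<Longrightarrow> integral {a..b} (\<lambda>x. g x * h x) = 0"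
  shows "\<exists>c. \<forall>a b. 0 < a \<longrightarrow> a \<le> b \<longrightarrow> integral {a..b} g = c * (b - a)"
proof (intro exI[of _ "integral {1..2} g"] allI impI)
  fix a b :: real assume ab: "0 < a" "a \<le> b"
  define lo hi where "lo = min a 1" and "hi = max b 2"
  have lohi: "0 < lo" "lo \<le> a" "b \<le> hi" "lo \<le> 1" "2 \<le> hi" "lo \<le> hi" using ab by (auto simp: lo_def hi_def)
  let ?I = "\<lambda>n a b. integral {lo..hi} (plateau n a b)"
  let ?G = "\<lambda>n a b. integral {lo..hi} (\<lambda>x. g x * plateau n a b x)"
  have pi: "plateau n a b integrable_on {lo..hi}" for n a b
    by (intro integrable_continuous_real continuous_intros)
  have gpi: "(\<lambda>x. g x * plateau n a b x) integrable_on {lo..hi}" for n a b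
  proof -
    have "(\<lambda>x. plateau n a b x * g x) absolutely_integrable_on {lo..hi}"
      by (intro absolutely_integrable_continuous_mult continuous_intros g lohi(1))
    then show ?thesis by (simp add: absolutely_integrable_on_def mult.commute)
  qed
  have eq: "?I n 1 2 * ?G n a b = ?I n a b * ?G n 1 2" for n
  proof -
    define h where "h x = ?I n 1 2 * plateau n a b x - ?I n a b * plateau n 1 2 x" for x
    have h: "continuous_on S h" for S unfolding h_def by (intro continuous_intros)
    have h0: "h x = 0" if "x \<le> lo \<or> hi \<le> x" for x
      using that lohi by (auto simp: h_def plateau_eq_0)
    have hint: "integral {lo..hi} h = 0"
      unfolding h_def using pi by (subst Henstock_Kurzweil_Integration.integral_diff) (auto intro!: integrable_on_mult_right)
    obtain F0 where F0: "\<And>x. (F0 has_real_derivative h x) (at x)"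
      using continuous_antiderivative[OF h] by blast
    define F where "F x = F0 x - F0 lo" for x
    have F: "(F has_real_derivative h x) (at x)" for x
      unfolding F_def by (auto intro!: derivative_eq_intros F0)
    have ftc: "integral {x..y} h = F y - F x" if "x \<le> y" for x y
      using that F by (intro integral_unique fundamental_theorem_of_calculus)
         (auto simp: has_real_derivative_iff_has_vector_derivative intro: has_vector_derivative_at_within)
    have Flo: "F lo = 0" by (simp add: F_def)
    have Fhi: "F hi = 0" using ftc[of lo hi] hint Flo lohi by simp
    have supp: "F x = 0" if "x \<notin> {lo..hi}" for x
    proof (cases "x < lo")
      case True
      have "integral {x..lo} h = integral {x..lo} (\<lambda>_. 0)"
        by (rule Henstock_Kurzweil_Integration.integral_cong) (use h0 in auto)
      then show ?thesis using ftc[of x lo] True Flo by simp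
    next
      case False
      have "integral {hi..x} h = integral {hi..x} (\<lambda>_. 0)"
        by (rule Henstock_Kurzweil_Integration.integral_cong) (use h0 in auto)
      then show ?thesis using ftc[of hi x] False that Fhi by simp
    qed
    have "integral {lo..hi} (\<lambda>x. g x * h x) = 0"
      by (rule zero[OF lohi(1,6) F h supp Flo Fhi])
    also have "(\<lambda>x. g x * h x) = (\<lambda>x. ?I n 1 2 * (g x * plateau n a b x) - ?I n a b * (g x * plateau n 1 2 x))"
      by (simp add: h_def algebra_simps)
    also have "integral {lo..hi} \<dots> = ?I n 1 2 * ?G n a b - ?I n a b * ?G n 1 2"
      using gpi by (subst Henstock_Kurzweil_Integration.integral_diff) (auto intro!: integrable_on_mult_right)
    finally show ?thesis by simp
  qed
  have one: "(\<lambda>_. 1::real) absolutely_integrable_on {lo..hi}" by simp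
  have I: "(\<lambda>n. ?I n a b) \<longlonglongrightarrow> b - a" if "lo \<le> a" "a \<le> b" "b \<le> hi" for a b
    using integral_plateau_tendsto[OF one that] that by simp
  have G: "(\<lambda>n. ?G n a b) \<longlonglongrightarrow> integral {a..b} g" if "lo \<le> a" "a \<le> b" "b \<le> hi" for a b
    using integral_plateau_tendsto[OF g[OF lohi(1)] that] by simp
  have "(\<lambda>n. ?I n 1 2 * ?G n a b) \<longlonglongrightarrow> (2 - 1) * integral {a..b} g"
    using lohi ab by (intro tendsto_mult I G) auto
  moreover have "(\<lambda>n. ?I n 1 2 * ?G n a b) \<longlonglongrightarrow> (b - a) * integral {1..2} g"
    unfolding eq using lohi ab by (intro tendsto_mult I G) auto
  ultimately have "(2 - 1) * integral {a..b} g = (b - a) * integral {1..2} g"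
    by (rule LIMSEQ_unique)
  then show "integral {a..b} g = integral {1..2} g * (b - a)" by (simp add: mult.commute)
qed

section \<open>Continuous representatives and boundary values\<close>

lemma exists_primitive_Ioi:
  fixes v :: "real \<Rightarrow> real"
  assumes "\<And>a b. 0 < a \<Longrightarrow> v absolutely_integrable_on {a..b}"
  shows "\<exists>w. primitive_on {0<..} w v"
proof -
  \<comment> \<open>The base point is 1 because \<open>v\<close> may fail to be integrable up to
    0.\<close>
  define w where "w x = (if 1 \<le> x then integral {1..x} v else - integral {x..1} v)" for x
  have int: "v integrable_on {a..b}" if "0 < a" for a b
    using assms[OF that] absolutely_integrable_on_def by blast
  have comb: "integral {a..b} v + integral {b..c} v = integral {a..c} v" if "0 < a" "a \<le> b" "b \<le> c" for a b c
    by (intro Henstock_Kurzweil_Integration.integral_combine that int)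
  have "primitive_on {0<..} w v"
    unfolding primitive_on_def
  proof (intro ballI impI conjI)
    fix x y :: real assume xy: "x \<in> {0<..}" "y \<in> {0<..}" "x \<le> y"
    show "v absolutely_integrable_on {x..y}" using xy by (intro assms) auto
    show "integral {x..y} v = w y - w x"
    proof (cases "1 \<le> x")
      case True
      then show ?thesis using comb[of 1 x y] xy by (simp add: w_def)
    next
      case False
      show ?thesis
      proof (cases "1 \<le> y")
        case True
        then show ?thesis using comb[of x 1 y] xy False by (simp add: w_def)
      next
        case False
        then show ?thesis using comb[of x y 1] xy by (simp add: w_def)
      qed
    qed
  qed
  then show ?thesis by (intro exI[of _ w])
qed

lemma primitive_on_Ioi_extend:
  assumes w: "primitive_on {0<..} w v" and v: "v absolutely_integrable_on {0..1}"
  obtains w' where "primitive_on {0..} w' v" "\<And>x. 0 < x \<Longrightarrow> w' x = w x"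
proof -
  define w' where "w' x = (if x = 0 then w 1 - integral {0..1} v else w x)" for x
  have ai: "v absolutely_integrable_on {0..x}" for x
  proof (cases "x \<le> 1")
    case True
    then show ?thesis using absolutely_integrable_on_subinterval[OF v, of 0 x] by (cases "0 \<le> x") auto
  next
    case False
    then show ?thesis
      using absolutely_integrable_on_combine[OF v, of x] primitive_onD(1)[OF w, of 1 x] by auto
  qed
  have i: "v integrable_on {0..x}" for x using ai absolutely_integrable_on_def by blast
  have zero: "integral {0..x} v = w x - (w 1 - integral {0..1} v)" if "0 < x" for x
  proof (cases "x \<le> 1")
    case True
    have "integral {0..x} v + integral {x..1} v = integral {0..1} v"
      using True that by (intro Henstock_Kurzweil_Integration.integral_combine i) auto
    then show ?thesis using primitive_onD(2)[OF w, of x 1] True that by simp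
  next
    case False
    have "integral {0..1} v + integral {1..x} v = integral {0..x} v"
      using False that by (intro Henstock_Kurzweil_Integration.integral_combine i) auto
    then show ?thesis using primitive_onD(2)[OF w, of 1 x] False that by simp
  qed
  have "primitive_on {0..} w' v"
    unfolding primitive_on_def
  proof (intro ballI impI)
    fix x y :: real assume xy: "x \<in> {0..}" "y \<in> {0..}" "x \<le> y"
    consider "x = 0" "y = 0" | "x = 0" "0 < y" | "0 < x" using xy(1,2) by (auto simp: le_less)
    then show "v absolutely_integrable_on {x..y} \<and> integral {x..y} v = w' y - w' x"
    proof cases
      case 1
      then show ?thesis using ai[of 0] by simp
    next
      case 2
      then show ?thesis using ai[of y] zero[of y] by (simp add: w'_def)
    next
      case 3
      then show ?thesis using primitive_onD(1,2)[OF w, of x y] xy by (simp add: w'_def)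
    qed
  qed
  then show ?thesis by (rule that) (simp add: w'_def)
qed

lemma L1loc_if_continuous:
  assumes "continuous_on {0<..} w"
  shows "L1loc_halfline w"
  unfolding L1loc_halfline_def
proof (intro allI impI)
  fix a b :: real assume "0 < a"
  then show "set_integrable lborel {a..b} w"
    by (intro borel_integrable_atLeastAtMost' continuous_on_subset[OF assms]) auto
qed

text \<open>Integrating a classical primitive \<open>V\<close> of \<open>v\<close> by parts shows
  that \<open>u - V\<close> is orthogonal to all derivatives of test functions. By
  \<open>du_bois_reymond\<close> its interval integrals are those of a constant \<open>c\<close>, so
  \<open>V + c\<close> is the continuous representative.\<close>

lemma has_weak_deriv_imp_primitive:
  assumes "has_weak_deriv u v"
  obtains w where "primitive_on {0<..} w v" "ae_eq w u"
proof -
  have L: "L1loc_halfline u" "L1loc_halfline v" using assms by (auto simp: has_weak_deriv_def)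
  obtain V where V: "primitive_on {0<..} V v"
    using exists_primitive_Ioi[of v] L1loc_halflineD(2)[OF L(2)] by blast
  have cV: "continuous_on {0<..} V" by (rule primitive_on_Ioi_continuous[OF V])
  have LV: "L1loc_halfline V" by (rule L1loc_if_continuous[OF cV])
  define g where "g x = u x - V x" for x
  have gi: "g absolutely_integrable_on {a..b}" if "0 < a" for a b
    unfolding g_def using L1loc_halflineD(2)[OF L(1) that] L1loc_halflineD(2)[OF LV that] by (rule set_integral_diff)
  have "\<exists>c. \<forall>a b. 0 < a \<longrightarrow> a \<le> b \<longrightarrow> integral {a..b} g = c * (b - a)"
  proof (rule du_bois_reymond[OF gi])
    fix F h a b assume ab: "0 < a" "a \<le> b" and F: "\<And>x. (F has_real_derivative h x) (at x)"
      and h: "continuous_on UNIV h" and supp: "\<And>x. x \<notin> {a..b} \<Longrightarrow> F x = 0" "F a = 0" "F b = 0"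
    have cF: "continuous_on S F" for S
      using F by (intro continuous_at_imp_continuous_on) (auto intro: DERIV_isCont)
    have ch: "continuous_on {a..b} h" by (rule continuous_on_subset[OF h]) auto
    have Vi: "primitive_on {a..b} V v" by (rule primitive_on_subset[OF V]) (use ab in auto)
    have Fp: "primitive_on {a..b} F h"
      by (rule primitive_on_C1[OF _ ch]) (auto intro: has_field_derivative_at_within[OF F])
    have i1: "(\<lambda>x. h x * u x) integrable_on {a..b}" "(\<lambda>x. h x * V x) integrable_on {a..b}" "(\<lambda>x. F x * v x) integrable_on {a..b}"
      using absolutely_integrable_continuous_mult[OF ch L1loc_halflineD(2)[OF L(1) ab(1)]]
        absolutely_integrable_continuous_mult[OF ch L1loc_halflineD(2)[OF LV ab(1)]]
        absolutely_integrable_continuous_mult[OF cF L1loc_halflineD(2)[OF L(2) ab(1)]]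
      by (auto simp: absolutely_integrable_on_def)
    have "integral {a..b} (\<lambda>x. v x * F x + V x * h x) = V b * F b - V a * F a"
      using primitive_onD(2)[OF primitive_on_mult[OF Vi Fp], of a b] ab by (simp add: is_interval_cc)
    also have "integral {a..b} (\<lambda>x. v x * F x + V x * h x) = integral {a..b} (\<lambda>x. v x * F x) + integral {a..b} (\<lambda>x. V x * h x)"
      using i1 by (intro Henstock_Kurzweil_Integration.integral_add) (auto simp: mult.commute)
    finally have "integral {a..b} (\<lambda>x. V x * h x) = - integral {a..b} (\<lambda>x. v x * F x)"
      using supp by simp
    moreover have "integral {a..b} (\<lambda>x. u x * h x) = - integral {a..b} (\<lambda>x. v x * F x)"
      by (rule has_weak_derivD[OF assms F h ab(1) supp(1)])
    moreover have "integral {a..b} (\<lambda>x. g x * h x) = integral {a..b} (\<lambda>x. u x * h x) - integral {a..b} (\<lambda>x. V x * h x)"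
      unfolding g_def left_diff_distrib using i1
      by (intro Henstock_Kurzweil_Integration.integral_diff) (auto simp: mult.commute)
    ultimately show "integral {a..b} (\<lambda>x. g x * h x) = 0" by simp
  qed
  then obtain c where c: "\<And>a b. 0 < a \<Longrightarrow> a \<le> b \<Longrightarrow> integral {a..b} g = c * (b - a)" by blast
  define w where "w x = V x + c" for x
  have pw: "primitive_on {0<..} w v" using V by (simp add: primitive_on_def w_def)
  have "ae_eq (\<lambda>x. u x - w x) (\<lambda>_. 0)"
  proof (rule ae_eq_0_if_interval_integrals_0)
    have Lw: "L1loc_halfline w" by (intro L1loc_if_continuous primitive_on_Ioi_continuous[OF pw])
    show "L1loc_halfline (\<lambda>x. u x - w x)"
      using L(1) Lw unfolding L1loc_halfline_def by (simp add: set_integral_diff)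
    fix a b :: real assume ab: "0 < a" "a \<le> b"
    have "integral {a..b} (\<lambda>x. u x - w x) = integral {a..b} (\<lambda>x. g x - c)"
      by (simp add: g_def w_def algebra_simps)
    also have "\<dots> = integral {a..b} g - integral {a..b} (\<lambda>_. c)"
      using gi[OF ab(1), of b] by (intro Henstock_Kurzweil_Integration.integral_diff) (auto simp: absolutely_integrable_on_def)
    also have "\<dots> = 0" using c[OF ab] ab by simp
    finally show "integral {a..b} (\<lambda>x. u x - w x) = 0" .
  qed
  then have "ae_eq w u" unfolding ae_eq_def by (elim eventually_mono) auto
  with pw show ?thesis by (rule that)
qed

text \<open>Function and derivative may both be replaced by almost everywhere equal versions,
  because \<open>weak_deriv\<close> is a choice and agrees with an explicit derivative only up to a
  null set.\<close>

lemma has_weak_deriv_if_primitive: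
  assumes w: "primitive_on {0<..} w v'" and u: "L1loc_halfline u" "ae_eq w u"
    and v: "L1loc_halfline v" "ae_eq v' v"
  shows "has_weak_deriv u v"
proof (rule has_weak_derivI[OF u(1) v(1)])
  fix F h :: "real \<Rightarrow> real" and a b :: real
  assume ab: "0 < a" "a \<le> b" and F: "\<And>x. (F has_real_derivative h x) (at x)"
    and h: "continuous_on UNIV h" and supp: "F a = 0" "F b = 0"
  have cF: "continuous_on S F" for S
    using F by (intro continuous_at_imp_continuous_on) (auto intro: DERIV_isCont)
  have ch: "continuous_on {a..b} h" by (rule continuous_on_subset[OF h]) auto
  have wi: "primitive_on {a..b} w v'" by (rule primitive_on_subset[OF w]) (use ab in auto)
  have Fp: "primitive_on {a..b} F h"
    by (rule primitive_on_C1[OF _ ch]) (auto intro: has_field_derivative_at_within[OF F])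
  have i1: "(\<lambda>x. h x * w x) integrable_on {a..b}" "(\<lambda>x. F x * v' x) integrable_on {a..b}"
    using absolutely_integrable_continuous_mult[OF cF primitive_onD(1)[OF wi]] ab
    by (auto simp: absolutely_integrable_on_def intro!: integrable_continuous_real continuous_intros ch primitive_on_Icc_continuous[OF wi])
  have "integral {a..b} (\<lambda>x. v' x * F x + w x * h x) = w b * F b - w a * F a"
    using primitive_onD(2)[OF primitive_on_mult[OF wi Fp], of a b] ab by (simp add: is_interval_cc)
  also have "integral {a..b} (\<lambda>x. v' x * F x + w x * h x) = integral {a..b} (\<lambda>x. v' x * F x) + integral {a..b} (\<lambda>x. w x * h x)"
    using i1 by (intro Henstock_Kurzweil_Integration.integral_add) (auto simp: mult.commute)
  finally have "integral {a..b} (\<lambda>x. w x * h x) = - integral {a..b} (\<lambda>x. v' x * F x)"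
    using supp by simp
  moreover have "integral {a..b} (\<lambda>x. w x * h x) = integral {a..b} (\<lambda>x. u x * h x)"
    using ab by (intro ae_eq_integral(2)[OF ae_eq_cong[OF u(2), of "\<lambda>x y. y * h x"]]) auto
  moreover have "integral {a..b} (\<lambda>x. v' x * F x) = integral {a..b} (\<lambda>x. v x * F x)"
    using ab by (intro ae_eq_integral(2)[OF ae_eq_cong[OF v(2), of "\<lambda>x y. y * F x"]]) auto
  ultimately show "integral {a..b} (\<lambda>x. u x * h x) = - integral {a..b} (\<lambda>x. v x * F x)" by simp
qed

text \<open>Only points to the right of \<open>x\<close> enter, so that \<open>x = 0\<close> is
  covered; this is what makes \<open>value_at_0\<close> well defined.\<close>

lemma ae_eq_continuous_imp_eq:
  assumes "continuous_on S w" "continuous_on S w'" "ae_eq w w'" "{x..} \<subseteq> S" "0 \<le> x"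
  shows "w x = w' x"
proof (rule ccontr)
  assume ne: "w x \<noteq> w' x"
  obtain N where N: "negligible N" "\<And>x. 0 < x \<Longrightarrow> x \<notin> N \<Longrightarrow> w x = w' x"
    using assms by (auto simp: ae_eq_iff_negligible)
  have "x \<in> S" "0 < \<bar>w x - w' x\<bar>" using ne assms(4) by auto
  moreover have "continuous_on S (\<lambda>x. w x - w' x)" by (intro continuous_intros assms)
  ultimately obtain d where d: "d > 0" "\<And>y. y \<in> S \<Longrightarrow> dist y x < d \<Longrightarrow> dist (w y - w' y) (w x - w' x) < \<bar>w x - w' x\<bar>"
    unfolding continuous_on_iff by blast
  have "{x<..<x+d} \<subseteq> N"
  proof
    fix y assume y: "y \<in> {x<..<x+d}"
    then have "dist (w y - w' y) (w x - w' x) < \<bar>w x - w' x\<bar>"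
      using assms(4) by (intro d(2) subsetD[OF assms(4)]) (auto simp: dist_real_def)
    then have "w y \<noteq> w' y" by (auto simp: dist_real_def)
    then show "y \<in> N" using N(2)[of y] y assms(5) by auto
  qed
  then have "negligible {x<..<x+d}" using N(1) negligible_subset by blast
  then show False using d(1) open_not_negligible[of "{x<..<x+d}"] by auto
qed

lemma has_weak_deriv_unique:
  assumes "has_weak_deriv u v1" "has_weak_deriv u v2"
  shows "ae_eq v1 v2"
proof -
  obtain w1 where w1: "primitive_on {0<..} w1 v1" "ae_eq w1 u"
    using has_weak_deriv_imp_primitive[OF assms(1)] by blast
  obtain w2 where w2: "primitive_on {0<..} w2 v2" "ae_eq w2 u"
    using has_weak_deriv_imp_primitive[OF assms(2)] by blast
  have eq: "w1 x = w2 x" if "0 < x" for x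
    by (rule ae_eq_continuous_imp_eq[OF primitive_on_Ioi_continuous[OF w1(1)] primitive_on_Ioi_continuous[OF w2(1)]
        ae_eq_trans[OF w1(2) ae_eq_sym[OF w2(2)]]]) (use that in auto)
  have L: "L1loc_halfline v1" "L1loc_halfline v2" using assms by (auto simp: has_weak_deriv_def)
  have "ae_eq (\<lambda>x. v1 x - v2 x) (\<lambda>_. 0)"
  proof (rule ae_eq_0_if_interval_integrals_0)
    show "L1loc_halfline (\<lambda>x. v1 x - v2 x)"
      using L unfolding L1loc_halfline_def by (simp add: set_integral_diff)
    fix a b :: real assume ab: "0 < a" "a \<le> b"
    have "integral {a..b} (\<lambda>x. v1 x - v2 x) = integral {a..b} v1 - integral {a..b} v2"
      using L1loc_halflineD(3)[OF L(1) ab(1)] L1loc_halflineD(3)[OF L(2) ab(1)]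
      by (rule Henstock_Kurzweil_Integration.integral_diff)
    then show "integral {a..b} (\<lambda>x. v1 x - v2 x) = 0"
      using primitive_onD(2)[OF w1(1), of a b] primitive_onD(2)[OF w2(1), of a b] eq ab by auto
  qed
  then show ?thesis unfolding ae_eq_def by (elim eventually_mono) auto
qed

lemma value_at_0_eq:
  assumes "continuous_on {0..} w" "ae_eq w u"
  shows "value_at_0 u = w 0"
  unfolding value_at_0_def
proof (rule the_equality)
  show "\<exists>w'. continuous_rep u w' \<and> w' 0 = w 0" using assms by (auto simp: continuous_rep_def)
  fix c assume "\<exists>w'. continuous_rep u w' \<and> w' 0 = c"
  then obtain w' where w': "continuous_on {0..} w'" "ae_eq w' u" "w' 0 = c"
    by (auto simp: continuous_rep_def)
  then show "c = w 0"
    using ae_eq_continuous_imp_eq[OF w'(1) assms(1) ae_eq_trans[OF w'(2) ae_eq_sym[OF assms(2)]], of 0] by simp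
qed

section \<open>Pairs of an energy function and its derivative\<close>

text \<open>Here \<open>w\<close> is the continuous representative, with boundary value
  \<open>w 0\<close>, and \<open>v\<close> is any version of the derivative, so that explicit
  derivatives can be used in place of the choice made by \<open>weak_deriv\<close>.\<close>

definition H1_pair :: "(real \<Rightarrow> real) \<Rightarrow> (real \<Rightarrow> real) \<Rightarrow> bool" where
  "H1_pair w v \<longleftrightarrow> primitive_on {0..} w v \<and> (\<lambda>x. (w x)\<^sup>2) absolutely_integrable_on {0..}
     \<and> (\<lambda>x. (v x)\<^sup>2) absolutely_integrable_on {0..}"

definition pair_energy :: "real \<Rightarrow> real \<Rightarrow> (real \<Rightarrow> real) \<Rightarrow> (real \<Rightarrow> real) \<Rightarrow> real" where
  "pair_energy p \<alpha> w v = 1 / 2 * integral {0..} (\<lambda>x. (v x)\<^sup>2)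
     - 1 / p * integral {0..} (\<lambda>x. \<bar>w x\<bar> powr p) + \<alpha> / 2 * (w 0)\<^sup>2"

lemma absolutely_integrable_nonneg_iff:
  fixes f :: "real \<Rightarrow> real"
  assumes "\<And>x. 0 \<le> f x"
  shows "f absolutely_integrable_on S \<longleftrightarrow> f integrable_on S"
  using assms by (simp add: absolutely_integrable_on_def)

lemma integral_Icc_tendsto_at_top:
  fixes f :: "real \<Rightarrow> real"
  assumes "f absolutely_integrable_on {a..}"
  shows "((\<lambda>b. integral {a..b} f) \<longlongrightarrow> integral {a..} f) at_top"
proof -
  have sub: "f absolutely_integrable_on {a..b}" for b
    by (rule set_integrable_subset[OF assms]) auto
  have "((\<lambda>b. set_lebesgue_integral lebesgue {a..b} f) \<longlongrightarrow> set_lebesgue_integral lebesgue {a..} f) at_top"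
    by (rule tendsto_set_lebesgue_integral_at_top[OF _ assms]) auto
  then show ?thesis
    using set_lebesgue_integral_eq_integral(2)[OF assms] set_lebesgue_integral_eq_integral(2)[OF sub] by simp
qed

lemma tendsto_0_if_integrable:
  fixes f :: "real \<Rightarrow> real"
  assumes f: "f integrable_on {0..}" and nn: "\<And>x. 0 \<le> f x" and lim: "(f \<longlongrightarrow> L) at_top"
  shows "L = 0"
proof (rule ccontr)
  assume "L \<noteq> 0"
  moreover have "0 \<le> L" using lim by (rule tendsto_lowerbound) (auto simp: nn)
  ultimately have "0 < L" by simp
  then have "eventually (\<lambda>x. L / 2 < f x) at_top" by (intro order_tendstoD[OF lim]) auto
  then obtain X where X: "\<And>x. X \<le> x \<Longrightarrow> L / 2 < f x" by (auto simp: eventually_at_top_linorder)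
  define a where "a = max 0 X"
  \<comment> \<open>\<open>b\<close> is so far from \<open>a\<close> that the integral of
    \<open>L / 2\<close> between them exceeds the total integral of \<open>f\<close> by 1.\<close>
  define b where "b = a + 2 * (integral {0..} f + 1) / L"
  have I: "0 \<le> integral {0..} f" using f by (intro Henstock_Kurzweil_Integration.integral_nonneg) (auto simp: nn)
  have ab: "a \<le> b" using I \<open>0 < L\<close> by (simp add: b_def)
  have fab: "f integrable_on {a..b}"
    by (rule integrable_on_subinterval[OF f]) (auto simp: a_def)
  have "integral {a..b} (\<lambda>_. L / 2) \<le> integral {a..b} f"
    by (rule integral_le) (use fab X in \<open>auto simp: a_def less_imp_le\<close>)
  also have "\<dots> \<le> integral {0..} f"
    by (rule integral_subset_le[OF _ fab f]) (auto simp: a_def nn)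
  finally show False using ab \<open>0 < L\<close> by (simp add: b_def field_simps)
qed

lemma H1_pair_props:
  assumes "H1_pair w v"
  shows "primitive_on {0..} w v" "(\<lambda>x. (w x)\<^sup>2) absolutely_integrable_on {0..}"
    "(\<lambda>x. (v x)\<^sup>2) absolutely_integrable_on {0..}" "(\<lambda>x. (w x)\<^sup>2) integrable_on {0..}"
    "(\<lambda>x. (v x)\<^sup>2) integrable_on {0..}" "continuous_on {0..} w"
  using assms primitive_on_Ici_continuous by (auto simp: H1_pair_def absolutely_integrable_on_def)

lemma primitive_on_Ici_measurable:
  assumes "primitive_on {0..} w v"
  shows "v \<in> borel_measurable (lebesgue_on {0..})"
proof -
  have "(\<lambda>x. if x \<in> {0..} then v x else 0) \<in> borel_measurable lebesgue"
  proof (rule borel_measurable_LIMSEQ_metric)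
    show "(\<lambda>x. if x \<in> {0..real n} then v x else 0) \<in> borel_measurable lebesgue" for n
    proof -
      have "v absolutely_integrable_on {0..real n}" by (rule primitive_onD[OF assms]) auto
      then have "v \<in> borel_measurable (lebesgue_on {0..real n})"
        by (rule absolutely_integrable_imp_borel_measurable) auto
      then show ?thesis by (rule borel_measurable_if_I) auto
    qed
  next
    fix x :: real
    obtain N where "x \<le> real N" using real_arch_simple by blast
    then have "eventually (\<lambda>n. (if x \<in> {0..real n} then v x else 0) = (if x \<in> {0..} then v x else 0)) sequentially"
      by (intro eventually_sequentiallyI[of N]) auto
    then show "(\<lambda>n. if x \<in> {0..real n} then v x else 0) \<longlonglongrightarrow> (if x \<in> {0..} then v x else 0)"
      by (rule tendsto_eventually)
  qed
  then show ?thesis by (rule borel_measurable_if_D)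
qed

lemma continuous_measurable_Ici:
  "continuous_on {0..} f \<Longrightarrow> f \<in> borel_measurable (lebesgue_on {0::real..})" for f :: "real \<Rightarrow> real"
  by (rule continuous_imp_measurable_on_sets_lebesgue) auto

text \<open>Vanishing at infinity: \<open>w\<^sup>2\<close> has a limit because its derivative \<open>2 w v\<close> is integrable.\<close>

lemma H1_pair_tendsto_0:
  assumes "H1_pair w v"
  shows "(w \<longlongrightarrow> 0) at_top"
proof -
  note pr = H1_pair_props[OF assms]
  have ch: "primitive_on {0..} (\<lambda>x. (w x)\<^sup>2) (\<lambda>x. 2 * w x * v x)"
    by (rule primitive_on_chain[OF pr(1), where F = "\<lambda>x. x\<^sup>2"])
       (auto intro!: derivative_eq_intros continuous_intros simp: is_interval_ci)
  have ai: "(\<lambda>x. 2 * w x * v x) absolutely_integrable_on {0..}"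
  proof (rule measurable_bounded_by_integrable_imp_absolutely_integrable)
    show "(\<lambda>x. 2 * w x * v x) \<in> borel_measurable (lebesgue_on {0..})"
      by (rule primitive_on_Ici_measurable[OF ch])
    show "(\<lambda>x. (w x)\<^sup>2 + (v x)\<^sup>2) integrable_on {0..}" by (intro integrable_add pr)
    fix x :: real
    have "2 * \<bar>w x\<bar> * \<bar>v x\<bar> \<le> (w x)\<^sup>2 + (v x)\<^sup>2"
      using sum_squares_bound[of "\<bar>w x\<bar>" "\<bar>v x\<bar>"] by simp
    then show "norm (2 * w x * v x) \<le> (w x)\<^sup>2 + (v x)\<^sup>2" by (simp add: abs_mult)
  qed auto
  have "((\<lambda>b. integral {0..b} (\<lambda>x. 2 * w x * v x) + (w 0)\<^sup>2) \<longlongrightarrow> integral {0..} (\<lambda>x. 2 * w x * v x) + (w 0)\<^sup>2) at_top"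
    by (intro tendsto_intros integral_Icc_tendsto_at_top ai)
  moreover have "eventually (\<lambda>b. integral {0..b} (\<lambda>x. 2 * w x * v x) + (w 0)\<^sup>2 = (w b)\<^sup>2) at_top"
    using eventually_ge_at_top[of 0]
    by eventually_elim (use primitive_onD(2)[OF ch, of 0] in auto)
  ultimately have lim: "((\<lambda>b. (w b)\<^sup>2) \<longlongrightarrow> integral {0..} (\<lambda>x. 2 * w x * v x) + (w 0)\<^sup>2) at_top"
    by (rule Lim_transform_eventually)
  then have "integral {0..} (\<lambda>x. 2 * w x * v x) + (w 0)\<^sup>2 = 0"
    by (rule tendsto_0_if_integrable[OF pr(4), rotated]) auto
  with lim have "((\<lambda>b. (w b)\<^sup>2) \<longlongrightarrow> 0) at_top" by simp
  then have "((\<lambda>b. sqrt ((w b)\<^sup>2)) \<longlongrightarrow> sqrt 0) at_top" by (rule tendsto_real_sqrt)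
  then show ?thesis by (simp add: tendsto_rabs_zero_iff)
qed

lemma H1_pair_attains_max:
  assumes "H1_pair w v"
  obtains x0 where "0 \<le> x0" "\<And>x. 0 \<le> x \<Longrightarrow> \<bar>w x\<bar> \<le> \<bar>w x0\<bar>"
proof (cases "\<forall>x\<ge>0. w x = 0")
  case True
  then show ?thesis using that[of 0] by simp
next
  case False
  then obtain x1 where x1: "0 \<le> x1" "w x1 \<noteq> 0" by auto
  have "((\<lambda>x. \<bar>w x\<bar>) \<longlongrightarrow> 0) at_top" using H1_pair_tendsto_0[OF assms] by (rule tendsto_rabs_zero)
  then have "eventually (\<lambda>x. \<bar>w x\<bar> < \<bar>w x1\<bar>) at_top" by (rule order_tendstoD) (use x1 in auto)
  then obtain X where X: "\<And>x. X \<le> x \<Longrightarrow> \<bar>w x\<bar> < \<bar>w x1\<bar>" by (auto simp: eventually_at_top_linorder)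
  define T where "T = max X x1"
  have "0 \<le> T" using x1 by (simp add: T_def)
  have "continuous_on {0..T} (\<lambda>x. \<bar>w x\<bar>)"
    by (intro continuous_intros continuous_on_subset[OF H1_pair_props(6)[OF assms]]) auto
  then obtain x0 where x0: "x0 \<in> {0..T}" "\<And>x. x \<in> {0..T} \<Longrightarrow> \<bar>w x\<bar> \<le> \<bar>w x0\<bar>"
    using continuous_attains_sup[of "{0..T}" "\<lambda>x. \<bar>w x\<bar>"] \<open>0 \<le> T\<close> by auto
  have "\<bar>w x\<bar> \<le> \<bar>w x0\<bar>" if "0 \<le> x" for x
  proof (cases "x \<le> T")
    case False
    then have "\<bar>w x\<bar> < \<bar>w x1\<bar>" by (intro X) (simp add: T_def)
    also have "\<dots> \<le> \<bar>w x0\<bar>" using x1 by (intro x0) (simp add: T_def)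
    finally show ?thesis by simp
  qed (use x0 that in auto)
  then show ?thesis using that x0(1) by auto
qed

text \<open>Bounding the factor of exponent \<open>p - 2\<close> by its value at a maximum point
  leaves a multiple of the integrable \<open>w^2\<close>.\<close>

lemma H1_pair_powr_integrable:
  assumes "H1_pair w v" and p: "2 < p"
  shows "(\<lambda>x. \<bar>w x\<bar> powr p) absolutely_integrable_on {0..}"
proof -
  obtain x0 where x0: "0 \<le> x0" "\<And>x. 0 \<le> x \<Longrightarrow> \<bar>w x\<bar> \<le> \<bar>w x0\<bar>"
    using H1_pair_attains_max[OF assms(1)] by blast
  note pr = H1_pair_props[OF assms(1)]
  show ?thesis
  proof (rule measurable_bounded_by_integrable_imp_absolutely_integrable)
    have "continuous_on {0..} (\<lambda>x. \<bar>w x\<bar> powr p)"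
      using p by (intro continuous_intros continuous_on_powr' pr) auto
    then show "(\<lambda>x. \<bar>w x\<bar> powr p) \<in> borel_measurable (lebesgue_on {0..})"
      by (rule continuous_measurable_Ici)
    show "(\<lambda>x. \<bar>w x0\<bar> powr (p - 2) * (w x)\<^sup>2) integrable_on {0..}"
      by (intro integrable_on_mult_right pr)
    fix x :: real assume x: "x \<in> {0..}"
    show "norm (\<bar>w x\<bar> powr p) \<le> \<bar>w x0\<bar> powr (p - 2) * (w x)\<^sup>2"
    proof (cases "w x = 0")
      case False
      have "\<bar>w x\<bar> powr p = \<bar>w x\<bar> powr (p - 2) * \<bar>w x\<bar> powr 2"
        using powr_add[of "\<bar>w x\<bar>" "p - 2" 2] by simp
      also have "\<dots> = \<bar>w x\<bar> powr (p - 2) * (w x)\<^sup>2" using False by simp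
      also have "\<dots> \<le> \<bar>w x0\<bar> powr (p - 2) * (w x)\<^sup>2"
        using x0 x p by (intro mult_right_mono powr_mono2) auto
      finally show ?thesis by simp
    qed simp
  qed auto
qed

section \<open>Passage between elements of \<open>H1\<close> and pairs\<close>

lemma LINT_halfline_eq:
  assumes "set_borel_measurable lborel {0<..} f" "ae_eq g f" "g absolutely_integrable_on {0..}"
  shows "set_integrable lborel {0<..} f" "(LINT x:{0<..}|lborel. f x) = integral {0..} g"
proof -
  have "g absolutely_integrable_on {0<..}"
    by (rule set_integrable_subset[OF assms(3)]) auto
  then have "f absolutely_integrable_on {0<..}"
    using ae_eq_integral(1)[OF assms(2), of "{0<..}"] by (simp add: subset_iff)
  then show si: "set_integrable lborel {0<..} f"
    by (rule absolutely_integrable_imp_set_integrable_lborel[OF assms(1)])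
  have "(LINT x:{0<..}|lborel. f x) = integral {0<..} f"
    by (rule set_borel_integral_eq_integral[OF si])
  also have "\<dots> = integral {0<..} g"
    by (rule ae_eq_integral(2)[OF assms(2), symmetric]) auto
  also have "\<dots> = integral {0..} g"
  proof (rule integral_subset_negligible)
    have "{0..} - {0<..} = {0::real}" by auto
    then show "negligible ({0..} - {0<..} :: real set)" by simp
  qed auto
  finally show "(LINT x:{0<..}|lborel. f x) = integral {0..} g" .
qed

lemma set_borel_measurable_compose_0:
  fixes u f :: "real \<Rightarrow> real"
  assumes u: "set_borel_measurable lborel {0<..} u" and f: "f \<in> borel_measurable borel"
  shows "set_borel_measurable lborel {0<..} (\<lambda>x. f (u x))"
proof -
  have m: "(\<lambda>x. indicator {0<..} x *\<^sub>R u x) \<in> borel_measurable borel"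
    using u by (simp add: set_borel_measurable_def)
  have "(\<lambda>x. indicator {0<..} x * f (indicator {0<..} x *\<^sub>R u x)) \<in> borel_measurable borel"
    by (intro borel_measurable_times measurable_compose[OF m f]) auto
  also have "(\<lambda>x. indicator {0<..} x * f (indicator {0<..} x *\<^sub>R u x)) = (\<lambda>x. indicator {0<..} x *\<^sub>R f (u x))"
    by (auto split: split_indicator)
  finally show ?thesis by (simp add: set_borel_measurable_def)
qed

lemma has_weak_deriv_weak_deriv: "has_weak_deriv u v \<Longrightarrow> has_weak_deriv u (weak_deriv u)"
  unfolding weak_deriv_def by (rule someI[of "has_weak_deriv u"])

text \<open>By \<open>|v| \<le> v^2 + 1\<close> a square integrable derivative is integrable near 0,
  so the primitive on the open half-line extends to the closed one.\<close>

lemma H1_imp_pair: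
  assumes "u \<in> H1"
  obtains w where "H1_pair w (weak_deriv u)" "ae_eq w u"
proof -
  obtain v where u: "L2_halfline u" and v: "has_weak_deriv u v" "L2_halfline v"
    using assms by (auto simp: H1_def)
  note wd = has_weak_deriv_weak_deriv[OF v(1)]
  obtain w0 where w0: "primitive_on {0<..} w0 (weak_deriv u)" "ae_eq w0 u"
    using has_weak_deriv_imp_primitive[OF wd] by blast
  have ae: "ae_eq v (weak_deriv u)" by (rule has_weak_deriv_unique[OF v(1) wd])
  have null: "negligible ({0..} - {0<..} :: real set)" "negligible ({0<..} - {0..} :: real set)"
  proof -
    have "{0..} - {0<..} = {0::real}" "{0<..} - {0..} = ({} :: real set)" by auto
    then show "negligible ({0..} - {0<..} :: real set)" "negligible ({0<..} - {0..} :: real set)" by simp_all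
  qed
  have ext: "f absolutely_integrable_on {0..}" if "f absolutely_integrable_on {0<..}" for f :: "real \<Rightarrow> real"
    by (rule absolutely_integrable_spike_set[OF that]) (auto intro: negligible_subset[OF null(1)] negligible_subset[OF null(2)])
  have v2: "(\<lambda>x. (weak_deriv u x)\<^sup>2) absolutely_integrable_on {0..}"
  proof (rule ext)
    have "(\<lambda>x. (v x)\<^sup>2) absolutely_integrable_on {0<..}"
      using v(2) by (intro set_integrable_lborel_imp_absolutely_integrable) (simp add: L2_halfline_def)
    then show "(\<lambda>x. (weak_deriv u x)\<^sup>2) absolutely_integrable_on {0<..}"
      using ae_eq_integral(1)[OF ae_eq_cong[OF ae, of "\<lambda>x y. y\<^sup>2"], of "{0<..}"] by (simp add: subset_iff)
  qed
  \<comment> \<open>Measurability is known on the open half-line only; the arbitrary value at 0 is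
    added by hand.\<close>
  have at0: "(\<lambda>x. if x \<in> {0} then weak_deriv u 0 else 0) \<in> borel_measurable lebesgue"
    by (intro measurable_If_set) auto
  have meas: "weak_deriv u \<in> borel_measurable (lebesgue_on {0..1})"
  proof -
    have L: "L1loc_halfline (weak_deriv u)" using wd by (simp add: has_weak_deriv_def)
    have "(\<lambda>x. indicator {0<..} x *\<^sub>R weak_deriv u x) \<in> borel_measurable lborel"
      using L1loc_imp_measurable[OF L] by (simp add: set_borel_measurable_def)
    then have "(\<lambda>x. indicator {0<..} x *\<^sub>R weak_deriv u x) \<in> borel_measurable lebesgue"
      by (rule measurable_completion)
    then have "(\<lambda>x. indicator {0<..} x *\<^sub>R weak_deriv u x + (if x \<in> {0} then weak_deriv u 0 else 0)) \<in> borel_measurable lebesgue"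
      by (intro borel_measurable_add at0)
    then have "(\<lambda>x. indicator {0<..} x *\<^sub>R weak_deriv u x + (if x \<in> {0} then weak_deriv u 0 else 0)) \<in> borel_measurable (lebesgue_on {0..1})"
      by (rule measurable_restrict_space1)
    then show ?thesis
      by (rule measurable_cong[THEN iffD1, rotated]) (auto split: split_indicator)
  qed
  have "weak_deriv u absolutely_integrable_on {0..1}"
  proof (rule measurable_bounded_by_integrable_imp_absolutely_integrable[OF meas])
    have "(\<lambda>x. (weak_deriv u x)\<^sup>2) integrable_on {0..1}"
      using v2 by (intro integrable_on_subinterval[of _ "{0..}"]) (auto simp: absolutely_integrable_on_def)
    then show "(\<lambda>x. (weak_deriv u x)\<^sup>2 + 1) integrable_on {0..1}"
      by (intro integrable_add) auto
    fix x :: real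
    have "0 \<le> (\<bar>weak_deriv u x\<bar> - 1/2)\<^sup>2" by simp
    then show "norm (weak_deriv u x) \<le> (weak_deriv u x)\<^sup>2 + 1" by (simp add: power2_diff power_divide)
  qed auto
  from primitive_on_Ioi_extend[OF w0(1) this]
  obtain w where w: "primitive_on {0..} w (weak_deriv u)" "\<And>x. 0 < x \<Longrightarrow> w x = w0 x" by blast
  have "ae_eq w w0" using w(2) by (simp add: ae_eq_def)
  then have wu: "ae_eq w u" using w0(2) by (rule ae_eq_trans)
  have "(\<lambda>x. (w x)\<^sup>2) absolutely_integrable_on {0..}"
  proof (rule ext)
    have "(\<lambda>x. (u x)\<^sup>2) absolutely_integrable_on {0<..}"
      using u by (intro set_integrable_lborel_imp_absolutely_integrable) (simp add: L2_halfline_def)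
    then show "(\<lambda>x. (w x)\<^sup>2) absolutely_integrable_on {0<..}"
      using ae_eq_integral(1)[OF ae_eq_cong[OF wu, of "\<lambda>x y. y\<^sup>2"], of "{0<..}"] by (simp add: subset_iff)
  qed
  then have "H1_pair w (weak_deriv u)" using w v2 by (simp add: H1_pair_def)
  then show ?thesis using wu by (rule that)
qed

lemma H1_mass_energy_eq:
  assumes u: "u \<in> H1" and w: "H1_pair w v" "ae_eq w u" and v: "L1loc_halfline v" and p: "2 < p"
  shows "ae_eq v (weak_deriv u)" "mass u = integral {0..} (\<lambda>x. (w x)\<^sup>2)"
    "energy p \<alpha> u = pair_energy p \<alpha> w v"
proof -
  note pr = H1_pair_props[OF w(1)]
  obtain z where u2: "L2_halfline u" and z: "has_weak_deriv u z"
    using u by (auto simp: H1_def)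
  note wd = has_weak_deriv_weak_deriv[OF z]
  have um: "set_borel_measurable lborel {0<..} u" using u2 by (simp add: L2_halfline_def)
  have vm: "set_borel_measurable lborel {0<..} (weak_deriv u)"
    using wd by (intro L1loc_imp_measurable) (simp add: has_weak_deriv_def)
  show ae: "ae_eq v (weak_deriv u)"
  proof -
    have "has_weak_deriv u v"
      by (rule has_weak_deriv_if_primitive[OF primitive_on_subset[OF pr(1)] _ w(2) v])
         (use z in \<open>auto simp: has_weak_deriv_def\<close>)
    then show ?thesis by (rule has_weak_deriv_unique[OF _ wd])
  qed
  show "mass u = integral {0..} (\<lambda>x. (w x)\<^sup>2)"
    unfolding mass_def
    by (rule LINT_halfline_eq[OF _ ae_eq_cong[OF w(2), of "\<lambda>x y. y\<^sup>2"] pr(2)],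
        rule set_borel_measurable_compose_0[OF um, of "\<lambda>y. y\<^sup>2"]) auto
  have "(LINT x:{0<..}|lborel. (weak_deriv u x)\<^sup>2) = integral {0..} (\<lambda>x. (v x)\<^sup>2)"
    by (rule LINT_halfline_eq[OF _ ae_eq_cong[OF ae, of "\<lambda>x y. y\<^sup>2"] pr(3)],
        rule set_borel_measurable_compose_0[OF vm, of "\<lambda>y. y\<^sup>2"]) auto
  moreover have "(LINT x:{0<..}|lborel. \<bar>u x\<bar> powr p) = integral {0..} (\<lambda>x. \<bar>w x\<bar> powr p)"
    by (rule LINT_halfline_eq[OF _ ae_eq_cong[OF w(2), of "\<lambda>x y. \<bar>y\<bar> powr p"] H1_pair_powr_integrable[OF w(1) p]],
        rule set_borel_measurable_compose_0[OF um, of "\<lambda>y. \<bar>y\<bar> powr p"]) auto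
  moreover have "value_at_0 u = w 0" by (rule value_at_0_eq[OF pr(6) w(2)])
  ultimately show "energy p \<alpha> u = pair_energy p \<alpha> w v"
    by (simp add: energy_def pair_energy_def)
qed

lemma H1_pair_imp_H1:
  assumes w: "H1_pair w v" and v: "L1loc_halfline v"
  shows "w \<in> H1" "has_weak_deriv w v"
proof -
  note pr = H1_pair_props[OF w]
  have wL: "L1loc_halfline w"
    by (intro L1loc_if_continuous continuous_on_subset[OF pr(6)]) auto
  show wd: "has_weak_deriv w v"
    by (rule has_weak_deriv_if_primitive[OF primitive_on_subset[OF pr(1)] wL _ v]) auto
  have L2: "L2_halfline f" if f: "L1loc_halfline f" "(\<lambda>x. (f x)\<^sup>2) absolutely_integrable_on {0..}" for f
  proof -
    have m: "set_borel_measurable lborel {0<..} f" using f(1) by (rule L1loc_imp_measurable)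
    then have "set_borel_measurable lborel {0<..} (\<lambda>x. (f x)\<^sup>2)"
      by (rule set_borel_measurable_compose_0[of f "\<lambda>y. y\<^sup>2"]) auto
    from LINT_halfline_eq(1)[OF this ae_eq_refl f(2)] show ?thesis
      using m by (simp add: L2_halfline_def)
  qed
  have "L2_halfline w" "L2_halfline v" by (intro L2 wL v pr(2,3))+
  then show "w \<in> H1" using wd by (auto simp: H1_def)
qed

section \<open>Truncated powers and the level of the energy\<close>

text \<open>Since \<open>0 powr 0 = 0\<close>, exponent \<open>0\<close> (needed for \<open>p = 4\<close>) gives the indicator of \<open>s\<^sup>2 < \<omega>\<close>.\<close>

definition trunc_powr :: "real \<Rightarrow> real \<Rightarrow> real \<Rightarrow> real" where
  "trunc_powr r \<omega> s = max 0 (\<omega> - s\<^sup>2) powr r"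

definition trunc_int :: "real \<Rightarrow> real \<Rightarrow> real \<Rightarrow> real" where
  "trunc_int r \<omega> T = integral {0..T} (trunc_powr r \<omega>)"

text \<open>The two legs of a truncated soliton: from its peak to infinity, and from the origin to its peak.\<close>

definition two_leg_int :: "real \<Rightarrow> real \<Rightarrow> real \<Rightarrow> real" where
  "two_leg_int r \<alpha> \<omega> = trunc_int r \<omega> (sqrt \<omega>) + trunc_int r \<omega> \<alpha>"

lemma trunc_powr_nonneg [simp]: "0 \<le> trunc_powr r \<omega> s" by (simp add: trunc_powr_def)

lemma trunc_powr_le:
  assumes "0 \<le> r" shows "trunc_powr r \<omega> s \<le> max 0 \<omega> powr r"
proof -
  have "max 0 (\<omega> - s\<^sup>2) \<le> max 0 \<omega>" by (rule max.mono) auto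
  then show ?thesis unfolding trunc_powr_def using assms by (intro powr_mono2) auto
qed

lemma trunc_powr_mono: "0 \<le> r \<Longrightarrow> \<omega> \<le> \<omega>' \<Longrightarrow> trunc_powr r \<omega> s \<le> trunc_powr r \<omega>' s"
  unfolding trunc_powr_def by (intro powr_mono2) auto

lemma trunc_powr_absolutely_integrable:
  assumes "0 \<le> r" shows "trunc_powr r \<omega> absolutely_integrable_on {a..b}"
proof (rule measurable_bounded_by_integrable_imp_absolutely_integrable)
  have "trunc_powr r \<omega> \<in> borel_measurable borel"
    unfolding trunc_powr_def[abs_def] by measurable
  then have "trunc_powr r \<omega> \<in> borel_measurable lebesgue"
    by (intro measurable_completion) auto
  then show "trunc_powr r \<omega> \<in> borel_measurable (lebesgue_on {a..b})"
    by (rule measurable_restrict_space1)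
  show "norm (trunc_powr r \<omega> s) \<le> max 0 \<omega> powr r" for s
    using trunc_powr_le[OF assms] by simp
qed auto

lemma trunc_powr_integrable: "0 \<le> r \<Longrightarrow> trunc_powr r \<omega> integrable_on {a..b}"
  using trunc_powr_absolutely_integrable absolutely_integrable_on_def by blast

lemma continuous_on_trunc_powr: "0 < r \<Longrightarrow> continuous_on S (trunc_powr r \<omega>)"
  unfolding trunc_powr_def[abs_def] by (intro continuous_on_powr' continuous_intros) auto

lemma continuous_on_trunc_powr_interior:
  "(\<And>s. s \<in> S \<Longrightarrow> s\<^sup>2 < \<omega>) \<Longrightarrow> continuous_on S (trunc_powr r \<omega>)"
  unfolding trunc_powr_def[abs_def] by (intro continuous_on_powr continuous_intros) fastforce

lemma trunc_int_combine:
  assumes "0 \<le> r" "0 \<le> S" "S \<le> T"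
  shows "trunc_int r \<omega> T = trunc_int r \<omega> S + integral {S..T} (trunc_powr r \<omega>)"
  unfolding trunc_int_def
  by (rule Henstock_Kurzweil_Integration.integral_combine[symmetric]) (use assms in \<open>auto intro: trunc_powr_integrable\<close>)

lemma trunc_int_0 [simp]: "trunc_int r \<omega> 0 = 0" by (simp add: trunc_int_def)

lemma trunc_int_saturated:
  assumes "0 \<le> r" "0 \<le> \<omega>" "sqrt \<omega> \<le> T"
  shows "trunc_int r \<omega> T = trunc_int r \<omega> (sqrt \<omega>)"
proof -
  have "integral {sqrt \<omega>..T} (trunc_powr r \<omega>) = integral {sqrt \<omega>..T} (\<lambda>_. 0)"
  proof (rule Henstock_Kurzweil_Integration.integral_cong)
    fix s assume "s \<in> {sqrt \<omega>..T}"
    then have "\<omega> \<le> s\<^sup>2" using assms by (auto intro: sqrt_le_D)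
    then show "trunc_powr r \<omega> s = 0" by (simp add: trunc_powr_def)
  qed
  then show ?thesis using trunc_int_combine[OF assms(1), of "sqrt \<omega>" T \<omega>] assms by simp
qed

lemma two_leg_int_eq:
  assumes "0 \<le> r" "0 \<le> \<omega>" "sqrt \<omega> \<le> T"
  shows "two_leg_int r \<alpha> \<omega> = trunc_int r \<omega> T + trunc_int r \<omega> \<alpha>"
  using trunc_int_saturated[OF assms] by (simp add: two_leg_int_def)

lemma trunc_int_mono:
  assumes "0 \<le> r" "\<omega> \<le> \<omega>'" shows "trunc_int r \<omega> T \<le> trunc_int r \<omega>' T"
  unfolding trunc_int_def
  by (rule integral_le) (use assms in \<open>auto intro: trunc_powr_integrable trunc_powr_mono\<close>)

lemma continuous_on_trunc_int: "0 \<le> r \<Longrightarrow> continuous_on {0..T} (trunc_int r \<omega>)"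
  unfolding trunc_int_def[abs_def] by (intro indefinite_integral_continuous_1 trunc_powr_integrable)

lemma trunc_int_has_derivative:
  assumes "0 < t" "continuous_on {0..T} (trunc_powr r \<omega>)" "t < T"
  shows "(trunc_int r \<omega> has_real_derivative trunc_powr r \<omega> t) (at t)"
proof -
  have "(trunc_int r \<omega> has_real_derivative trunc_powr r \<omega> t) (at t within {0..T})"
    unfolding trunc_int_def[abs_def] using assms by (intro integral_has_real_derivative) auto
  moreover have "at t within {0..T} = at t"
    using assms by (intro at_within_interior) auto
  ultimately show ?thesis by simp
qed

text \<open>Substitution of \<open>k\<close> times the variable. It makes the dependence on the
  frequency explicit, so that monotonicity, continuity and the range in \<open>k\<close> can be read
  off.\<close>

lemma trunc_int_scaling:
  assumes "0 < k" shows "trunc_int r (k\<^sup>2) T = k powr (2 * r + 1) * trunc_int r 1 (T / k)"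
proof -
  have sc: "trunc_powr r (k\<^sup>2) s = k powr (2 * r) * trunc_powr r 1 (1 / k * s)" for s
  proof -
    have "max 0 (k\<^sup>2 - s\<^sup>2) = k\<^sup>2 * max 0 (1 - (s / k)\<^sup>2)"
      using assms by (simp add: max_def field_simps power_divide)
    also have "\<dots> powr r = (k\<^sup>2) powr r * max 0 (1 - (s / k)\<^sup>2) powr r"
      by (simp add: powr_mult)
    also have "(k\<^sup>2) powr r = k powr (2 * r)"
      using assms powr_powr[of k 2 r] by simp
    finally show ?thesis by (simp add: trunc_powr_def)
  qed
  have img: "(\<lambda>x. x / (1 / k)) ` {0..T / k} = {0..T}"
  proof -
    have "(\<lambda>x. x / (1 / k)) = (*) k" by (auto simp: mult.commute)
    then show ?thesis using image_mult_atLeastAtMost[OF assms, of 0 "T / k"] assms by (simp only:) simp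
  qed
  have "integral {0..T} (trunc_powr r (k\<^sup>2)) = integral {0..T} (\<lambda>s. k powr (2 * r) * trunc_powr r 1 (1 / k * s))"
    using sc by (intro Henstock_Kurzweil_Integration.integral_cong) auto
  also have "\<dots> = k powr (2 * r) * integral {0..T} (\<lambda>s. trunc_powr r 1 (1 / k * s))"
    by simp
  also have "integral {0..T} (\<lambda>s. trunc_powr r 1 (1 / k * s)) = k * integral {0..T / k} (trunc_powr r 1)"
    using integral_stretch_real[of "1 / k" 0 "T / k" "trunc_powr r 1"] assms unfolding img by simp
  finally show ?thesis using assms by (simp add: trunc_int_def powr_add)
qed

lemma trunc_int_pos:
  assumes "0 \<le> r" shows "0 < trunc_int r 1 1"
proof -
  \<comment> \<open>On \<open>{0..1/2}\<close> the base \<open>1 - s^2\<close> is at least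
    3/4.\<close>
  have "integral {0..1/2::real} (\<lambda>_. (3/4) powr r :: real) \<le> integral {0..1/2} (trunc_powr r 1)"
  proof (rule integral_le)
    fix s :: real assume s: "s \<in> {0..1/2}"
    then have "s\<^sup>2 \<le> (1/2)\<^sup>2" by (intro power_mono) auto
    then have "s\<^sup>2 \<le> 1/4" by (simp add: power_divide)
    then have "3/4 \<le> max 0 (1 - s\<^sup>2)" by (simp add: le_max_iff_disj)
    from powr_mono2[OF assms _ this] show "(3/4) powr r \<le> trunc_powr r 1 s"
      unfolding trunc_powr_def by simp
  qed (auto intro: trunc_powr_integrable assms)
  also have "\<dots> \<le> trunc_int r 1 1"
    unfolding trunc_int_def
    by (rule integral_subset_le) (auto intro: trunc_powr_integrable assms)
  finally show ?thesis by (rule less_le_trans[rotated]) simp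
qed

lemma two_leg_int_scaling:
  assumes "0 < k"
  shows "two_leg_int r \<alpha> (k\<^sup>2) = k powr (2 * r + 1) * (trunc_int r 1 1 + trunc_int r 1 (\<alpha> / k))"
  using assms by (simp add: two_leg_int_def trunc_int_scaling distrib_left)

text \<open>The first leg is a constant times a positive power of \<open>sqrt \<omega>\<close>,
  hence strictly increasing, and the second is monotone. This includes \<open>r = 0\<close>, where
  the integrand takes only the values 0 and 1.\<close>

lemma two_leg_int_strict_mono:
  assumes r: "0 \<le> r" and "0 < \<omega>" "\<omega> < \<omega>'"
  shows "two_leg_int r \<alpha> \<omega> < two_leg_int r \<alpha> \<omega>'"
proof -
  have sq: "trunc_int r \<omega> (sqrt \<omega>) = sqrt \<omega> powr (2 * r + 1) * trunc_int r 1 1" if "0 < \<omega>" for \<omega>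
    using trunc_int_scaling[of "sqrt \<omega>" r "sqrt \<omega>"] that by simp
  have "sqrt \<omega> powr (2 * r + 1) < sqrt \<omega>' powr (2 * r + 1)"
    using assms by (intro powr_less_mono2) auto
  then have "trunc_int r \<omega> (sqrt \<omega>) < trunc_int r \<omega>' (sqrt \<omega>')"
    using assms trunc_int_pos[OF r] by (simp add: sq)
  moreover have "trunc_int r \<omega> \<alpha> \<le> trunc_int r \<omega>' \<alpha>"
    using assms by (intro trunc_int_mono) auto
  ultimately show ?thesis by (simp add: two_leg_int_def)
qed

section \<open>Convexity in the frequency and the optimal boundary slope\<close>

lemma powr_above_tangent:
  fixes y z q :: real
  assumes "1 \<le> q" "0 < y" "0 < z"
  shows "z powr q + q * (y - z) * z powr (q - 1) \<le> y powr q"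
proof (cases y z rule: linorder_cases)
  case less
  have "\<exists>x. y < x \<and> x < z \<and> z powr q - y powr q = (z - y) * (q * x powr (q - 1))"
    using assms by (intro MVT2[OF less]) (auto intro!: has_real_derivative_powr)
  then obtain x where x: "y < x" "x < z" "z powr q - y powr q = (z - y) * (q * x powr (q - 1))" by blast
  have "(z - y) * (q * x powr (q - 1)) \<le> (z - y) * (q * z powr (q - 1))"
    using assms x less by (intro mult_left_mono powr_mono2) auto
  then show ?thesis using x(3) by (simp add: algebra_simps)
next
  case greater
  have "\<exists>x. z < x \<and> x < y \<and> y powr q - z powr q = (y - z) * (q * x powr (q - 1))"
    using assms by (intro MVT2[OF greater]) (auto intro!: has_real_derivative_powr)
  then obtain x where x: "z < x" "x < y" "y powr q - z powr q = (y - z) * (q * x powr (q - 1))" by blast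
  have "(y - z) * (q * z powr (q - 1)) \<le> (y - z) * (q * x powr (q - 1))"
    using assms x greater by (intro mult_left_mono powr_mono2) auto
  then show ?thesis using x(3) by (simp add: algebra_simps)
qed simp

text \<open>Here \<open>q \<ge> 1\<close> supplies convexity in \<omega>. For \<open>q = 1\<close>
  the truncated power has a kink at \<open>s^2\<close>, and the convention
  \<open>0 powr 0 = 0\<close> selects the left slope there.\<close>

lemma trunc_powr_above_tangent:
  assumes q: "1 \<le> q"
  shows "trunc_powr q \<omega>' s + q * (\<omega> - \<omega>') * trunc_powr (q - 1) \<omega>' s \<le> trunc_powr q \<omega> s"
proof (cases "\<omega>' \<le> s\<^sup>2")
  case True
  then show ?thesis by (simp add: trunc_powr_def)
next
  case False
  define z where "z = \<omega>' - s\<^sup>2"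
  define y where "y = \<omega> - s\<^sup>2"
  have z: "0 < z" using False by (simp add: z_def)
  have yz: "\<omega> - \<omega>' = y - z" by (simp add: y_def z_def)
  have ez: "trunc_powr r \<omega>' s = z powr r" for r using z by (simp add: trunc_powr_def z_def[symmetric] max_def)
  show ?thesis
  proof (cases "0 < y")
    case True
    then have "trunc_powr q \<omega> s = y powr q" by (simp add: trunc_powr_def y_def[symmetric] max_def)
    then show ?thesis using powr_above_tangent[OF q True z] by (simp add: ez yz)
  next
    case False
    \<comment> \<open>The tangent is itself nonpositive at \<open>y \<le> 0\<close>: as
      \<open>q \<ge> 1\<close> and \<open>y < z\<close>, its value there is at most
      \<open>y z^(q-1)\<close>.\<close>
    have "z powr q = z * z powr (q - 1)"
      using z powr_add[of z 1 "q - 1"] by simp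
    then have "z powr q + q * (y - z) * z powr (q - 1) = (z + q * (y - z)) * z powr (q - 1)"
      by (simp add: algebra_simps)
    also have "\<dots> \<le> 0"
    proof (rule mult_nonpos_nonneg)
      have "q * (y - z) \<le> 1 * (y - z)"
        using q False z by (intro mult_right_mono_neg) auto
      then show "z + q * (y - z) \<le> 0" using False by simp
    qed simp
    also have "0 \<le> trunc_powr q \<omega> s" by simp
    finally show ?thesis by (simp add: ez yz)
  qed
qed

lemma trunc_int_above_tangent:
  assumes q: "1 \<le> q"
  shows "trunc_int q \<omega>' T + q * (\<omega> - \<omega>') * trunc_int (q - 1) \<omega>' T \<le> trunc_int q \<omega> T"
proof -
  have i: "trunc_powr q \<omega>' integrable_on {0..T}" "trunc_powr (q - 1) \<omega>' integrable_on {0..T}" "trunc_powr q \<omega> integrable_on {0..T}"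
    using q by (auto intro: trunc_powr_integrable)
  have "integral {0..T} (\<lambda>s. trunc_powr q \<omega>' s + q * (\<omega> - \<omega>') * trunc_powr (q - 1) \<omega>' s) \<le> trunc_int q \<omega> T"
    unfolding trunc_int_def using i q
    by (intro integral_le integrable_add integrable_on_mult_right trunc_powr_above_tangent) auto
  also have "integral {0..T} (\<lambda>s. trunc_powr q \<omega>' s + q * (\<omega> - \<omega>') * trunc_powr (q - 1) \<omega>' s)
      = trunc_int q \<omega>' T + q * (\<omega> - \<omega>') * trunc_int (q - 1) \<omega>' T"
    unfolding trunc_int_def using i
    by (subst Henstock_Kurzweil_Integration.integral_add) (auto intro!: integrable_on_mult_right)
  finally show ?thesis .
qed

text \<open>The upper limit of the first leg moves with the frequency. Since the integrand vanishes
  beyond it, both frequencies can share one upper limit \<open>T\<close>, and the tangent inequality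
  is then integrated over fixed intervals.\<close>

lemma two_leg_int_above_tangent:
  assumes q: "1 \<le> q" and "0 < \<omega>" "0 < \<omega>'"
  shows "two_leg_int q \<alpha> \<omega>' + q * (\<omega> - \<omega>') * two_leg_int (q - 1) \<alpha> \<omega>' \<le> two_leg_int q \<alpha> \<omega>"
proof -
  define T where "T = max (sqrt \<omega>) (sqrt \<omega>')"
  have eq: "two_leg_int r \<alpha> \<omega> = trunc_int r \<omega> T + trunc_int r \<omega> \<alpha>"
    "two_leg_int r \<alpha> \<omega>' = trunc_int r \<omega>' T + trunc_int r \<omega>' \<alpha>" if "0 \<le> r" for r
    using assms that by (auto intro!: two_leg_int_eq simp: T_def)
  show ?thesis
    using trunc_int_above_tangent[OF q, of \<omega>' T \<omega>] trunc_int_above_tangent[OF q, of \<omega>' \<alpha> \<omega>] q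
    by (simp add: eq distrib_left)
qed

text \<open>Strictness comes from comparing with the tangent at the midpoint.\<close>

lemma two_leg_int_above_tangent_strict:
  assumes q: "1 \<le> q" and pos: "0 < \<omega>" "0 < \<omega>'" and ne: "\<omega> \<noteq> \<omega>'"
  shows "two_leg_int q \<alpha> \<omega>' + q * (\<omega> - \<omega>') * two_leg_int (q - 1) \<alpha> \<omega>' < two_leg_int q \<alpha> \<omega>"
proof -
  define m where "m = (\<omega> + \<omega>') / 2"
  have m: "0 < m" using pos by (simp add: m_def)
  have d: "\<omega> - m = (\<omega> - \<omega>') / 2" "m - \<omega>' = (\<omega> - \<omega>') / 2" by (auto simp: m_def field_simps)
  let ?M = "two_leg_int (q - 1) \<alpha>"
  have 1: "two_leg_int q \<alpha> \<omega>' + q * ((\<omega> - \<omega>') / 2) * ?M \<omega>' \<le> two_leg_int q \<alpha> m"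
    using two_leg_int_above_tangent[OF q m pos(2)] d by simp
  have 2: "two_leg_int q \<alpha> m + q * ((\<omega> - \<omega>') / 2) * ?M m \<le> two_leg_int q \<alpha> \<omega>"
    using two_leg_int_above_tangent[OF q pos(1) m] d by simp
  have "(\<omega> - \<omega>') * ?M \<omega>' < (\<omega> - \<omega>') * ?M m"
  proof (cases "\<omega> < \<omega>'")
    case True
    then have "?M m < ?M \<omega>'" using q m by (intro two_leg_int_strict_mono) (auto simp: m_def)
    then show ?thesis using True by simp
  next
    case False
    then have "?M \<omega>' < ?M m" using q pos ne by (intro two_leg_int_strict_mono) (auto simp: m_def)
    then show ?thesis using False ne by simp
  qed
  then have "q * ((\<omega> - \<omega>') / 2) * ?M \<omega>' < q * ((\<omega> - \<omega>') / 2) * ?M m"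
    using q by (simp add: mult.assoc)
  then show ?thesis using 1 2 by (simp add: field_simps)
qed

text \<open>\<open>trunc_powr q \<omega>\<close> decreases on the half-line, so its integral from
  \<open>t\<close> to \<alpha> is at most \<open>\<alpha> - t\<close> times its value at
  \<open>t\<close>, on whichever side of \<alpha> the point \<open>t\<close> lies. The inequality is
  strict where the value at \<open>t\<close> is positive. This is the optimization over the boundary
  value: \<alpha> is the best slope.\<close>

lemma trunc_int_vertex:
  assumes q: "0 < q" and t: "0 \<le> t" "0 \<le> \<alpha>"
  shows "trunc_int q \<omega> \<alpha> \<le> (\<alpha> - t) * trunc_powr q \<omega> t + trunc_int q \<omega> t"
    and "t \<noteq> \<alpha> \<Longrightarrow> t\<^sup>2 < \<omega> \<Longrightarrow> trunc_int q \<omega> \<alpha> < (\<alpha> - t) * trunc_powr q \<omega> t + trunc_int q \<omega> t"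
proof -
  have cont: "continuous_on S (trunc_powr q \<omega>)" for S using q by (rule continuous_on_trunc_powr)
  have mv: "\<exists>z. a < z \<and> z < b \<and> trunc_int q \<omega> b - trunc_int q \<omega> a = (b - a) * trunc_powr q \<omega> z"
    if "0 \<le> a" "a < b" for a b
  proof -
    have der: "(trunc_int q \<omega> has_real_derivative trunc_powr q \<omega> z) (at z)" if "a < z" for z
      using that \<open>0 \<le> a\<close> by (intro trunc_int_has_derivative[OF _ cont, of _ "z + 1"]) auto
    have "continuous_on {a..b} (trunc_int q \<omega>)"
      by (rule continuous_on_subset[OF continuous_on_trunc_int[of q b]]) (use q that in auto)
    then obtain l z where "a < z" "z < b" "(trunc_int q \<omega> has_real_derivative l) (at z)"
      "trunc_int q \<omega> b - trunc_int q \<omega> a = (b - a) * l"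
      using MVT[OF \<open>a < b\<close>, of "trunc_int q \<omega>"] der real_differentiable_def by blast
    then show ?thesis using DERIV_unique[OF _ der] by blast
  qed
  have dec: "trunc_powr q \<omega> z \<le> trunc_powr q \<omega> y" if "0 \<le> y" "y \<le> z" for y z
  proof -
    have "y\<^sup>2 \<le> z\<^sup>2" using that by (intro power_mono)
    then show ?thesis unfolding trunc_powr_def using q by (intro powr_mono2) auto
  qed
  have sdec: "trunc_powr q \<omega> z < trunc_powr q \<omega> y" if "0 \<le> y" "y < z" "y\<^sup>2 < \<omega>" for y z
  proof -
    have "y\<^sup>2 < z\<^sup>2" using that by (intro power_strict_mono) auto
    then show ?thesis unfolding trunc_powr_def using q that by (intro powr_less_mono2) auto
  qed
  have "trunc_int q \<omega> \<alpha> \<le> (\<alpha> - t) * trunc_powr q \<omega> t + trunc_int q \<omega> t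
    \<and> (t \<noteq> \<alpha> \<longrightarrow> t\<^sup>2 < \<omega> \<longrightarrow> trunc_int q \<omega> \<alpha> < (\<alpha> - t) * trunc_powr q \<omega> t + trunc_int q \<omega> t)"
  proof (cases t \<alpha> rule: linorder_cases)
    case less
    obtain z where z: "t < z" "z < \<alpha>" "trunc_int q \<omega> \<alpha> - trunc_int q \<omega> t = (\<alpha> - t) * trunc_powr q \<omega> z"
      using mv[OF t(1) less] by blast
    have "(\<alpha> - t) * trunc_powr q \<omega> z \<le> (\<alpha> - t) * trunc_powr q \<omega> t"
      using less dec[of t z] z t by (intro mult_left_mono) auto
    moreover have "(\<alpha> - t) * trunc_powr q \<omega> z < (\<alpha> - t) * trunc_powr q \<omega> t" if "t\<^sup>2 < \<omega>"
      using less sdec[of t z] z t that by (intro mult_strict_left_mono) auto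
    ultimately show ?thesis using z(3) by fastforce
  next
    case greater
    obtain z where z: "\<alpha> < z" "z < t" "trunc_int q \<omega> t - trunc_int q \<omega> \<alpha> = (t - \<alpha>) * trunc_powr q \<omega> z"
      using mv[OF t(2) greater] by blast
    have "(t - \<alpha>) * trunc_powr q \<omega> t \<le> (t - \<alpha>) * trunc_powr q \<omega> z"
      using greater dec[of z t] z t by (intro mult_left_mono) auto
    moreover have "(t - \<alpha>) * trunc_powr q \<omega> t < (t - \<alpha>) * trunc_powr q \<omega> z" if "t\<^sup>2 < \<omega>"
    proof -
      have "z\<^sup>2 < t\<^sup>2" using z t by (intro power_strict_mono) auto
      then show ?thesis using greater sdec[of z t] z t that by (intro mult_strict_left_mono) auto
    qed
    ultimately show ?thesis using z(3) by (fastforce simp: algebra_simps)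
  qed simp
  then show "trunc_int q \<omega> \<alpha> \<le> (\<alpha> - t) * trunc_powr q \<omega> t + trunc_int q \<omega> t"
    "t \<noteq> \<alpha> \<Longrightarrow> t\<^sup>2 < \<omega> \<Longrightarrow> trunc_int q \<omega> \<alpha> < (\<alpha> - t) * trunc_powr q \<omega> t + trunc_int q \<omega> t" by auto
qed

text \<open>Intermediate value theorem for the scaled form of \<open>two_leg_int\<close>, whose
  continuity in \<open>k\<close> is visible.\<close>

lemma exists_two_leg_int_eq:
  assumes r: "0 \<le> r" and \<alpha>: "0 \<le> \<alpha>" and \<mu>: "0 < \<mu>"
  obtains k where "0 < k" "two_leg_int r \<alpha> (k\<^sup>2) = \<mu>"
proof -
  let ?L = "trunc_int r 1"
  have L: "0 < ?L 1" by (rule trunc_int_pos[OF r])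
  have Lnn: "0 \<le> ?L t" for t unfolding trunc_int_def
    using r by (intro Henstock_Kurzweil_Integration.integral_nonneg trunc_powr_integrable) auto
  have Lle: "?L t \<le> ?L 1" if "0 \<le> t" for t
  proof (cases "t \<le> 1")
    case True
    have "0 \<le> integral {t..1} (trunc_powr r 1)"
      using r by (intro Henstock_Kurzweil_Integration.integral_nonneg trunc_powr_integrable) auto
    then show ?thesis using trunc_int_combine[OF r that True, of 1] by simp
  next
    case False
    then show ?thesis using trunc_int_saturated[OF r, of 1 t] by simp
  qed
  \<comment> \<open>For \<open>k \<le> 1\<close> the power of \<open>k\<close> is at most
    \<open>k\<close> and the bracket in \<open>f\<close> below at most \<open>2 * ?L 1\<close>; for
    \<open>k \<ge> 1\<close> they are at least \<open>k\<close> and \<open>?L 1\<close>. These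
    bounds give the two end points.\<close>
  define k0 where "k0 = min 1 (\<mu> / (2 * ?L 1))"
  define k1 where "k1 = max 1 (\<mu> / ?L 1)"
  have k0: "0 < k0" "k0 \<le> 1" using L \<mu> by (auto simp: k0_def)
  have k1: "1 \<le> k1" by (simp add: k1_def)
  define f where "f k = k powr (2 * r + 1) * (?L 1 + ?L (\<alpha> / k))" for k
  have "f k0 \<le> \<mu>"
  proof -
    have "k0 powr (2 * r + 1) \<le> k0 powr 1" using k0 r by (intro powr_mono') auto
    moreover have "?L 1 + ?L (\<alpha> / k0) \<le> 2 * ?L 1" using Lle[of "\<alpha> / k0"] \<alpha> k0 by simp
    ultimately have "f k0 \<le> k0 powr 1 * (2 * ?L 1)"
      unfolding f_def using L Lnn[of "\<alpha> / k0"] by (intro mult_mono) auto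
    also have "\<dots> \<le> \<mu> / (2 * ?L 1) * (2 * ?L 1)"
      using k0 L by (intro mult_right_mono) (auto simp: k0_def)
    also have "\<dots> = \<mu>" using L by simp
    finally show ?thesis .
  qed
  moreover have "\<mu> \<le> f k1"
  proof -
    have "\<mu> = \<mu> / ?L 1 * ?L 1" using L by simp
    also have "\<dots> \<le> k1 powr 1 * ?L 1" using L k1 by (intro mult_right_mono) (auto simp: k1_def)
    also have "\<dots> \<le> f k1"
      unfolding f_def using k1 r L Lnn[of "\<alpha> / k1"] by (intro mult_mono powr_mono) auto
    finally show ?thesis .
  qed
  moreover have "continuous_on {k0..k1} f"
    unfolding f_def
  proof (intro continuous_intros continuous_on_compose2[OF continuous_on_trunc_int[OF r, of "\<alpha> / k0"]])
    show "(\<lambda>k. \<alpha> / k) ` {k0..k1} \<subseteq> {0..\<alpha> / k0}"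
      using \<alpha> k0 by (auto intro!: divide_left_mono)
  qed (use k0 in auto)
  ultimately obtain k where "k0 \<le> k" "k \<le> k1" "f k = \<mu>"
    using IVT'[of f k0 \<mu> k1] k0 k1 by auto
  then show ?thesis using that[of k] two_leg_int_scaling[of k r \<alpha>] k0 by (simp add: f_def)
qed

section \<open>The completed square\<close>

text \<open>The nonlinearity \<open>|u|^(p-2) u\<close> is at most cubic, which is the same as
  \<open>q \<ge> 1\<close> for the exponent \<open>q\<close> below.\<close>

locale subcubic =
  fixes p :: real
  assumes p_gt: "2 < p" and p_le: "p \<le> 4"
begin

definition q :: real where "q = 2 / (p - 2)"

definition A :: real where "A = (p / 2) powr q"

definition peak :: "real \<Rightarrow> real" where "peak k = (p / 2 * k\<^sup>2) powr (1 / (p - 2))"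

text \<open>Modulus of the logarithmic derivative of a soliton as a function of its value
  \<open>c\<close>, read off from the first integral \<open>v^2 = k^2 w^2 - 2/p |w|^p\<close>;
  accordingly \<open>speed\<close> is the modulus of the derivative. Cutting off at 0 extends both
  continuously beyond the peak, so that \<open>speed k\<close> has an antiderivative on the whole
  line.\<close>

definition slope :: "real \<Rightarrow> real \<Rightarrow> real" where
  "slope k c = sqrt (max 0 (k\<^sup>2 - 2 / p * \<bar>c\<bar> powr (p - 2)))"

definition speed :: "real \<Rightarrow> real \<Rightarrow> real" where
  "speed k c = \<bar>c\<bar> * slope k c"

lemma q_ge_1: "1 \<le> q" using p_gt p_le by (simp add: q_def)
lemma p2_q: "(p - 2) * q = 2" using p_gt by (simp add: q_def field_simps)
lemma q_pos: "0 < q" using q_ge_1 by simp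
lemma A_pos: "0 < A" using p_gt by (simp add: A_def)

lemma peak_pos: "k \<noteq> 0 \<Longrightarrow> 0 < peak k" using p_gt by (simp add: peak_def)

lemma peak_powr: "k \<noteq> 0 \<Longrightarrow> peak k powr (p - 2) = p / 2 * k\<^sup>2"
  using p_gt by (simp add: peak_def powr_powr)

lemma continuous_slope: "continuous_on S (slope k)"
  unfolding slope_def[abs_def] using p_gt by (intro continuous_intros continuous_on_powr') auto

lemma continuous_speed: "continuous_on S (speed k)"
  unfolding speed_def[abs_def] by (intro continuous_intros continuous_slope)

lemma speed_nonneg: "0 \<le> speed k c" by (simp add: speed_def slope_def)

lemma slope_bounds: "0 \<le> slope k c" "0 < k \<Longrightarrow> slope k c \<le> k"
proof -
  show "0 \<le> slope k c" by (simp add: slope_def)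
  assume "0 < k"
  have "slope k c \<le> sqrt (k\<^sup>2)" unfolding slope_def using p_gt by (intro real_sqrt_le_mono) simp
  then show "slope k c \<le> k" using \<open>0 < k\<close> by simp
qed

lemma below_peak:
  assumes "0 < k" "\<bar>c\<bar> \<le> peak k"
  shows "2 / p * \<bar>c\<bar> powr (p - 2) \<le> k\<^sup>2"
proof -
  have "\<bar>c\<bar> powr (p - 2) \<le> peak k powr (p - 2)"
    using assms p_gt by (intro powr_mono2) auto
  then show ?thesis using peak_powr[of k] assms p_gt by (simp add: field_simps)
qed

lemma strictly_below_peak:
  assumes "0 < k" "\<bar>c\<bar> < peak k"
  shows "2 / p * \<bar>c\<bar> powr (p - 2) < k\<^sup>2"
proof -
  have "\<bar>c\<bar> powr (p - 2) < peak k powr (p - 2)"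
    using assms p_gt by (intro powr_less_mono2) auto
  then show ?thesis using peak_powr[of k] assms p_gt by (simp add: field_simps)
qed

lemma slope_sq:
  assumes "0 < k" "\<bar>c\<bar> \<le> peak k"
  shows "(slope k c)\<^sup>2 = k\<^sup>2 - 2 / p * \<bar>c\<bar> powr (p - 2)"
  using below_peak[OF assms] by (simp add: slope_def)

lemma speed_sq:
  assumes "0 < k" "\<bar>c\<bar> \<le> peak k"
  shows "(speed k c)\<^sup>2 = k\<^sup>2 * c\<^sup>2 - 2 / p * \<bar>c\<bar> powr p"
proof (cases "c = 0")
  case False
  have "\<bar>c\<bar> powr p = \<bar>c\<bar> powr (p - 2) * c\<^sup>2"
    using powr_add[of "\<bar>c\<bar>" "p - 2" 2] False by simp
  moreover have "(speed k c)\<^sup>2 = c\<^sup>2 * (k\<^sup>2 - 2 / p * \<bar>c\<bar> powr (p - 2))"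
    by (simp add: speed_def power_mult_distrib slope_sq[OF assms])
  ultimately show ?thesis by (simp add: algebra_simps)
qed (simp add: speed_def)

text \<open>Inverts \<open>slope\<close>: a value not above the peak is recovered, up to sign, from
  its slope. This is the parametrization of the boundary value by \<open>t\<close>.\<close>

lemma A_trunc_powr_slope:
  assumes "0 < k" "\<bar>c\<bar> \<le> peak k"
  shows "A * trunc_powr q (k\<^sup>2) (slope k c) = c\<^sup>2"
proof (cases "c = 0")
  case True
  then show ?thesis using slope_sq[OF assms] by (simp add: trunc_powr_def)
next
  case False
  have "trunc_powr q (k\<^sup>2) (slope k c) = (2 / p * \<bar>c\<bar> powr (p - 2)) powr q"
    using slope_sq[OF assms] p_gt by (simp add: trunc_powr_def)
  also have "\<dots> = (2 / p) powr q * (\<bar>c\<bar> powr (p - 2)) powr q"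
    by (rule powr_mult)
  also have "(\<bar>c\<bar> powr (p - 2)) powr q = \<bar>c\<bar> powr ((p - 2) * q)" by (rule powr_powr)
  also have "(p - 2) * q = 2" by (rule p2_q)
  also have "\<bar>c\<bar> powr 2 = c\<^sup>2" using False by simp
  finally have "A * trunc_powr q (k\<^sup>2) (slope k c) = (A * (2 / p) powr q) * c\<^sup>2" by simp
  also have "A * (2 / p) powr q = (p / 2 * (2 / p)) powr q"
    unfolding A_def by (rule powr_mult[symmetric])
  also have "\<dots> = 1" using p_gt by simp
  finally show ?thesis by simp
qed

lemma slope_deriv:
  assumes "0 < k" "0 < c" "c < peak k"
  obtains d where "(slope k has_real_derivative d) (at c)" "0 < slope k c" "slope k c < k"
proof -
  have pos: "0 < k\<^sup>2 - 2 / p * c powr (p - 2)" using strictly_below_peak[of k c] assms by simp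
  have "((\<lambda>c. k\<^sup>2 - 2 / p * c powr (p - 2)) has_real_derivative 0 - 2 / p * ((p - 2) * c powr (p - 2 - 1))) (at c)"
    by (intro DERIV_diff DERIV_const DERIV_cmult has_real_derivative_powr assms)
  from DERIV_chain2[OF DERIV_real_sqrt[OF pos] this]
  obtain d where d: "((\<lambda>c. sqrt (k\<^sup>2 - 2 / p * c powr (p - 2))) has_real_derivative d) (at c)" by blast
  have "(slope k has_real_derivative d) (at c)"
  proof (rule has_field_derivative_transform_within_open[OF d, of "{0<..<peak k}"])
    show "sqrt (k\<^sup>2 - 2 / p * y powr (p - 2)) = slope k y" if "y \<in> {0<..<peak k}" for y
      using strictly_below_peak[of k y] assms that by (simp add: slope_def)
  qed (use assms in auto)
  moreover have "0 < slope k c" using pos assms by (simp add: slope_def)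
  moreover have "(slope k c)\<^sup>2 < k\<^sup>2"
    using slope_sq[of k c] assms p_gt by simp
  then have "slope k c < k" using assms(1) by (simp add: power_less_imp_less_base)
  ultimately show ?thesis by (rule that)
qed

text \<open>Integration by parts: twice the integral of \<open>c * slope k c\<close> is
  \<open>slope k c * c^2\<close> minus the integral of \<open>c^2\<close> against the differential
  of \<open>slope\<close>, and \<open>A_trunc_powr_slope\<close> writes \<open>c^2\<close> as a
  function of the slope, which starts at \<open>k\<close> for \<open>c = 0\<close>.\<close>

lemma potential_eq:
  assumes F: "\<And>c. (F has_real_derivative speed k c) (at c)" and k: "0 < k" and c: "0 \<le> c" "c \<le> peak k"
  shows "2 * (F c - F 0) = A * (trunc_int q (k\<^sup>2) k - trunc_int q (k\<^sup>2) (slope k c)) + slope k c * c\<^sup>2"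
proof -
  define D where "D c = 2 * F c - (slope k c * c\<^sup>2 - A * trunc_int q (k\<^sup>2) (slope k c))" for c
  have "D c = D 0"
  proof (cases "c = 0")
    case False
    then have "0 < peak k" using c by simp
    have "D x = D 0" if "0 \<le> x" "x \<le> peak k" for x
    \<comment> \<open>Derivatives are taken strictly between 0 and the peak, away from the square
      root singularity of \<open>slope k\<close>; continuity covers the ends.\<close>
    proof (rule DERIV_isconst2[OF \<open>0 < peak k\<close> _ _ that])
      have "continuous_on {0..peak k} F"
        using F by (intro continuous_at_imp_continuous_on) (auto intro: DERIV_isCont)
      moreover have "continuous_on {0..peak k} (\<lambda>c. trunc_int q (k\<^sup>2) (slope k c))"
        by (rule continuous_on_compose2[OF continuous_on_trunc_int[of q k] continuous_slope])
           (use q_pos slope_bounds k in auto)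
      ultimately show "continuous_on {0..peak k} D"
        unfolding D_def by (intro continuous_intros continuous_slope)
      fix x assume x: "0 < x" "x < peak k"
      obtain d where d: "(slope k has_real_derivative d) (at x)" "0 < slope k x" "slope k x < k"
        using slope_deriv[OF k x] by blast
      have "((\<lambda>c. trunc_int q (k\<^sup>2) (slope k c)) has_real_derivative trunc_powr q (k\<^sup>2) (slope k x) * d) (at x)"
        by (rule DERIV_chain2[OF trunc_int_has_derivative[OF d(2) continuous_on_trunc_powr[OF q_pos] d(3)] d(1)])
      then have "(D has_real_derivative
          2 * speed k x - (d * x\<^sup>2 + slope k x * (2 * x) - A * (trunc_powr q (k\<^sup>2) (slope k x) * d))) (at x)"
        unfolding D_def using F d(1) by (auto intro!: derivative_eq_intros)
      moreover have "A * (trunc_powr q (k\<^sup>2) (slope k x) * d) = d * x\<^sup>2"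
        using A_trunc_powr_slope[OF k, of x] x by (simp flip: mult.assoc)
      then have "2 * speed k x - (d * x\<^sup>2 + slope k x * (2 * x) - A * (trunc_powr q (k\<^sup>2) (slope k x) * d)) = 0"
        using x by (simp add: speed_def)
      ultimately show "(D has_real_derivative 0) (at x)" by (rule DERIV_cong)
    qed
    then show ?thesis using c by blast
  qed simp
  moreover have "slope k 0 = k" using k by (simp add: slope_def)
  ultimately show ?thesis by (simp add: D_def algebra_simps)
qed

text \<open>Completing the square turns the action into the defect \<open>(v \<mp> speed k w)\<^sup>2\<close> plus boundary
  terms; the sign changes at a maximum point \<open>x\<^sub>0\<close> of \<open>w\<close>.\<close>

definition defect :: "real \<Rightarrow> real \<Rightarrow> (real \<Rightarrow> real) \<Rightarrow> (real \<Rightarrow> real) \<Rightarrow> real \<Rightarrow> real" where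
  "defect k x\<^sub>0 w v x = v x - (if x \<le> x\<^sub>0 then 1 else -1) * speed k (w x)"

text \<open>Below the peak \<open>(speed k w)^2\<close> is exactly
  \<open>k^2 w^2 - 2/p |w|^p\<close>, so the defect squared is the action density minus twice the
  cross term \<open>g\<close>. Up to sign \<open>g\<close> is the derivative of
  \<open>F (w x)\<close>. Integrated upwards to \<open>x0\<close> and downwards to \<open>X\<close>
  it telescopes, and \<open>w\<close> tends to 0 as \<open>X\<close> grows.\<close>

lemma completed_square:
  assumes w: "H1_pair w v" and k: "0 < k" and x0: "0 \<le> x0" "w x0 = peak k"
    and le: "\<And>x. 0 \<le> x \<Longrightarrow> \<bar>w x\<bar> \<le> peak k"
    and F: "\<And>c. (F has_real_derivative speed k c) (at c)"
  shows "(\<lambda>x. (defect k x0 w v x)\<^sup>2) absolutely_integrable_on {0..}" (is ?g1)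
    and "2 * pair_energy p \<alpha> w v + k\<^sup>2 * integral {0..} (\<lambda>x. (w x)\<^sup>2)
      = integral {0..} (\<lambda>x. (defect k x0 w v x)\<^sup>2) + 4 * F (peak k) - 2 * F (w 0) - 2 * F 0 + \<alpha> * (w 0)\<^sup>2" (is ?g2)
proof -
  note pr = H1_pair_props[OF w]
  define \<sigma> where "\<sigma> x = (if x \<le> x0 then 1 else -1 :: real)" for x
  define g where "g x = \<sigma> x * (speed k (w x) * v x)" for x
  have pw: "(\<lambda>x. \<bar>w x\<bar> powr p) absolutely_integrable_on {0..}" by (rule H1_pair_powr_integrable[OF w p_gt])
  have sp: "(speed k (w x))\<^sup>2 = k\<^sup>2 * (w x)\<^sup>2 - 2 / p * \<bar>w x\<bar> powr p" if "0 \<le> x" for x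
    by (rule speed_sq[OF k le[OF that]])
  define f where "f x = (v x)\<^sup>2 + (k\<^sup>2 * (w x)\<^sup>2 - 2 / p * \<bar>w x\<bar> powr p)" for x
  have f: "f absolutely_integrable_on {0..}"
    unfolding f_def using pr(2,3) pw by (intro set_integral_add set_integral_diff) auto
  then have fi: "f integrable_on {0..}" by (simp add: absolutely_integrable_on_def)
  have ch: "primitive_on {0..} (\<lambda>x. F (w x)) (\<lambda>x. speed k (w x) * v x)"
    by (rule primitive_on_chain[OF pr(1) _ F continuous_speed]) (simp add: is_interval_ci)
  have g: "g absolutely_integrable_on {0..}"
  proof (rule measurable_bounded_by_integrable_imp_absolutely_integrable[OF _ _ fi])
    have "\<sigma> \<in> borel_measurable borel" unfolding \<sigma>_def[abs_def] by measurable
    then have "\<sigma> \<in> borel_measurable lebesgue" by (intro measurable_completion) auto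
    then have "\<sigma> \<in> borel_measurable (lebesgue_on {0..})" by (rule measurable_restrict_space1)
    then show "g \<in> borel_measurable (lebesgue_on {0..})"
      unfolding g_def[abs_def] by (intro borel_measurable_times primitive_on_Ici_measurable[OF ch])
    fix x :: real assume "x \<in> {0..}"
    then have fx: "f x = (v x)\<^sup>2 + (speed k (w x))\<^sup>2" using sp by (simp add: f_def)
    have "2 * (speed k (w x) * \<bar>v x\<bar>) \<le> f x"
      using sum_squares_bound[of "speed k (w x)" "\<bar>v x\<bar>"] unfolding fx by simp
    moreover have "0 \<le> speed k (w x) * \<bar>v x\<bar>" by (simp add: speed_nonneg)
    moreover have "norm (g x) = speed k (w x) * \<bar>v x\<bar>"
      using speed_nonneg[of k "w x"] by (simp add: g_def abs_mult \<sigma>_def)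
    ultimately show "norm (g x) \<le> f x" by linarith
  qed auto
  then have gi: "g integrable_on {0..}" by (simp add: absolutely_integrable_on_def)
  have defect: "(defect k x0 w v x)\<^sup>2 = f x - 2 * g x" if "0 \<le> x" for x
  proof -
    have "(\<sigma> x)\<^sup>2 = 1" by (simp add: \<sigma>_def)
    then have "(v x - \<sigma> x * speed k (w x))\<^sup>2 = (v x)\<^sup>2 + (speed k (w x))\<^sup>2 - 2 * g x"
      by (simp add: power2_diff power_mult_distrib g_def)
    then show ?thesis using sp[OF that] by (simp add: defect_def f_def \<sigma>_def)
  qed
  have "(\<lambda>x. f x - 2 * g x) absolutely_integrable_on {0..}" using f g by auto
  then show ?g1 by (rule absolutely_integrable_spike[of _ _ "{}"]) (use defect in auto)
  have gX: "integral {0..X} g = 2 * F (peak k) - F (w 0) - F (w X)" if X: "x0 \<le> X" for X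
  proof -
    have "integral {0..X} g = integral {0..x0} g + integral {x0..X} g"
      using x0 X by (intro Henstock_Kurzweil_Integration.integral_combine[symmetric] integrable_on_subinterval[OF gi]) auto
    also have "integral {0..x0} g = integral {0..x0} (\<lambda>x. speed k (w x) * v x)"
      by (intro Henstock_Kurzweil_Integration.integral_cong) (simp add: g_def \<sigma>_def)
    also have "\<dots> = F (peak k) - F (w 0)"
      using primitive_onD(2)[OF ch, of 0 x0] x0 by simp
    \<comment> \<open>The sign at \<open>x0\<close> itself is still \<open>+1\<close>, so the two
      integrands differ at that single point.\<close>
    also have "integral {x0..X} g = integral {x0..X} (\<lambda>x. - (speed k (w x) * v x))"
      by (rule integral_spike[of "{x0}"]) (auto simp: g_def \<sigma>_def)
    also have "\<dots> = F (peak k) - F (w X)"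
      using primitive_onD(2)[OF ch, of x0 X] x0 X by simp
    finally show ?thesis by simp
  qed
  have "((\<lambda>X. integral {0..X} g) \<longlongrightarrow> integral {0..} g) at_top" by (rule integral_Icc_tendsto_at_top[OF g])
  moreover have "((\<lambda>X. integral {0..X} g) \<longlongrightarrow> 2 * F (peak k) - F (w 0) - F 0) at_top"
  proof (rule Lim_transform_eventually)
    have "isCont F 0" using F by (rule DERIV_isCont)
    then have "((\<lambda>X. F (w X)) \<longlongrightarrow> F 0) at_top"
      by (rule isCont_tendsto_compose[OF _ H1_pair_tendsto_0[OF w]])
    then show "((\<lambda>X. 2 * F (peak k) - F (w 0) - F (w X)) \<longlongrightarrow> 2 * F (peak k) - F (w 0) - F 0) at_top"
      by (intro tendsto_intros)
    show "eventually (\<lambda>X. 2 * F (peak k) - F (w 0) - F (w X) = integral {0..X} g) at_top"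
      using eventually_ge_at_top[of x0] by eventually_elim (simp add: gX)
  qed
  ultimately have G: "integral {0..} g = 2 * F (peak k) - F (w 0) - F 0"
    by (intro tendsto_unique[OF trivial_limit_at_top_linorder])
  have "integral {0..} (\<lambda>x. (defect k x0 w v x)\<^sup>2) = integral {0..} (\<lambda>x. f x - 2 * g x)"
    by (intro Henstock_Kurzweil_Integration.integral_cong) (use defect in auto)
  also have "\<dots> = integral {0..} f - 2 * integral {0..} g"
    using fi gi by (subst Henstock_Kurzweil_Integration.integral_diff) (auto intro: integrable_on_mult_right)
  also have "integral {0..} f = integral {0..} (\<lambda>x. (v x)\<^sup>2) + (k\<^sup>2 * integral {0..} (\<lambda>x. (w x)\<^sup>2) - 2 / p * integral {0..} (\<lambda>x. \<bar>w x\<bar> powr p))"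
  proof -
    have "(\<lambda>x. \<bar>w x\<bar> powr p) integrable_on {0..}" using pw by (simp add: absolutely_integrable_on_def)
    then have "((\<lambda>x. (v x)\<^sup>2 + (k\<^sup>2 * (w x)\<^sup>2 - 2 / p * \<bar>w x\<bar> powr p)) has_integral
      (integral {0..} (\<lambda>x. (v x)\<^sup>2) + (k\<^sup>2 * integral {0..} (\<lambda>x. (w x)\<^sup>2) - 2 / p * integral {0..} (\<lambda>x. \<bar>w x\<bar> powr p)))) {0..}"
      using pr(4,5) by (intro has_integral_add has_integral_diff has_integral_mult_right integrable_integral)
    then show ?thesis unfolding f_def by (rule integral_unique)
  qed
  finally show ?g2 unfolding G by (simp add: pair_energy_def algebra_simps)
qed

text \<open>Insert \<open>potential_eq\<close> at the peak, where the slope is 0, and at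
  \<open>|w 0|\<close>. The boundary value may be negative while the potential is known at
  \<open>|w 0|\<close> only; as \<open>F\<close> is nondecreasing, this costs an inequality in the
  right direction.\<close>

lemma pair_energy_identity:
  assumes w: "H1_pair w v" and k: "0 < k" and x0: "0 \<le> x0" "w x0 = peak k"
    and le: "\<And>x. 0 \<le> x \<Longrightarrow> \<bar>w x\<bar> \<le> peak k"
  defines "t \<equiv> slope k (w 0)"
  shows "integral {0..} (\<lambda>x. (defect k x0 w v x)\<^sup>2)
      + A * (trunc_int q (k\<^sup>2) k + trunc_int q (k\<^sup>2) t + (\<alpha> - t) * trunc_powr q (k\<^sup>2) t)
      \<le> 2 * pair_energy p \<alpha> w v + k\<^sup>2 * integral {0..} (\<lambda>x. (w x)\<^sup>2)" (is "?L \<le> ?R")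
    and "0 \<le> w 0 \<Longrightarrow> 2 * pair_energy p \<alpha> w v + k\<^sup>2 * integral {0..} (\<lambda>x. (w x)\<^sup>2)
      = integral {0..} (\<lambda>x. (defect k x0 w v x)\<^sup>2)
      + A * (trunc_int q (k\<^sup>2) k + trunc_int q (k\<^sup>2) t + (\<alpha> - t) * trunc_powr q (k\<^sup>2) t)"
proof -
  obtain F where F: "\<And>c. (F has_real_derivative speed k c) (at c)"
    using continuous_antiderivative[OF continuous_speed] by blast
  have c: "0 \<le> \<bar>w 0\<bar>" "\<bar>w 0\<bar> \<le> peak k" using le[of 0] by auto
  have pk: "0 < peak k" using k by (intro peak_pos) simp
  have "slope k (peak k) = 0"
    using pk p_gt k by (simp add: slope_def peak_powr)
  then have 1: "2 * (F (peak k) - F 0) = A * trunc_int q (k\<^sup>2) k"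
    using potential_eq[OF F k, of "peak k"] pk by simp
  have ts: "slope k \<bar>w 0\<bar> = t" by (simp add: t_def slope_def)
  have 2: "2 * (F \<bar>w 0\<bar> - F 0) = A * (trunc_int q (k\<^sup>2) k - trunc_int q (k\<^sup>2) t) + t * (w 0)\<^sup>2"
    using potential_eq[OF F k c] by (simp add: ts)
  have 3: "A * trunc_powr q (k\<^sup>2) t = (w 0)\<^sup>2"
    using A_trunc_powr_slope[OF k c(2)] by (simp add: t_def)
  have L: "?L = integral {0..} (\<lambda>x. (defect k x0 w v x)\<^sup>2)
      + A * (trunc_int q (k\<^sup>2) k + trunc_int q (k\<^sup>2) t) + (\<alpha> - t) * (w 0)\<^sup>2"
    unfolding 3[symmetric] by (simp add: algebra_simps)
  have R: "?R = integral {0..} (\<lambda>x. (defect k x0 w v x)\<^sup>2) + 4 * F (peak k) - 2 * F (w 0) - 2 * F 0 + \<alpha> * (w 0)\<^sup>2"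
    by (rule completed_square(2)[OF w k x0 le F])
  have "F (w 0) \<le> F \<bar>w 0\<bar>"
    by (rule DERIV_nonneg_imp_nondecreasing) (use F speed_nonneg in auto)
  with 1 2 show "?L \<le> ?R" unfolding L R by (simp add: algebra_simps)
  from 1 2 show "?R = ?L" if "0 \<le> w 0" unfolding L R using that by (simp add: algebra_simps)
qed

text \<open>A zero square integral forces all interval integrals of the defect to vanish, by
  \<open>|e| \<le> \<delta> + e^2 / \<delta>\<close> with small \<delta>. On each side of
  \<open>x0\<close> the function \<open>w\<close> is thereby a primitive of a continuous function,
  hence classically differentiable.\<close>

lemma defect_zero_imp_speed:
  assumes w: "H1_pair w v" and int: "(\<lambda>x. (defect k x0 w v x)\<^sup>2) absolutely_integrable_on {0..}"
    and zero: "integral {0..} (\<lambda>x. (defect k x0 w v x)\<^sup>2) = 0" and ab: "0 \<le> a" "a \<le> b"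
  shows "b \<le> x0 \<Longrightarrow> w b - w a = integral {a..b} (\<lambda>x. speed k (w x))"
    "x0 \<le> a \<Longrightarrow> w b - w a = - integral {a..b} (\<lambda>x. speed k (w x))"
proof -
  note pr = H1_pair_props[OF w]
  define \<sigma> where "\<sigma> x = (if x \<le> x0 then 1 else -1 :: real)" for x
  have vi: "(v has_integral (w b - w a)) {a..b}" by (rule primitive_onD[OF pr(1)]) (use ab in auto)
  have ci: "(\<lambda>x. speed k (w x)) integrable_on {a..b}"
    by (intro integrable_continuous_real continuous_on_compose2[OF continuous_speed[of UNIV] continuous_on_subset[OF pr(6)]])
       (use ab in auto)
  have key: "w b - w a = c * integral {a..b} (\<lambda>x. speed k (w x))"
    if c: "\<And>x. x \<in> {a..b} - {x0} \<Longrightarrow> \<sigma> x = c" for c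
  proof -
    have d2: "(\<lambda>x. (defect k x0 w v x)\<^sup>2) integrable_on {a..b}"
      using ab by (intro integrable_on_subinterval[of _ "{0..}"] absolutely_integrable_on_def[THEN iffD1, THEN conjunct1, OF int]) auto
    have "integral {a..b} (\<lambda>x. (defect k x0 w v x)\<^sup>2) \<le> integral {0..} (\<lambda>x. (defect k x0 w v x)\<^sup>2)"
      by (rule integral_subset_le[OF _ d2]) (use ab int in \<open>auto simp: absolutely_integrable_on_def\<close>)
    then have z: "integral {a..b} (\<lambda>x. (defect k x0 w v x)\<^sup>2) \<le> 0" using zero by simp
    define e where "e x = v x - c * speed k (w x)" for x
    have ei: "(e has_integral (w b - w a - c * integral {a..b} (\<lambda>x. speed k (w x)))) {a..b}"
      unfolding e_def by (intro has_integral_diff vi has_integral_mult_right integrable_integral ci)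
    have "defect k x0 w v x = e x" if "x \<in> {a..b} - {x0}" for x
      using c[OF that] by (auto simp: defect_def e_def \<sigma>_def)
    then have e2: "(\<lambda>x. (e x)\<^sup>2) integrable_on {a..b}" "integral {a..b} (\<lambda>x. (e x)\<^sup>2) \<le> 0"
      using integrable_spike[OF d2, of "{x0}" "\<lambda>x. (e x)\<^sup>2"] z
        integral_spike[of "{x0}" "{a..b}" "\<lambda>x. (defect k x0 w v x)\<^sup>2" "\<lambda>x. (e x)\<^sup>2"] by auto
    have "\<bar>w b - w a - c * integral {a..b} (\<lambda>x. speed k (w x))\<bar> \<le> 0 + \<epsilon>" if "0 < \<epsilon>" for \<epsilon>
    proof -
      \<comment> \<open>Chosen so that \<open>\<delta> * (b - a) \<le> \<epsilon>\<close>; the added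
        1 allows \<open>a = b\<close>.\<close>
      define \<delta> where "\<delta> = \<epsilon> / (b - a + 1)"
      have \<delta>: "0 < \<delta>" using that ab by (simp add: \<delta>_def)
      have "norm (integral {a..b} e) \<le> integral {a..b} (\<lambda>x. \<delta> + 1 / \<delta> * (e x)\<^sup>2)"
      proof (rule integral_norm_bound_integral)
        show "e integrable_on {a..b}" using ei by blast
        show "(\<lambda>x. \<delta> + 1 / \<delta> * (e x)\<^sup>2) integrable_on {a..b}"
          using e2(1) by (intro integrable_add integrable_on_mult_right) auto
        fix x
        have "2 * (\<delta> / 2) * \<bar>e x\<bar> \<le> (\<delta> / 2)\<^sup>2 + \<bar>e x\<bar>\<^sup>2" by (rule sum_squares_bound)
        moreover have "(\<delta> / 2)\<^sup>2 \<le> \<delta> * \<delta>" by (simp add: power2_eq_square)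
        ultimately have "\<delta> * \<bar>e x\<bar> \<le> \<delta> * \<delta> + (e x)\<^sup>2" by simp
        then have "(\<delta> * \<bar>e x\<bar>) / \<delta> \<le> (\<delta> * \<delta> + (e x)\<^sup>2) / \<delta>"
          by (rule divide_right_mono) (use \<delta> in simp)
        then show "norm (e x) \<le> \<delta> + 1 / \<delta> * (e x)\<^sup>2"
          using \<delta> by (simp add: add_divide_distrib)
      qed
      also have "\<dots> = integral {a..b} (\<lambda>_. \<delta>) + integral {a..b} (\<lambda>x. 1 / \<delta> * (e x)\<^sup>2)"
        by (intro Henstock_Kurzweil_Integration.integral_add integrable_const_ivl integrable_on_mult_right e2(1))
      also have "\<dots> = \<delta> * (b - a) + 1 / \<delta> * integral {a..b} (\<lambda>x. (e x)\<^sup>2)"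
        using ab by simp
      also have "\<dots> \<le> \<delta> * (b - a)" using e2(2) \<delta> by (simp add: divide_nonpos_pos)
      also have "\<dots> \<le> \<epsilon>" using that ab by (simp add: \<delta>_def field_simps)
      finally show ?thesis using integral_unique[OF ei] by simp
    qed
    then have "\<bar>w b - w a - c * integral {a..b} (\<lambda>x. speed k (w x))\<bar> \<le> 0" by (rule field_le_epsilon)
    then show ?thesis by simp
  qed
  show "b \<le> x0 \<Longrightarrow> w b - w a = integral {a..b} (\<lambda>x. speed k (w x))"
    using key[of 1] by (auto simp: \<sigma>_def)
  show "x0 \<le> a \<Longrightarrow> w b - w a = - integral {a..b} (\<lambda>x. speed k (w x))"
    using key[of "-1"] by (auto simp: \<sigma>_def)
qed

end

section \<open>Solitons\<close>

lemma abs_less_iff_power2_less: "\<bar>x\<bar> < \<bar>y\<bar> \<longleftrightarrow> x\<^sup>2 < (y::real)\<^sup>2"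
  using abs_le_square_iff[of y x] by linarith

context subcubic
begin

definition kap :: real where "kap = (p - 2) / 2"

text \<open>Logarithmic derivative of the soliton of frequency \<open>k^2\<close>. For
  \<open>k > 0\<close> it decreases from \<open>k\<close> to \<open>-k\<close> and solves a Riccati
  equation, through which the soliton computations run.\<close>

definition logd :: "real \<Rightarrow> real \<Rightarrow> real" where "logd k x = - k * tanh (kap * k * x)"

abbreviation sol :: "real \<Rightarrow> real \<Rightarrow> real" where "sol k \<equiv> soliton p (k\<^sup>2)"

lemma kap_pos: "0 < kap" using p_gt by (simp add: kap_def)

lemma q_kap: "q * kap = 1" using p_gt by (simp add: q_def kap_def)

lemma logd_deriv: "(logd k has_real_derivative - kap * (k\<^sup>2 - (logd k x)\<^sup>2)) (at x)"
proof -
  have "(logd k has_real_derivative - k * ((1 - (tanh (kap * k * x))\<^sup>2) * (kap * k * 1))) (at x)"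
    unfolding logd_def[abs_def]
    by (intro DERIV_cmult has_field_derivative_tanh DERIV_ident) simp
  then show ?thesis by (rule DERIV_cong) (simp add: logd_def power2_eq_square algebra_simps)
qed

lemma logd_bounds: "0 < k \<Longrightarrow> - k < logd k x" "0 < k \<Longrightarrow> logd k x < k" "0 < k \<Longrightarrow> (logd k x)\<^sup>2 < k\<^sup>2"
proof -
  assume k: "0 < k"
  have t: "-1 < tanh (kap * k * x)" "tanh (kap * k * x) < 1" using tanh_real_bounds[of "kap * k * x"] by auto
  show 1: "- k < logd k x" using mult_strict_left_mono[OF t(2) k] by (simp add: logd_def)
  show 2: "logd k x < k" using mult_strict_left_mono[OF t(1) k] by (simp add: logd_def)
  have "\<bar>logd k x\<bar> < \<bar>k\<bar>" using 1 2 k by auto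
  then show "(logd k x)\<^sup>2 < k\<^sup>2" by (simp add: abs_less_iff_power2_less)
qed

lemma logd_0 [simp]: "logd k 0 = 0" by (simp add: logd_def)

text \<open>\<open>sech^2 = 1 - tanh^2\<close> expresses the closed form through the logarithmic
  derivative.\<close>

lemma sol_eq:
  assumes "0 < k"
  shows "sol k x = (p / 2 * (k\<^sup>2 - (logd k x)\<^sup>2)) powr (1 / (p - 2))"
proof -
  define y where "y = kap * k * x"
  have "p / 2 - 1 = kap" by (simp add: kap_def diff_divide_distrib)
  then have "(p / 2 - 1) * sqrt (k\<^sup>2) * \<bar>x\<bar> = \<bar>y\<bar>"
    using assms kap_pos by (simp add: y_def abs_mult)
  then have "(sech ((p / 2 - 1) * sqrt (k\<^sup>2) * \<bar>x\<bar>))\<^sup>2 = 1 / (cosh y)\<^sup>2"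
    by (simp add: sech_def power_divide)
  also have "\<dots> = 1 - (tanh y)\<^sup>2"
  proof -
    have "1 - (tanh y)\<^sup>2 = ((cosh y)\<^sup>2 - (sinh y)\<^sup>2) / (cosh y)\<^sup>2"
      by (simp add: tanh_def power_divide diff_divide_distrib)
    then show ?thesis by (simp add: hyperbolic_pythagoras)
  qed
  finally have "k\<^sup>2 * (sech ((p / 2 - 1) * sqrt (k\<^sup>2) * \<bar>x\<bar>))\<^sup>2 = k\<^sup>2 - (logd k x)\<^sup>2"
    by (simp add: logd_def y_def power_mult_distrib right_diff_distrib)
  then show ?thesis unfolding soliton_def mult.assoc by simp
qed

lemma sol_base_pos: "0 < k \<Longrightarrow> 0 < p / 2 * (k\<^sup>2 - (logd k x)\<^sup>2)"
  using logd_bounds(3)[of k x] p_gt by simp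

lemma sol_pos:
  assumes "0 < k" shows "0 < sol k x"
proof -
  have "p / 2 * (k\<^sup>2 - (logd k x)\<^sup>2) \<noteq> 0" using sol_base_pos[OF assms, of x] by (rule less_imp_neq[symmetric])
  then show ?thesis unfolding sol_eq[OF assms] powr_gt_zero .
qed

lemma sol_powr: "0 < k \<Longrightarrow> sol k x powr (p - 2) = p / 2 * (k\<^sup>2 - (logd k x)\<^sup>2)"
  using sol_base_pos[of k x] p_gt unfolding sol_eq powr_powr by simp

lemma sol_sq:
  assumes "0 < k" shows "(sol k x)\<^sup>2 = A * trunc_powr q (k\<^sup>2) (logd k x)"
proof -
  have "(sol k x)\<^sup>2 = sol k x powr 2" using sol_pos[OF assms, of x] by simp
  also have "\<dots> = (p / 2 * (k\<^sup>2 - (logd k x)\<^sup>2)) powr (1 / (p - 2) * 2)"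
    unfolding sol_eq[OF assms] powr_powr ..
  also have "1 / (p - 2) * 2 = q" by (simp add: q_def)
  also have "(p / 2 * (k\<^sup>2 - (logd k x)\<^sup>2)) powr q = A * (k\<^sup>2 - (logd k x)\<^sup>2) powr q"
    unfolding A_def by (rule powr_mult)
  also have "\<dots> = A * trunc_powr q (k\<^sup>2) (logd k x)"
    using logd_bounds(3)[OF assms, of x] by (simp add: trunc_powr_def)
  finally show ?thesis .
qed

lemma sol_deriv:
  assumes "0 < k" shows "(sol k has_real_derivative logd k x * sol k x) (at x)"
proof -
  define g where "g x = p / 2 * (k\<^sup>2 - (logd k x)\<^sup>2)" for x
  define r where "r = 1 / (p - 2)"
  have g: "0 < g x" using sol_base_pos[OF assms] by (simp add: g_def)
  have "(g has_real_derivative p / 2 * (0 - 2 * logd k x ^ (2 - 1) * (- kap * (k\<^sup>2 - (logd k x)\<^sup>2)))) (at x)"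
    unfolding g_def[abs_def]
    by (intro DERIV_cmult DERIV_diff DERIV_const) (auto intro!: derivative_eq_intros logd_deriv)
  then have g': "(g has_real_derivative 2 * kap * logd k x * g x) (at x)"
    by (rule DERIV_cong) (simp add: g_def)
  have "((\<lambda>x. g x powr r) has_real_derivative (r * g x powr (r - 1)) * (2 * kap * logd k x * g x)) (at x)"
    by (rule DERIV_chain2[OF has_real_derivative_powr[OF g] g'])
  moreover have "(r * g x powr (r - 1)) * (2 * kap * logd k x * g x) = (r * (2 * kap)) * logd k x * (g x * g x powr (r - 1))"
    by simp
  moreover have "g x * g x powr (r - 1) = g x powr r" using g powr_add[of "g x" 1 "r - 1"] by simp
  moreover have "r * (2 * kap) = 1" using p_gt by (simp add: r_def kap_def)
  moreover have "(\<lambda>x. g x powr r) = sol k" using sol_eq[OF assms] by (auto simp: g_def r_def)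
  ultimately show ?thesis by (metis mult_1)
qed

lemma continuous_on_sol: "0 < k \<Longrightarrow> continuous_on S (sol k)"
  using sol_deriv by (intro continuous_at_imp_continuous_on) (auto intro: DERIV_isCont)

lemma continuous_on_logd: "continuous_on S (logd k)"
  using logd_deriv by (intro continuous_at_imp_continuous_on) (auto intro: DERIV_isCont)

lemma sol_0: "0 < k \<Longrightarrow> sol k 0 = peak k" by (simp add: sol_eq peak_def)

lemma sol_le_peak: "0 < k \<Longrightarrow> sol k x \<le> peak k"
  unfolding sol_eq peak_def using sol_base_pos[of k x] p_gt by (intro powr_mono2) auto

lemma slope_sol:
  assumes "0 < k" shows "slope k (sol k x) = \<bar>logd k x\<bar>"
proof -
  have "2 / p * sol k x powr (p - 2) = k\<^sup>2 - (logd k x)\<^sup>2"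
    unfolding sol_powr[OF assms] using p_gt by simp
  then have "k\<^sup>2 - 2 / p * \<bar>sol k x\<bar> powr (p - 2) = (logd k x)\<^sup>2"
    using sol_pos[OF assms, of x] by simp
  then show ?thesis unfolding slope_def by simp
qed

lemma sol_strict_antimono:
  assumes k: "0 < k" and xy: "\<bar>x\<bar> < \<bar>y\<bar>" shows "sol k y < sol k x"
proof -
  have abs: "\<bar>logd k z\<bar> = k * tanh (kap * k * \<bar>z\<bar>)" for z
  proof -
    have "\<bar>logd k z\<bar> = k * \<bar>tanh (kap * k * z)\<bar>" using k by (simp add: logd_def abs_mult)
    also have "\<bar>tanh (kap * k * z)\<bar> = tanh (kap * k * \<bar>z\<bar>)"
    proof (cases "0 \<le> z")
      case True
      then have "0 \<le> kap * k * z" using k kap_pos by simp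
      then show ?thesis using True by (simp add: abs_if)
    next
      case False
      then have "kap * k * z < 0" using k kap_pos by (simp add: mult_pos_neg)
      then have "tanh (kap * k * z) < 0" by (metis tanh_real_less_iff tanh_0)
      then show ?thesis using False by simp
    qed
    finally show ?thesis .
  qed
  have "\<bar>logd k x\<bar> < \<bar>logd k y\<bar>"
    unfolding abs using k kap_pos xy by simp
  then have "(logd k x)\<^sup>2 < (logd k y)\<^sup>2" by (simp add: abs_less_iff_power2_less)
  then show ?thesis
    unfolding sol_eq[OF k] using sol_base_pos[OF k, of y] p_gt by (intro powr_less_mono2) auto
qed

lemma sol_antimono: "0 < k \<Longrightarrow> \<bar>x\<bar> \<le> \<bar>y\<bar> \<Longrightarrow> sol k y \<le> sol k x"
proof (cases "\<bar>x\<bar> = \<bar>y\<bar>")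
  case True
  then have "sol k x = sol k y" by (simp add: soliton_def)
  then show ?thesis by simp
qed (use sol_strict_antimono[of k x y] in auto)

lemma sol_even: "sol k (- x) = sol k x" by (simp add: soliton_def)

lemma logd_at_top: "0 < k \<Longrightarrow> ((\<lambda>x. logd k (x - a)) \<longlongrightarrow> - k) at_top"
proof -
  assume k: "0 < k"
  have "filterlim (\<lambda>x::real. x - a) at_top at_top"
    using filterlim_tendsto_add_at_top[OF tendsto_const[of "- a"] filterlim_ident] by simp
  then have "filterlim (\<lambda>x::real. kap * k * (x - a)) at_top at_top"
    using k kap_pos by (intro filterlim_tendsto_pos_mult_at_top[OF tendsto_const]) auto
  then have "((\<lambda>x. tanh (kap * k * (x - a))) \<longlongrightarrow> 1) at_top"
    by (rule filterlim_compose[OF tanh_real_at_top])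
  then have "((\<lambda>x. - k * tanh (kap * k * (x - a))) \<longlongrightarrow> - k * 1) at_top"
    by (intro tendsto_intros)
  then show ?thesis by (simp add: logd_def)
qed

lemma trunc_int_reflect: "integral {-k..0} (trunc_powr r \<omega>) = trunc_int r \<omega> k"
proof -
  have "(\<lambda>x. trunc_powr r \<omega> (- x)) = trunc_powr r \<omega>" by (simp add: trunc_powr_def fun_eq_iff)
  then show ?thesis
    using Henstock_Kurzweil_Integration.integral_reflect_real[of k 0 "trunc_powr r \<omega>"]
    by (simp add: trunc_int_def)
qed

text \<open>Change of variable to \<open>s = logd k (x - a)\<close>: the squared soliton is
  \<open>A (k^2 - s^2)^q\<close>, the differential of \<open>s\<close> is
  \<open>- kap (k^2 - s^2)\<close> times that of \<open>x\<close>, and \<open>q * kap = 1\<close>.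
  Over the half-line \<open>s\<close> runs from \<open>k * tanh (kap * k * a)\<close> down to
  \<open>-k\<close>.\<close>

lemma sol_mass:
  assumes k: "0 < k" and a: "0 \<le> a"
  shows "((\<lambda>x. (sol k (x - a))\<^sup>2) has_integral
    A * q * (trunc_int (q - 1) (k\<^sup>2) k + trunc_int (q - 1) (k\<^sup>2) (k * tanh (kap * k * a)))) {0..}"
proof -
  define e where "e = trunc_powr (q - 1) (k\<^sup>2)"
  \<comment> \<open>Based at \<open>-k\<close>, the limit of \<open>logd\<close> at infinity, so
    that the antiderivative \<open>F\<close> tends to 0.\<close>
  define Q where "Q y = integral {-k..y} e" for y
  define F where "F x = - A * q * Q (logd k (x - a))" for x
  have ei: "e integrable_on {c..d}" for c d unfolding e_def by (rule trunc_powr_integrable) (use q_ge_1 in simp)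
  \<comment> \<open>For \<open>q = 1\<close> the integrand \<open>e\<close> is an indicator with
    jumps at \<open>-k\<close> and \<open>k\<close>; differentiation is confined to the open
    interval, which \<open>logd\<close> never leaves.\<close>
  have Qd: "(Q has_real_derivative e y) (at y)" if "- k < y" "y < k" for y
  proof -
    have "isCont e y"
    proof -
      have op: "open {-k<..<k}" by simp
      have "continuous_on {-k<..<k} e"
        unfolding e_def
      proof (rule continuous_on_trunc_powr_interior)
        fix s assume "s \<in> {-k<..<k}"
        then have "\<bar>s\<bar> < \<bar>k\<bar>" by auto
        then show "s\<^sup>2 < k\<^sup>2" by (simp add: abs_less_iff_power2_less)
      qed
      then show ?thesis using that op by (auto simp: continuous_on_eq_continuous_at)
    qed
    then have "(Q has_vector_derivative e y) (at y within {-k..k} - {})"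
      unfolding Q_def[abs_def] using that
      by (intro integral_has_vector_derivative_continuous_at ei) (auto intro: continuous_at_imp_continuous_within)
    moreover have "at y within {-k..k} - {} = at y" using that by (intro at_within_interior) auto
    ultimately show ?thesis by (simp add: has_real_derivative_iff_has_vector_derivative)
  qed
  have deriv: "(F has_real_derivative (sol k (x - a))\<^sup>2) (at x)" for x
  proof -
    have l: "((\<lambda>x. logd k (x - a)) has_real_derivative - kap * (k\<^sup>2 - (logd k (x - a))\<^sup>2)) (at x)"
    proof -
      have "((\<lambda>x. x - a) has_real_derivative 1) (at x)" by (auto intro!: derivative_eq_intros)
      from DERIV_chain2[OF logd_deriv this] show ?thesis by simp
    qed
    have "(F has_real_derivative - A * q * (e (logd k (x - a)) * (- kap * (k\<^sup>2 - (logd k (x - a))\<^sup>2)))) (at x)"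
      unfolding F_def[abs_def]
      by (intro DERIV_cmult DERIV_chain2[OF Qd l] logd_bounds k)
    moreover have "- A * q * (e (logd k (x - a)) * (- kap * (k\<^sup>2 - (logd k (x - a))\<^sup>2))) = (sol k (x - a))\<^sup>2"
    proof -
      define z where "z = k\<^sup>2 - (logd k (x - a))\<^sup>2"
      have z: "0 < z" using logd_bounds(3)[OF k, of "x - a"] by (simp add: z_def)
      have "e (logd k (x - a)) * z = z powr q"
        using z powr_add[of z "q - 1" 1] by (simp add: e_def trunc_powr_def flip: z_def)
      moreover have "(sol k (x - a))\<^sup>2 = A * z powr q"
        using z by (simp add: sol_sq[OF k] trunc_powr_def flip: z_def)
      moreover have "- A * q * (e (logd k (x - a)) * (- kap * z)) = A * (q * kap) * (e (logd k (x - a)) * z)"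
        by simp
      ultimately show ?thesis by (simp add: q_kap z_def)
    qed
    ultimately show ?thesis by simp
  qed
  have "((\<lambda>x. Q (logd k (x - a))) \<longlongrightarrow> Q (- k)) at_top"
  proof -
    have "continuous_on {-k..k} Q" unfolding Q_def[abs_def] by (rule indefinite_integral_continuous_1[OF ei])
    moreover have "\<forall>\<^sub>F x in at_top. logd k (x - a) \<in> {- k..k}"
      by (rule always_eventually) (use logd_bounds[OF k] in \<open>auto simp: less_imp_le\<close>)
    ultimately show ?thesis
      using k by (intro continuous_on_tendsto_compose[OF _ logd_at_top[OF k]]) auto
  qed
  then have "(F \<longlongrightarrow> - A * q * Q (- k)) at_top"
    unfolding F_def[abs_def] by (intro tendsto_intros)
  then have lim: "(F \<longlongrightarrow> 0) at_top" by (simp add: Q_def)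
  have t: "logd k (0 - a) = k * tanh (kap * k * a)" by (simp add: logd_def)
  have "0 \<le> kap * k * a" using k a kap_pos by simp
  then have tnn: "0 \<le> k * tanh (kap * k * a)" using k by simp
  have "Q (k * tanh (kap * k * a)) = integral {-k..0} e + integral {0..k * tanh (kap * k * a)} e"
    unfolding Q_def by (rule Henstock_Kurzweil_Integration.integral_combine[symmetric]) (use k tnn ei in auto)
  also have "\<dots> = trunc_int (q - 1) (k\<^sup>2) k + trunc_int (q - 1) (k\<^sup>2) (k * tanh (kap * k * a))"
    unfolding e_def trunc_int_reflect by (simp add: trunc_int_def)
  finally have F0: "- F 0 = A * q * (trunc_int (q - 1) (k\<^sup>2) k + trunc_int (q - 1) (k\<^sup>2) (k * tanh (kap * k * a)))"
    unfolding F_def t by simp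
  have meas: "(\<lambda>x. (sol k (x - a))\<^sup>2) \<in> borel_measurable borel"
    by (intro borel_measurable_continuous_onI continuous_intros continuous_on_compose2[OF continuous_on_sol[OF k, of UNIV]]) auto
  \<comment> \<open>Nonnegativity lets this version of the fundamental theorem deliver integrability
    together with the value.\<close>
  have nn: "(\<integral>\<^sup>+x. ennreal ((sol k (x - a))\<^sup>2) * indicator {0..} x \<partial>lborel) = ennreal (0 - F 0)"
    by (rule nn_integral_FTC_atLeast[OF meas deriv _ lim]) simp
  have Fnn: "0 \<le> - F 0"
  proof -
    have "F 0 \<le> F x" if "0 \<le> x" for x
    proof (rule DERIV_nonneg_imp_nondecreasing[OF that])
      fix y
      show "\<exists>d. (F has_real_derivative d) (at y) \<and> 0 \<le> d"
        using deriv[of y] by (intro exI[of _ "(sol k (y - a))\<^sup>2"]) simp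
    qed
    then have "F 0 \<le> 0"
      by (intro tendsto_lowerbound[OF lim]) (auto intro: eventually_at_top_linorderI[of 0])
    then show ?thesis by simp
  qed
  have "((\<lambda>x. indicator {0..} x * (sol k (x - a))\<^sup>2) has_integral - F 0) UNIV"
  proof (rule nn_integral_has_integral)
    show "(\<lambda>x. indicator {0..} x * (sol k (x - a))\<^sup>2) \<in> borel_measurable borel"
      using meas by (intro borel_measurable_times) auto
    have "(\<integral>\<^sup>+x. ennreal (indicator {0..} x * (sol k (x - a))\<^sup>2) \<partial>lborel)
      = (\<integral>\<^sup>+x. ennreal ((sol k (x - a))\<^sup>2) * indicator {0..} x \<partial>lborel)"
      by (intro nn_integral_cong) (auto split: split_indicator)
    then show "(\<integral>\<^sup>+x. ennreal (indicator {0..} x * (sol k (x - a))\<^sup>2) \<partial>lborel) = ennreal (- F 0)"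
      using nn by simp
  qed (use Fnn in auto)
  moreover have "(\<lambda>x. indicator {0..} x * (sol k (x - a))\<^sup>2) = (\<lambda>x. if x \<in> {0..} then (sol k (x - a))\<^sup>2 else 0)"
    by auto
  ultimately show ?thesis
    unfolding F0 by (simp only: has_integral_restrict_UNIV)
qed

lemma sol_shift_deriv:
  assumes "0 < k" shows "((\<lambda>x. sol k (x - a)) has_real_derivative logd k (x - a) * sol k (x - a)) (at x)"
proof -
  have "((\<lambda>x. x - a) has_real_derivative 1) (at x)" by (auto intro!: derivative_eq_intros)
  from DERIV_chain2[OF sol_deriv[OF assms] this] show ?thesis by simp
qed

lemma continuous_on_sol_shift:
  assumes "0 < k"
  shows "continuous_on S (\<lambda>x. sol k (x - a))" "continuous_on S (\<lambda>x. logd k (x - a) * sol k (x - a))"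
  using assms
  by (auto intro!: continuous_intros continuous_on_compose2[OF continuous_on_sol[OF assms, of UNIV]]
      continuous_on_compose2[OF continuous_on_logd[of UNIV]])

lemma sol_H1_pair:
  assumes k: "0 < k" and a: "0 \<le> a"
  shows "H1_pair (\<lambda>x. sol k (x - a)) (\<lambda>x. logd k (x - a) * sol k (x - a))"
  unfolding H1_pair_def
proof (intro conjI)
  show "primitive_on {0..} (\<lambda>x. sol k (x - a)) (\<lambda>x. logd k (x - a) * sol k (x - a))"
    by (rule primitive_on_C1)
      (auto intro!: continuous_on_sol_shift k has_field_derivative_at_within[OF sol_shift_deriv[OF k]] simp: is_interval_ci)
  have i: "(\<lambda>x. (sol k (x - a))\<^sup>2) integrable_on {0..}" using sol_mass[OF k a] by blast
  then show "(\<lambda>x. (sol k (x - a))\<^sup>2) absolutely_integrable_on {0..}"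
    by (subst absolutely_integrable_nonneg_iff) auto
  show "(\<lambda>x. (logd k (x - a) * sol k (x - a))\<^sup>2) absolutely_integrable_on {0..}"
  proof (rule measurable_bounded_by_integrable_imp_absolutely_integrable)
    show "(\<lambda>x. (logd k (x - a) * sol k (x - a))\<^sup>2) \<in> borel_measurable (lebesgue_on {0..})"
      by (intro continuous_measurable_Ici continuous_on_power continuous_on_sol_shift k)
    show "(\<lambda>x. k\<^sup>2 * (sol k (x - a))\<^sup>2) integrable_on {0..}" by (intro integrable_on_mult_right i)
    show "norm ((logd k (x - a) * sol k (x - a))\<^sup>2) \<le> k\<^sup>2 * (sol k (x - a))\<^sup>2" for x
      using logd_bounds(3)[OF k, of "x - a"] by (auto simp: power_mult_distrib intro: mult_right_mono)
  qed auto
qed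

text \<open>The soliton moves with \<open>speed\<close> upwards before its peak at \<open>a\<close>
  and downwards after it, so its defect is 0 and the energy identity contains boundary terms
  only.\<close>

lemma sol_energy:
  assumes k: "0 < k" and a: "0 \<le> a"
  defines "t \<equiv> k * tanh (kap * k * a)"
  shows "2 * pair_energy p \<alpha> (\<lambda>x. sol k (x - a)) (\<lambda>x. logd k (x - a) * sol k (x - a))
    = A * (trunc_int q (k\<^sup>2) k + trunc_int q (k\<^sup>2) t + (\<alpha> - t) * trunc_powr q (k\<^sup>2) t)
      - k\<^sup>2 * integral {0..} (\<lambda>x. (sol k (x - a))\<^sup>2)"
proof -
  let ?w = "\<lambda>x. sol k (x - a)" and ?v = "\<lambda>x. logd k (x - a) * sol k (x - a)"
  have ta: "logd k (0 - a) = t" by (simp add: logd_def t_def)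
  have tpos: "0 \<le> t" using k a kap_pos by (simp add: t_def)
  have "defect k a ?w ?v x = 0" for x
  proof (cases "x \<le> a")
    case True
    then have "kap * k * (x - a) \<le> 0" using k kap_pos by (simp add: mult_nonneg_nonpos)
    then have "0 \<le> logd k (x - a)" using k by (simp add: logd_def mult_le_0_iff)
    then show ?thesis using True sol_pos[OF k, of "x - a"] by (simp add: defect_def speed_def slope_sol[OF k])
  next
    case False
    then have "0 \<le> kap * k * (x - a)" using k kap_pos by simp
    then have "logd k (x - a) \<le> 0" using k by (simp add: logd_def)
    then show ?thesis using False sol_pos[OF k, of "x - a"] by (simp add: defect_def speed_def slope_sol[OF k])
  qed
  moreover have "slope k (sol k (0 - a)) = t" using slope_sol[OF k, of "0 - a"] ta tpos by simp
  ultimately show ?thesis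
    using pair_energy_identity(2)[OF sol_H1_pair[OF k a] k a, of \<alpha>] sol_0[OF k] sol_le_peak[OF k] sol_pos[OF k]
    by (simp add: less_imp_le)
qed

text \<open>At frequency \<open>\<alpha>^2\<close> the upper limits \<open>sqrt \<omega>\<close> and
  \<alpha> coincide, so the two legs are the two equal halves of the even soliton.\<close>

lemma full_soliton_mass:
  assumes \<alpha>: "0 < \<alpha>"
  shows "(LINT x|lborel. (sol \<alpha> x)\<^sup>2) = A * q * two_leg_int (q - 1) \<alpha> (\<alpha>\<^sup>2)"
proof -
  let ?f = "\<lambda>x. (sol \<alpha> x)\<^sup>2"
  let ?I = "A * q * trunc_int (q - 1) (\<alpha>\<^sup>2) \<alpha>"
  have p: "(?f has_integral ?I) {0..}" using sol_mass[OF \<alpha>, of 0] by simp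
  have n: "(?f has_integral ?I) {..0}"
  proof -
    have "?f absolutely_integrable_on {0..}"
      by (subst absolutely_integrable_nonneg_iff) (use p in auto)
    then have "(\<lambda>x. \<bar>- 1\<bar> * ?f (- x)) absolutely_integrable_on {0..} \<and> integral {0..} (\<lambda>x. \<bar>- 1\<bar> * ?f (- x)) = ?I"
      using integral_unique[OF p] by (simp add: sol_even)
    then have "?f absolutely_integrable_on uminus ` {0..} \<and> integral (uminus ` {0..}) ?f = ?I"
      by (subst (asm) has_absolute_integral_change_of_variables_1') (auto intro!: derivative_eq_intros)
    then show ?thesis
      by (simp add: absolutely_integrable_on_def has_integral_iff)
  qed
  have "(?f has_integral ?I + ?I) ({0..} \<union> {..0})"
  proof (rule has_integral_Un[OF p n])
    have "{0..} \<inter> {..0} = {0::real}" by auto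
    then show "negligible ({0..} \<inter> {..0} :: real set)" by simp
  qed
  also have "{0..} \<union> {..0} = (UNIV :: real set)" by auto
  finally have f: "(?f has_integral ?I + ?I) UNIV" .
  have "?f absolutely_integrable_on UNIV"
    by (subst absolutely_integrable_nonneg_iff) (use f in auto)
  then have "set_integrable lborel UNIV ?f"
    by (intro absolutely_integrable_imp_set_integrable_lborel)
       (auto simp: set_borel_measurable_def intro!: borel_measurable_continuous_onI continuous_intros continuous_on_sol \<alpha>)
  from set_borel_integral_eq_integral(2)[OF this]
  have "(LINT x|lborel. ?f x) = integral UNIV ?f" by (simp add: set_lebesgue_integral_def)
  also have "\<dots> = ?I + ?I" using f by (rule integral_unique)
  finally show ?thesis using \<alpha> by (simp add: two_leg_int_def algebra_simps)
qed

end

section \<open>Comparison with the soliton\<close>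

lemma tanh_artanh_real:
  fixes z :: real
  assumes "-1 < z" "z < 1" shows "tanh (artanh z) = z"
proof -
  define r where "r = (1 + z) / (1 - z)"
  have r: "0 < r" using assms by (simp add: r_def)
  have "tanh (ln (sqrt r)) = (r - 1) / (r + 1)"
    using r tanh_ln_real[of "sqrt r"] by simp
  also have "\<dots> = z" using assms by (simp add: r_def field_simps)
  finally have "tanh (ln (sqrt r)) = z" .
  then show ?thesis using artanh_tanh_real[of "ln (sqrt r)"] by simp
qed

lemma nonneg_integral_0_imp_0:
  fixes f :: "real \<Rightarrow> real"
  assumes f: "continuous_on {0..} f" "f integrable_on {0..}" "integral {0..} f = 0"
    and nn: "\<And>x. 0 \<le> x \<Longrightarrow> 0 \<le> f x" and x: "0 \<le> x"
  shows "f x = 0"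
proof -
  have i: "f integrable_on {0..x + 1}" by (rule integrable_on_subinterval[OF f(2)]) auto
  have "integral {0..x + 1} f \<le> integral {0..} f"
    by (rule integral_subset_le[OF _ i f(2)]) (auto simp: nn)
  moreover have "0 \<le> integral {0..x + 1} f"
    by (rule Henstock_Kurzweil_Integration.integral_nonneg[OF i]) (auto simp: nn)
  ultimately have "integral {0..x + 1} f = 0" using f(3) by simp
  then show ?thesis
    using integral_eq_0_iff[of 0 "x + 1" f] continuous_on_subset[OF f(1), of "{0..x + 1}"] nn x by auto
qed

lemma H1_pair_uminus: "H1_pair w v \<Longrightarrow> H1_pair (\<lambda>x. - w x) (\<lambda>x. - v x)"
  using primitive_on_linear[of "{0..}" w v w v "-1" 0] by (simp add: H1_pair_def)

lemma pair_energy_uminus: "pair_energy p \<alpha> (\<lambda>x. - w x) (\<lambda>x. - v x) = pair_energy p \<alpha> w v"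
  by (simp add: pair_energy_def)

context subcubic
begin

text \<open>The coordinate that straightens the descending equation: for a solution \<open>w\<close>
  the \<open>arcosh\<close> of the corresponding quantity \<open>(peak k / w) powr kap\<close> grows
  linearly once \<open>w\<close> has left the peak.\<close>

lemma sol_cosh: 
  assumes k: "0 < k" shows "(peak k / sol k x) powr kap = cosh (kap * k * x)"
proof -
  define y where "y = kap * k * x"
  have c: "0 < (cosh y)\<^sup>2" by simp
  have "1 - (tanh y)\<^sup>2 = ((cosh y)\<^sup>2 - (sinh y)\<^sup>2) / (cosh y)\<^sup>2"
    by (simp add: tanh_def power_divide diff_divide_distrib)
  then have "1 - (tanh y)\<^sup>2 = 1 / (cosh y)\<^sup>2" by (simp add: hyperbolic_pythagoras)
  moreover have "logd k x = - k * tanh y" by (simp add: logd_def y_def)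
  then have "k\<^sup>2 - (logd k x)\<^sup>2 = k\<^sup>2 * (1 - (tanh y)\<^sup>2)"
    by (simp add: power_mult_distrib right_diff_distrib)
  ultimately have "k\<^sup>2 - (logd k x)\<^sup>2 = k\<^sup>2 / (cosh y)\<^sup>2" by simp
  then have "sol k x = (p / 2 * (k\<^sup>2 / (cosh y)\<^sup>2)) powr (1 / (p - 2))" by (simp add: sol_eq[OF k])
  then have "peak k / sol k x = ((p / 2 * k\<^sup>2) / (p / 2 * (k\<^sup>2 / (cosh y)\<^sup>2))) powr (1 / (p - 2))"
    by (simp only: peak_def powr_divide)
  also have "(p / 2 * k\<^sup>2) / (p / 2 * (k\<^sup>2 / (cosh y)\<^sup>2)) = (cosh y)\<^sup>2"
    using p_gt k c by simp
  finally have "(peak k / sol k x) powr kap = (cosh y)\<^sup>2 powr (1 / (p - 2) * kap)"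
    by (simp only: powr_powr)
  also have "1 / (p - 2) * kap = 1 / 2" using p_gt by (simp add: kap_def)
  also have "(cosh y)\<^sup>2 powr (1 / 2) = cosh y"
    using c by (simp only: powr_half_sqrt less_imp_le real_sqrt_abs) simp
  finally show ?thesis by (simp add: y_def)
qed

text \<open>A solution leaves the peak at some last time \<open>x1\<close>. From then on
  \<open>Y = (peak k / w)^kap\<close> satisfies \<open>Y' = kap k sqrt (Y^2 - 1)\<close>, so
  \<open>Y\<close> is the \<open>cosh\<close> of \<open>kap k (x - x1)\<close>: \<open>w\<close> is
  the soliton delayed by \<open>x1\<close>, and the delay only lifts it.\<close>

lemma sol_le_descending:
  assumes k: "0 < k" and cont: "continuous_on {0..L} w" and w0: "w 0 = peak k"
    and der: "\<And>x. 0 < x \<Longrightarrow> x < L \<Longrightarrow> (w has_real_derivative - speed k (w x)) (at x)"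
    and x: "0 \<le> x" "x \<le> L"
  shows "sol k x \<le> w x"
proof -
  have pk: "0 < peak k" using k by (intro peak_pos) simp
  have dec: "w b \<le> w a" if "0 \<le> a" "a \<le> b" "b \<le> L" for a b
  proof -
    have "- w a \<le> - w b"
    proof (rule DERIV_nonneg_imp_increasing_open[OF that(2)])
      fix y assume "a < y" "y < b"
      then have "((\<lambda>x. - w x) has_real_derivative speed k (w y)) (at y)"
        using der[of y] that by (auto intro!: derivative_eq_intros)
      then show "\<exists>d. ((\<lambda>x. - w x) has_real_derivative d) (at y) \<and> 0 \<le> d"
        using speed_nonneg by blast
    next
      show "continuous_on {a..b} (\<lambda>x. - w x)"
        by (intro continuous_intros continuous_on_subset[OF cont]) (use that in auto)
    qed
    then show ?thesis by simp
  qed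
  have pos: "sol k x \<le> w x" if x: "0 \<le> x" "x \<le> L" "0 < w x" for x
  proof (cases "w x = peak k")
    case True
    then show ?thesis using sol_le_peak[OF k] by simp
  next
    case False
    \<comment> \<open>The compact set of times up to \<open>x\<close> at which \<open>w\<close> is
      at the peak; \<open>x1\<close> is its greatest element.\<close>
    define S where "S = {y \<in> {0..x}. w y = peak k}"
    have "closed S"
      unfolding S_def by (intro continuous_closed_preimage_constant continuous_on_subset[OF cont]) (use x in auto)
    moreover have "bounded S" unfolding S_def by (rule bounded_subset[of "{0..x}"]) auto
    ultimately have "compact S" by (simp add: compact_eq_bounded_closed)
    moreover have "S \<noteq> {}" using w0 x by (auto simp: S_def)
    ultimately have "\<exists>s\<in>S. \<forall>t\<in>S. t \<le> s" by (rule compact_attains_sup)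
    then obtain x1 where x1: "x1 \<in> S" "\<And>y. y \<in> S \<Longrightarrow> y \<le> x1" by auto
    have x1x: "0 \<le> x1" "x1 < x" "w x1 = peak k"
    proof -
      have "x1 \<in> {0..x}" "w x1 = peak k" using x1(1) by (simp_all add: S_def)
      moreover have "x1 \<noteq> x" using False \<open>w x1 = peak k\<close> by auto
      ultimately show "0 \<le> x1" "x1 < x" "w x1 = peak k" by auto
    qed
    have wpos: "0 < w y" if "x1 \<le> y" "y \<le> x" for y
      using dec[of y x] that x1x x by auto
    have wlt: "w y < peak k" if "x1 < y" "y \<le> x" for y
    proof -
      have "y \<notin> S" using x1(2)[of y] that by linarith
      then have "w y \<noteq> peak k" using that x1x by (simp add: S_def)
      then show ?thesis using dec[of 0 y] that x1x x w0 by simp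
    qed
    define g where "g y = peak k / w y" for y
    define Y where "Y y = g y powr kap" for y
    have cw: "continuous_on {x1..x} w" by (rule continuous_on_subset[OF cont]) (use x1x x in auto)
    have wne: "\<forall>y\<in>{x1..x}. w y \<noteq> 0" using wpos by force
    have g1: "1 \<le> g y" if "y \<in> {x1..x}" for y
      using wpos[of y] wlt[of y] x1x that by (cases "y = x1") (auto simp: g_def)
    have Y1: "1 \<le> Y y" if "y \<in> {x1..x}" for y
      unfolding Y_def using g1[OF that] kap_pos by (intro ge_one_powr_ge_zero) auto
    have cY: "continuous_on {x1..x} Y"
      unfolding Y_def g_def using pk wpos wne kap_pos
      by (intro continuous_on_powr' continuous_on_divide continuous_on_const cw) (auto simp: less_imp_le)
    \<comment> \<open>The derivative of \<open>arcosh\<close> is singular at \<open>Y = 1\<close>,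
      which is the value at \<open>x1\<close>; \<open>H\<close> is differentiated inside the
      interval and merely continuous at its ends.\<close>
    define H where "H y = arcosh (Y y) - kap * k * y" for y
    have "H x = H x1"
    proof (rule DERIV_isconst_end[OF x1x(2)])
      show "continuous_on {x1..x} H"
        unfolding H_def by (intro continuous_intros continuous_on_arcosh' cY) (use Y1 in auto)
      fix y assume y: "x1 < y" "y < x"
      have wy: "0 < w y" "w y < peak k" using wpos[of y] wlt[of y] y by auto
      have gy: "1 < g y" using wy by (simp add: g_def)
      have Yy: "1 < Y y" unfolding Y_def using gy kap_pos by (intro gr_one_powr) auto
      have "(g has_real_derivative (0 * w y - peak k * (- speed k (w y))) / (w y * w y)) (at y)"
        unfolding g_def[abs_def] using wy y x1x x by (intro DERIV_divide DERIV_const der) auto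
      then have gd: "(g has_real_derivative g y * slope k (w y)) (at y)"
        by (rule DERIV_cong) (use wy in \<open>simp add: g_def speed_def\<close>)
      have "(Y has_real_derivative (kap * g y powr (kap - 1)) * (g y * slope k (w y))) (at y)"
        unfolding Y_def[abs_def] using gy
        by (intro DERIV_chain2[OF has_real_derivative_powr gd]) auto
      moreover have "g y powr (kap - 1) * g y = Y y"
        using gy powr_add[of "g y" "kap - 1" 1] by (simp add: Y_def)
      then have "(kap * g y powr (kap - 1)) * (g y * slope k (w y)) = kap * (Y y * slope k (w y))"
        by (metis mult.assoc)
      \<comment> \<open>Since \<open>2 * kap = p - 2\<close>, \<open>Y^2\<close> is
        \<open>k^2\<close> divided by \<open>2/p * w^(p-2)\<close>, hence
        \<open>slope^2 = k^2 (1 - 1/Y^2)\<close>.\<close>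
      moreover have "Y y * slope k (w y) = k * sqrt ((Y y)\<^sup>2 - 1)"
      proof (rule power2_eq_imp_eq)
        have "(Y y)\<^sup>2 = g y powr (kap * 2)" using gy unfolding Y_def by (simp flip: powr_powr)
        also have "kap * 2 = p - 2" by (simp add: kap_def)
        also have "g y powr (p - 2) = p / 2 * k\<^sup>2 / w y powr (p - 2)"
          unfolding g_def powr_divide using k by (subst peak_powr) auto
        finally have Y2: "(Y y)\<^sup>2 * (2 / p * w y powr (p - 2)) = k\<^sup>2"
          using wy p_gt by simp
        have "(Y y * slope k (w y))\<^sup>2 = (Y y)\<^sup>2 * (k\<^sup>2 - 2 / p * w y powr (p - 2))"
          using slope_sq[OF k, of "w y"] wy by (simp add: power_mult_distrib)
        also have "\<dots> = k\<^sup>2 * ((Y y)\<^sup>2 - 1)" using Y2 by (simp add: algebra_simps)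
        also have "\<dots> = (k * sqrt ((Y y)\<^sup>2 - 1))\<^sup>2" using Yy by (simp add: power_mult_distrib)
        finally show "(Y y * slope k (w y))\<^sup>2 = (k * sqrt ((Y y)\<^sup>2 - 1))\<^sup>2" .
        show "0 \<le> Y y * slope k (w y)" using Yy slope_bounds(1) by simp
        show "0 \<le> k * sqrt ((Y y)\<^sup>2 - 1)" using Yy k by simp
      qed
      ultimately have Yd: "(Y has_real_derivative kap * (k * sqrt ((Y y)\<^sup>2 - 1))) (at y)" by simp
      have "(H has_real_derivative 1 / sqrt ((Y y)\<^sup>2 - 1) * (kap * (k * sqrt ((Y y)\<^sup>2 - 1))) - kap * k * 1) (at y)"
        unfolding H_def[abs_def]
        by (intro DERIV_diff DERIV_chain2[OF arcosh_real_has_field_derivative[OF Yy] Yd] DERIV_cmult DERIV_ident)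
      then show "(H has_real_derivative 0) (at y)"
        by (rule DERIV_cong) (use one_less_power[OF Yy, of 2] in simp)
    qed
    moreover have "Y x1 = 1" using x1x pk by (simp add: Y_def g_def)
    ultimately have "arcosh (Y x) = kap * k * (x - x1)" by (simp add: H_def algebra_simps)
    then have "Y x = cosh (kap * k * (x - x1))"
      using cosh_arcosh_real[OF Y1[of x]] x1x by simp
    also have "\<dots> \<le> cosh (kap * k * x)"
      using x1x k kap_pos by (subst cosh_real_nonneg_le_iff) auto
    also have "\<dots> = (peak k / sol k x) powr kap" by (rule sol_cosh[OF k, symmetric])
    finally have le: "(peak k / w x) powr kap \<le> (peak k / sol k x) powr kap" by (simp add: Y_def g_def)
    show ?thesis
    proof (rule ccontr)
      assume "\<not> sol k x \<le> w x"
      then have "peak k / sol k x < peak k / w x"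
        using pk x(3) by (intro divide_strict_left_mono) (auto intro: mult_pos_pos sol_pos k)
      then have "(peak k / sol k x) powr kap < (peak k / w x) powr kap"
        using kap_pos pk sol_pos[OF k, of x] by (intro powr_less_mono2) auto
      then show False using le by simp
    qed
  qed
  show ?thesis
  proof (cases "0 < w x")
    case True
    then show ?thesis using pos x by simp
  next
    case False
    \<comment> \<open>If \<open>w x\<close> were not positive, \<open>w\<close> would earlier take
      the positive value \<open>sol k x / 2\<close>, where the case already treated makes it at
      least \<open>sol k x\<close>.\<close>
    have "\<exists>y\<ge>0. y \<le> x \<and> w y = sol k x / 2"
    proof (rule IVT2')
      show "w x \<le> sol k x / 2" using False sol_pos[OF k, of x] by simp
      show "sol k x / 2 \<le> w 0" using sol_le_peak[OF k, of x] sol_pos[OF k, of x] by (simp add: w0)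
      show "continuous_on {0..x} w" by (rule continuous_on_subset[OF cont]) (use x in auto)
    qed (use x in auto)
    then obtain y where y: "0 \<le> y" "y \<le> x" "w y = sol k x / 2" by blast
    have "sol k x \<le> sol k y" using y by (intro sol_antimono k) auto
    also have "\<dots> \<le> w y" using y x sol_pos[OF k, of x] by (intro pos) auto
    finally show ?thesis using y(3) sol_pos[OF k, of x] by simp
  qed
qed

text \<open>To the right of \<open>x0\<close> the function itself descends from the peak, to the
  left its reflection at \<open>x0\<close> does; the soliton is even, so both sides give the same
  comparison function.\<close>

lemma sol_le_if_defect_zero:
  assumes w: "H1_pair w v" and int: "(\<lambda>x. (defect k x0 w v x)\<^sup>2) absolutely_integrable_on {0..}"
    and zero: "integral {0..} (\<lambda>x. (defect k x0 w v x)\<^sup>2) = 0" and k: "0 < k"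
    and x0: "0 \<le> x0" "w x0 = peak k" and x: "0 \<le> x"
  shows "sol k (x - x0) \<le> w x"
proof -
  note pr = H1_pair_props[OF w]
  have cs: "continuous_on S (\<lambda>x. speed k (w x))" if "S \<subseteq> {0..}" for S
    by (rule continuous_on_compose2[OF continuous_speed[of UNIV] continuous_on_subset[OF pr(6) that]]) auto
  have left: "primitive_on {0..x0} w (\<lambda>x. speed k (w x))"
    unfolding primitive_on_def
  proof (intro ballI impI conjI)
    fix a b assume ab: "a \<in> {0..x0}" "b \<in> {0..x0}" "a \<le> b"
    show "(\<lambda>x. speed k (w x)) absolutely_integrable_on {a..b}"
      using ab by (intro absolutely_integrable_continuous_real cs) auto
    show "integral {a..b} (\<lambda>x. speed k (w x)) = w b - w a"
      using defect_zero_imp_speed(1)[OF w int zero, of a b] ab by simp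
  qed
  have right: "primitive_on {x0..} w (\<lambda>x. - speed k (w x))"
    unfolding primitive_on_def
  proof (intro ballI impI conjI)
    fix a b assume ab: "a \<in> {x0..}" "b \<in> {x0..}" "a \<le> b"
    show "(\<lambda>x. - speed k (w x)) absolutely_integrable_on {a..b}"
      using ab x0 by (intro absolutely_integrable_continuous_real continuous_on_minus cs) auto
    show "integral {a..b} (\<lambda>x. - speed k (w x)) = w b - w a"
      using defect_zero_imp_speed(2)[OF w int zero, of a b] ab x0 by simp
  qed
  show ?thesis
  proof (cases "x0 \<le> x")
    case True
    have "sol k (x - x0) \<le> w (x0 + (x - x0))"
    proof (rule sol_le_descending[OF k, where L = "x - x0" and w = "\<lambda>y. w (x0 + y)"])
      show "continuous_on {0..x - x0} (\<lambda>y. w (x0 + y))"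
        by (rule continuous_on_compose2[OF pr(6)]) (use x0 in \<open>auto intro!: continuous_intros\<close>)
      fix y assume y: "0 < y" "y < x - x0"
      have "(w has_real_derivative - speed k (w (x0 + y))) (at (x0 + y))"
        by (rule primitive_on_imp_deriv[OF primitive_on_subset[OF right], of "{x0<..}"])
           (use x0 y in \<open>auto intro!: continuous_on_minus cs simp: is_interval_oi\<close>)
      moreover have "((\<lambda>y. x0 + y) has_real_derivative 1) (at y)" by (auto intro!: derivative_eq_intros)
      ultimately have "((\<lambda>y. w (x0 + y)) has_real_derivative - speed k (w (x0 + y)) * 1) (at y)"
        by (rule DERIV_chain2[where f = w and g = "\<lambda>y. x0 + y"])
      then show "((\<lambda>y. w (x0 + y)) has_real_derivative - speed k (w (x0 + y))) (at y)" by simp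
    qed (use x0 True in auto)
    then show ?thesis by simp
  next
    case False
    have "sol k (x0 - x) \<le> w (x0 - (x0 - x))"
    proof (rule sol_le_descending[OF k, where L = "x0 - x" and w = "\<lambda>y. w (x0 - y)"])
      show "continuous_on {0..x0 - x} (\<lambda>y. w (x0 - y))"
        by (rule continuous_on_compose2[OF pr(6)]) (use x x0 in \<open>auto intro!: continuous_intros\<close>)
      fix y assume y: "0 < y" "y < x0 - x"
      have "(w has_real_derivative speed k (w (x0 - y))) (at (x0 - y))"
        by (rule primitive_on_imp_deriv[OF primitive_on_subset[OF left], of "{0<..<x0}"])
           (use x y in \<open>auto intro!: cs simp: is_interval_oo\<close>)
      moreover have "((\<lambda>y. x0 - y) has_real_derivative -1) (at y)" by (auto intro!: derivative_eq_intros)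
      ultimately have "((\<lambda>y. w (x0 - y)) has_real_derivative speed k (w (x0 - y)) * - 1) (at y)"
        by (rule DERIV_chain2[where f = w and g = "\<lambda>y. x0 - y"])
      then show "((\<lambda>y. w (x0 - y)) has_real_derivative - speed k (w (x0 - y))) (at y)" by simp
    qed (use x0 False in auto)
    then show ?thesis using sol_even[of k "x0 - x"] by simp
  qed
qed

end

section \<open>Minimizers and positive bound states\<close>

context subcubic
begin

lemma slope_less:
  assumes "0 < k" "c \<noteq> 0" shows "(slope k c)\<^sup>2 < k\<^sup>2"
proof -
  have "max 0 (k\<^sup>2 - 2 / p * \<bar>c\<bar> powr (p - 2)) < k\<^sup>2" using assms p_gt by simp
  then show ?thesis by (simp add: slope_def)
qed

lemma slope_antimono:
  assumes "0 \<le> c" "c \<le> d" shows "slope k d \<le> slope k c"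
proof -
  have "c powr (p - 2) \<le> d powr (p - 2)" using assms p_gt by (intro powr_mono2) auto
  then have "2 / p * c powr (p - 2) \<le> 2 / p * d powr (p - 2)"
    using p_gt by (intro mult_left_mono) auto
  then show ?thesis using assms unfolding slope_def by (intro real_sqrt_le_mono max.mono) auto
qed

text \<open>The lower bound for twice the energy at frequency \<open>k^2\<close> once the boundary
  slope is \<alpha>. Over \<open>k > 0\<close> it is least where its tangent in \<open>k^2\<close>
  is horizontal, that is where
  \<open>A * q * two_leg_int (q - 1) \<alpha> (k^2) = \<mu>\<close>.\<close>

definition min_level :: "real \<Rightarrow> real \<Rightarrow> real \<Rightarrow> real" where
  "min_level \<alpha> \<mu> k = A * two_leg_int q \<alpha> (k\<^sup>2) - k\<^sup>2 * \<mu>"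

lemma peak_surj:
  assumes "0 < m" obtains k where "0 < k" "peak k = m"
proof -
  define k where "k = sqrt (2 / p * m powr (p - 2))"
  have pos: "0 < 2 / p * m powr (p - 2)" using assms p_gt by simp
  have "peak k = (m powr (p - 2)) powr (1 / (p - 2))"
    unfolding peak_def k_def using pos p_gt by simp
  also have "\<dots> = m" using assms p_gt by (simp add: powr_powr)
  finally show ?thesis using that[of k] pos by (simp add: k_def)
qed

lemma trunc_int_mono_upper:
  assumes "0 \<le> r" "0 \<le> S" "S \<le> T" shows "trunc_int r \<omega> S \<le> trunc_int r \<omega> T"
proof -
  have "0 \<le> integral {S..T} (trunc_powr r \<omega>)"
    using assms by (intro Henstock_Kurzweil_Integration.integral_nonneg trunc_powr_integrable) auto
  then show ?thesis using trunc_int_combine[OF assms] by simp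
qed

text \<open>Three nonnegative losses separate twice the energy from the level: the defect \<Delta>,
  the boundary loss \<open>A * V\<close> for \<open>t\<close> different from \<alpha>, and the
  frequency loss \<open>A * W\<close> for \<open>k\<close> different from \<open>kk\<close>.
  Equality annihilates all three, and a comparison of masses then identifies
  \<open>w\<close>.\<close>

lemma energy_lower_bound:
  assumes w: "H1_pair w v" and mass: "integral {0..} (\<lambda>x. (w x)\<^sup>2) = \<mu>"
    and \<mu>: "0 < \<mu>" and \<alpha>: "0 < \<alpha>"
    and x0: "0 \<le> x0" "\<And>x. 0 \<le> x \<Longrightarrow> \<bar>w x\<bar> \<le> w x0"
    and kk: "0 < kk" "A * q * two_leg_int (q - 1) \<alpha> (kk\<^sup>2) = \<mu>"
  shows "min_level \<alpha> \<mu> kk \<le> 2 * pair_energy p \<alpha> w v"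
    and "2 * pair_energy p \<alpha> w v = min_level \<alpha> \<mu> kk \<Longrightarrow>
      \<exists>a\<ge>0. kk * tanh (kap * kk * a) = \<alpha> \<and> (\<forall>x\<ge>0. w x = sol kk (x - a))"
proof -
  note pr = H1_pair_props[OF w]
  have "0 < w x0"
  proof (rule ccontr)
    assume "\<not> 0 < w x0"
    then have z: "w x = 0" if "0 \<le> x" for x using x0(2)[OF that] by linarith
    have "integral {0..} (\<lambda>x. (w x)\<^sup>2) = integral {0..} (\<lambda>x::real. 0)"
      by (intro Henstock_Kurzweil_Integration.integral_cong) (use z in auto)
    then show False using mass \<mu> by simp
  qed
  then obtain k where k: "0 < k" "peak k = w x0" by (rule peak_surj)
  have le: "\<bar>w x\<bar> \<le> peak k" if "0 \<le> x" for x using x0(2)[OF that] k(2) by simp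
  define t where "t = slope k (w 0)"
  have t: "0 \<le> t" using slope_bounds(1) by (simp add: t_def)
  define \<Delta> where "\<Delta> = integral {0..} (\<lambda>x. (defect k x0 w v x)\<^sup>2)"
  obtain F where F: "\<And>c. (F has_real_derivative speed k c) (at c)"
    using continuous_antiderivative[OF continuous_speed] by blast
  have dint: "(\<lambda>x. (defect k x0 w v x)\<^sup>2) absolutely_integrable_on {0..}"
    by (rule completed_square(1)[OF w k(1) x0(1) k(2)[symmetric] le F])
  have \<Delta>: "0 \<le> \<Delta>"
    unfolding \<Delta>_def using dint
    by (intro Henstock_Kurzweil_Integration.integral_nonneg) (auto simp: absolutely_integrable_on_def)
  have sk: "sqrt (k\<^sup>2) = k" using k by simp
  have 1: "\<Delta> + A * (trunc_int q (k\<^sup>2) k + trunc_int q (k\<^sup>2) t + (\<alpha> - t) * trunc_powr q (k\<^sup>2) t)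
      \<le> 2 * pair_energy p \<alpha> w v + k\<^sup>2 * \<mu>"
    unfolding \<Delta>_def t_def mass[symmetric]
    by (rule pair_energy_identity(1)[OF w k(1) x0(1) k(2)[symmetric] le])
  have 2: "trunc_int q (k\<^sup>2) \<alpha> \<le> (\<alpha> - t) * trunc_powr q (k\<^sup>2) t + trunc_int q (k\<^sup>2) t"
    by (rule trunc_int_vertex(1)[OF q_pos t]) (use \<alpha> in simp)
  define V where "V = (\<alpha> - t) * trunc_powr q (k\<^sup>2) t + trunc_int q (k\<^sup>2) t - trunc_int q (k\<^sup>2) \<alpha>"
  have V: "0 \<le> A * V" using 2 A_pos by (simp add: V_def)
  have k2: "0 < k\<^sup>2" "0 < kk\<^sup>2" using k kk by auto
  have 3: "two_leg_int q \<alpha> (kk\<^sup>2) + q * (k\<^sup>2 - kk\<^sup>2) * two_leg_int (q - 1) \<alpha> (kk\<^sup>2) \<le> two_leg_int q \<alpha> (k\<^sup>2)"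
    by (rule two_leg_int_above_tangent[OF q_ge_1 k2])
  define W where "W = two_leg_int q \<alpha> (k\<^sup>2) - (two_leg_int q \<alpha> (kk\<^sup>2) + q * (k\<^sup>2 - kk\<^sup>2) * two_leg_int (q - 1) \<alpha> (kk\<^sup>2))"
  have W: "0 \<le> A * W" using 3 A_pos by (simp add: W_def)
  have AW: "A * two_leg_int q \<alpha> (k\<^sup>2) = A * W + A * two_leg_int q \<alpha> (kk\<^sup>2) + (k\<^sup>2 - kk\<^sup>2) * \<mu>"
    unfolding W_def kk(2)[symmetric] by (simp add: algebra_simps)
  have main: "\<Delta> + A * V + A * W + min_level \<alpha> \<mu> kk \<le> 2 * pair_energy p \<alpha> w v"
  proof -
    have "A * (trunc_int q (k\<^sup>2) k + trunc_int q (k\<^sup>2) t + (\<alpha> - t) * trunc_powr q (k\<^sup>2) t)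
        = A * two_leg_int q \<alpha> (k\<^sup>2) + A * V"
      unfolding two_leg_int_def V_def sk by (simp add: algebra_simps)
    then show ?thesis using 1 AW unfolding min_level_def by (simp add: algebra_simps)
  qed
  then show "min_level \<alpha> \<mu> kk \<le> 2 * pair_energy p \<alpha> w v" using \<Delta> V W by linarith
  assume eq: "2 * pair_energy p \<alpha> w v = min_level \<alpha> \<mu> kk"
  have \<Delta>0: "\<Delta> = 0" and V0: "A * V = 0" and W0: "A * W = 0" using main eq \<Delta> V W by linarith+
  have "k\<^sup>2 = kk\<^sup>2"
  proof (rule ccontr)
    assume "k\<^sup>2 \<noteq> kk\<^sup>2"
    then have "0 < W" unfolding W_def
      using two_leg_int_above_tangent_strict[OF q_ge_1 k2, of \<alpha>] by simp
    then show False using W0 A_pos by simp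
  qed
  then have kkk: "k = kk" using k kk by simp
  \<comment> \<open>Besides the comparison itself, this gives \<open>w 0 > 0\<close>, hence
    \<open>t^2 < k^2\<close>, as the strict form of \<open>trunc_int_vertex\<close>
    requires.\<close>
  have ge: "sol k (x - x0) \<le> w x" if "0 \<le> x" for x
    by (rule sol_le_if_defect_zero[OF w dint \<Delta>0[unfolded \<Delta>_def] k(1) x0(1) k(2)[symmetric] that])
  have w0: "0 < w 0" using ge[of 0] sol_pos[OF k(1), of "0 - x0"] by simp
  have "t\<^sup>2 < k\<^sup>2" unfolding t_def by (rule slope_less) (use k w0 in auto)
  then have t\<alpha>: "t = \<alpha>"
    using trunc_int_vertex(2)[OF q_pos t, of \<alpha> "k\<^sup>2"] V0 A_pos \<alpha> by (auto simp: V_def)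
  define \<tau> where "\<tau> = k * tanh (kap * k * x0)"
  have \<tau>abs: "\<bar>logd k (0 - x0)\<bar> = \<tau>"
    using k x0(1) kap_pos by (simp add: logd_def \<tau>_def abs_mult)
  \<comment> \<open>A larger value has a smaller slope, so the soliton starts at 0 with slope \<tau>
    at least \<alpha>. Its mass is then at least \<mu>, although it lies below
    \<open>w\<close>.\<close>
  have "\<alpha> \<le> slope k (sol k (0 - x0))"
    unfolding t\<alpha>[symmetric] t_def
    by (rule slope_antimono) (use ge[of 0] sol_pos[OF k(1), of "0 - x0"] in auto)
  then have \<alpha>\<tau>: "\<alpha> \<le> \<tau>" unfolding slope_sol[OF k(1)] \<tau>abs .
  have "\<tau> < k" unfolding \<tau>_def using tanh_real_lt_1[of "kap * k * x0"] k by simp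
  then have \<alpha>k: "\<alpha> < k" using \<alpha>\<tau> by simp
  have sm: "((\<lambda>x. (sol k (x - x0))\<^sup>2) has_integral
    A * q * (trunc_int (q - 1) (k\<^sup>2) k + trunc_int (q - 1) (k\<^sup>2) \<tau>)) {0..}"
    unfolding \<tau>_def by (rule sol_mass[OF k(1) x0(1)])
  have "\<mu> \<le> A * q * (trunc_int (q - 1) (k\<^sup>2) k + trunc_int (q - 1) (k\<^sup>2) \<tau>)"
    unfolding kk(2)[symmetric] kkk[symmetric] two_leg_int_def sk
    using \<alpha> \<alpha>\<tau> A_pos q_ge_1 by (intro mult_left_mono add_left_mono trunc_int_mono_upper) auto
  then have "integral {0..} (\<lambda>x. (w x)\<^sup>2) \<le> integral {0..} (\<lambda>x. (sol k (x - x0))\<^sup>2)"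
    unfolding mass integral_unique[OF sm] .
  moreover have i: "(\<lambda>x. (w x)\<^sup>2 - (sol k (x - x0))\<^sup>2) integrable_on {0..}"
    using sm by (intro Henstock_Kurzweil_Integration.integrable_diff pr(4)) blast
  have sq: "(sol k (x - x0))\<^sup>2 \<le> (w x)\<^sup>2" if "0 \<le> x" for x
    using ge[OF that] sol_pos[OF k(1), of "x - x0"] by (intro power_mono) auto
  have "integral {0..} (\<lambda>x. (w x)\<^sup>2 - (sol k (x - x0))\<^sup>2) = integral {0..} (\<lambda>x. (w x)\<^sup>2) - integral {0..} (\<lambda>x. (sol k (x - x0))\<^sup>2)"
    using sm by (intro Henstock_Kurzweil_Integration.integral_diff pr(4)) blast
  moreover have "0 \<le> integral {0..} (\<lambda>x. (w x)\<^sup>2 - (sol k (x - x0))\<^sup>2)"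
    by (rule Henstock_Kurzweil_Integration.integral_nonneg[OF i]) (use sq in auto)
  ultimately have "integral {0..} (\<lambda>x. (w x)\<^sup>2 - (sol k (x - x0))\<^sup>2) = 0" by simp
  then have sq0: "(w x)\<^sup>2 - (sol k (x - x0))\<^sup>2 = 0" if "0 \<le> x" for x
    using that sq
    by (intro nonneg_integral_0_imp_0[of "\<lambda>x. (w x)\<^sup>2 - (sol k (x - x0))\<^sup>2"] i continuous_intros pr(6) continuous_on_sol_shift k(1)) auto
  have weq: "w x = sol k (x - x0)" if "0 \<le> x" for x
  proof (rule power2_eq_imp_eq)
    show "(w x)\<^sup>2 = (sol k (x - x0))\<^sup>2" using sq0[OF that] by simp
    show "0 \<le> sol k (x - x0)" using sol_pos[OF k(1), of "x - x0"] by simp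
    then show "0 \<le> w x" using ge[OF that] by linarith
  qed
  have "\<alpha> = slope k (w 0)" using t\<alpha> by (simp add: t_def)
  also have "w 0 = sol k (0 - x0)" by (rule weq) simp
  also have "slope k (sol k (0 - x0)) = \<tau>" unfolding slope_sol[OF k(1)] by (rule \<tau>abs)
  finally have "\<alpha> = \<tau>" .
  then show "\<exists>a\<ge>0. kk * tanh (kap * kk * a) = \<alpha> \<and> (\<forall>x\<ge>0. w x = sol kk (x - a))"
    using x0(1) weq by (intro exI[of _ x0]) (auto simp: \<tau>_def kkk)
qed

text \<open>The first integral has no constant term because it is integrable; then the logarithmic
  derivative \<open>z / w\<close> satisfies the autonomous equation \<open>s' = - kap (\<omega> - s\<^sup>2)\<close> of \<open>logd\<close>.\<close>

lemma positive_solution_is_soliton: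
  assumes w: "H1_pair w z" and k: "0 < k"
    and dw: "\<And>x. 0 < x \<Longrightarrow> (w has_real_derivative z x) (at x)"
    and dz: "\<And>x. 0 < x \<Longrightarrow> (z has_real_derivative k\<^sup>2 * w x - \<bar>w x\<bar> powr (p - 2) * w x) (at x)"
    and pos: "\<And>x. 0 < x \<Longrightarrow> 0 < w x"
  obtains a where "\<And>x. 0 < x \<Longrightarrow> w x = sol k (x - a)" "\<And>x. 0 < x \<Longrightarrow> z x = logd k (x - a) * sol k (x - a)"
proof -
  note pr = H1_pair_props[OF w]
  define E where "E x = (z x)\<^sup>2 - k\<^sup>2 * (w x)\<^sup>2 + 2 / p * w x powr p" for x
  have "(E has_real_derivative 0) (at x)" if x: "0 < x" for x
  proof -
    have "(E has_real_derivative 2 * z x ^ (2 - 1) * (k\<^sup>2 * w x - \<bar>w x\<bar> powr (p - 2) * w x)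
       - k\<^sup>2 * (2 * w x ^ (2 - 1) * z x) + 2 / p * ((p * w x powr (p - 1)) * z x)) (at x)"
      unfolding E_def[abs_def]
      by (intro DERIV_add DERIV_diff DERIV_cmult DERIV_chain2[OF has_real_derivative_powr[OF pos[OF x]] dw[OF x]])
         (auto intro!: derivative_eq_intros dw[OF x] dz[OF x])
    moreover have "w x powr (p - 1) = w x powr (p - 2) * w x"
      using pos[OF x] powr_add[of "w x" "p - 2" 1] by simp
    then have "2 * z x ^ (2 - 1) * (k\<^sup>2 * w x - \<bar>w x\<bar> powr (p - 2) * w x)
       - k\<^sup>2 * (2 * w x ^ (2 - 1) * z x) + 2 / p * ((p * w x powr (p - 1)) * z x) = 0"
      using pos[OF x] p_gt by (simp add: algebra_simps)
    ultimately show ?thesis by (rule DERIV_cong)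
  qed
  then have "\<exists>c. \<forall>x\<in>{0<..}. E x = c"
    by (intro has_field_derivative_zero_constant) (auto intro: has_field_derivative_at_within)
  then obtain c where c: "\<And>x. 0 < x \<Longrightarrow> E x = c" by auto
  have "(\<lambda>x. (z x)\<^sup>2 - k\<^sup>2 * (w x)\<^sup>2 + 2 / p * \<bar>w x\<bar> powr p) absolutely_integrable_on {0..}"
    using pr(2,3) H1_pair_powr_integrable[OF w p_gt] by (intro set_integral_add set_integral_diff) auto
  then have "(\<lambda>_::real. c) absolutely_integrable_on {0..}"
  proof (rule absolutely_integrable_spike[where S = "{0}"])
    fix x :: real assume "x \<in> {0..} - {0}"
    then have "0 < x" by auto
    then show "c = (z x)\<^sup>2 - k\<^sup>2 * (w x)\<^sup>2 + 2 / p * \<bar>w x\<bar> powr p"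
      using c[of x] pos[of x] by (simp add: E_def)
  qed simp
  then have "(\<lambda>_::real. \<bar>c\<bar>) integrable_on {0..}" by (simp add: absolutely_integrable_on_def)
  then have "\<bar>c\<bar> = 0" by (rule tendsto_0_if_integrable) auto
  then have first: "(z x)\<^sup>2 = k\<^sup>2 * (w x)\<^sup>2 - 2 / p * w x powr p" if "0 < x" for x
    using c[OF that] by (simp add: E_def)
  define s where "s x = z x / w x" for x
  have s2: "(s x)\<^sup>2 = k\<^sup>2 - 2 / p * w x powr (p - 2)" if x: "0 < x" for x
  proof -
    have "w x powr p = w x powr (p - 2) * (w x)\<^sup>2"
      using pos[OF x] powr_add[of "w x" "p - 2" 2] by simp
    then have "(z x)\<^sup>2 = (k\<^sup>2 - 2 / p * w x powr (p - 2)) * (w x)\<^sup>2"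
      using first[OF x] by (simp add: algebra_simps)
    then show ?thesis using pos[OF x] by (simp add: s_def power_divide)
  qed
  have slt: "\<bar>s x\<bar> < k" if x: "0 < x" for x
  proof -
    have "(s x)\<^sup>2 < k\<^sup>2" using s2[OF x] pos[OF x] p_gt by simp
    then have "\<bar>s x\<bar> < \<bar>k\<bar>" by (simp add: abs_less_iff_power2_less)
    then show ?thesis using k by simp
  qed
  have sk: "-1 < s x / k" "s x / k < 1" if "0 < x" for x
    using slt[OF that] k by (auto simp: field_simps abs_less_iff)
  have ds: "(s has_real_derivative - kap * (k\<^sup>2 - (s x)\<^sup>2)) (at x)" if x: "0 < x" for x
  proof -
    have "(s has_real_derivative ((k\<^sup>2 * w x - \<bar>w x\<bar> powr (p - 2) * w x) * w x - z x * z x) / (w x * w x)) (at x)"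
      unfolding s_def[abs_def] using pos[OF x] by (intro DERIV_divide dz dw x) auto
    moreover have "((k\<^sup>2 * w x - \<bar>w x\<bar> powr (p - 2) * w x) * w x - z x * z x) / (w x * w x)
      = k\<^sup>2 - w x powr (p - 2) - (s x)\<^sup>2"
      using pos[OF x] by (simp add: s_def field_simps power2_eq_square)
    moreover have "w x powr (p - 2) = p / 2 * (k\<^sup>2 - (s x)\<^sup>2)" using s2[OF x] p_gt by simp
    moreover have "k\<^sup>2 - p / 2 * (k\<^sup>2 - (s x)\<^sup>2) - (s x)\<^sup>2 = - kap * (k\<^sup>2 - (s x)\<^sup>2)"
      by (simp add: kap_def field_simps)
    ultimately show ?thesis by simp
  qed
  \<comment> \<open>\<open>artanh\<close> straightens the Riccati equation:
    \<open>artanh (s / k)\<close> has the constant derivative \<open>- kap * k\<close>.\<close>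
  define G where "G x = artanh (s x / k) + kap * k * x" for x
  have "(G has_real_derivative 0) (at x)" if x: "0 < x" for x
  proof -
    have d: "((\<lambda>x. s x / k) has_real_derivative - kap * (k\<^sup>2 - (s x)\<^sup>2) / k) (at x)"
      by (rule DERIV_cdivide[OF ds[OF x]])
    have "(G has_real_derivative 1 / (1 - (s x / k)\<^sup>2) * (- kap * (k\<^sup>2 - (s x)\<^sup>2) / k) + kap * k * 1) (at x)"
      unfolding G_def[abs_def] using sk[OF x]
      by (intro DERIV_add DERIV_cmult DERIV_ident DERIV_chain2[OF artanh_real_has_field_derivative d]) (auto simp: abs_less_iff)
    moreover have "k\<^sup>2 - (s x)\<^sup>2 \<noteq> 0" using s2[OF x] pos[OF x] p_gt by simp
    then have "1 / (1 - (s x / k)\<^sup>2) * (- kap * (k\<^sup>2 - (s x)\<^sup>2) / k) + kap * k * 1 = 0"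
    proof -
      have "1 - (s x / k)\<^sup>2 = (k\<^sup>2 - (s x)\<^sup>2) / k\<^sup>2" using k by (simp add: power_divide diff_divide_distrib)
      then show ?thesis using k \<open>k\<^sup>2 - (s x)\<^sup>2 \<noteq> 0\<close> by (simp add: power2_eq_square)
    qed
    ultimately show ?thesis by (rule DERIV_cong)
  qed
  then have "\<exists>C. \<forall>x\<in>{0<..}. G x = C"
    by (intro has_field_derivative_zero_constant) (auto intro: has_field_derivative_at_within)
  then obtain C where C: "\<And>x. 0 < x \<Longrightarrow> G x = C" by auto
  \<comment> \<open>The position of the peak, where \<open>s = 0\<close> and hence
    \<open>kap * k * a = C\<close>.\<close>
  define a where "a = C / (kap * k)"
  have sl: "s x = logd k (x - a)" if x: "0 < x" for x
  proof -
    define Z where "Z = kap * k * (x - a)"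
    have "artanh (s x / k) = - Z"
      using C[OF x] k kap_pos by (simp add: G_def a_def Z_def algebra_simps)
    then have "s x / k = - tanh Z"
      using tanh_artanh_real[OF sk[OF x]] by simp
    then have "s x = - k * tanh Z" using k by (simp add: field_simps)
    then show ?thesis unfolding logd_def Z_def .
  qed
  have ws: "w x = sol k (x - a)" if x: "0 < x" for x
  proof -
    have "w x powr (p - 2) = p / 2 * (k\<^sup>2 - (s x)\<^sup>2)" using s2[OF x] p_gt by simp
    then have "w x powr (p - 2) = p / 2 * (k\<^sup>2 - (logd k (x - a))\<^sup>2)" unfolding sl[OF x] .
    then have "(w x powr (p - 2)) powr (1 / (p - 2)) = sol k (x - a)"
      by (simp only: sol_eq[OF k])
    then show ?thesis using pos[OF x] p_gt by (simp add: powr_powr)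
  qed
  have "z x = logd k (x - a) * sol k (x - a)" if x: "0 < x" for x
    using sl[OF x] ws[OF x] pos[OF x] by (simp add: s_def field_simps)
  then show ?thesis using ws that by blast
qed

end

section \<open>Existence and uniqueness of ground states\<close>

lemma primitive_on_ae_cong:
  assumes "primitive_on S w v" "ae_eq v v'" "S \<subseteq> {0..}"
  shows "primitive_on S w v'"
  unfolding primitive_on_def
proof (intro ballI impI)
  fix x y assume xy: "x \<in> S" "y \<in> S" "x \<le> y"
  have "{x..y} \<subseteq> {0..}" using xy assms(3) by auto
  from ae_eq_integral[OF assms(2) this] primitive_onD(1,2)[OF assms(1) xy]
  show "v' absolutely_integrable_on {x..y} \<and> integral {x..y} v' = w y - w x" by simp
qed

lemma H1_mass_pair:
  assumes u: "u \<in> H1_mass \<mu>" and p: "2 < p"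
  obtains w where "H1_pair w (weak_deriv u)" "ae_eq w u" "integral {0..} (\<lambda>x. (w x)\<^sup>2) = \<mu>"
    "energy p \<alpha> u = pair_energy p \<alpha> w (weak_deriv u)"
proof -
  have uH: "u \<in> H1" and m: "mass u = \<mu>" using u by (auto simp: H1_mass_def)
  obtain z where z: "has_weak_deriv u z" using uH by (auto simp: H1_def)
  have L: "L1loc_halfline (weak_deriv u)"
    using has_weak_deriv_weak_deriv[OF z] by (simp add: has_weak_deriv_def)
  obtain w where w: "H1_pair w (weak_deriv u)" "ae_eq w u" using H1_imp_pair[OF uH] by blast
  show ?thesis
  proof (rule that[OF w])
    show "integral {0..} (\<lambda>x. (w x)\<^sup>2) = \<mu>"
      using H1_mass_energy_eq(2)[OF uH w L p] m by simp
    show "energy p \<alpha> u = pair_energy p \<alpha> w (weak_deriv u)"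
      by (rule H1_mass_energy_eq(3)[OF uH w L p])
  qed
qed

lemma ground_stateI:
  assumes "u \<in> H1_mass \<mu>" "\<And>v. v \<in> H1_mass \<mu> \<Longrightarrow> energy p \<alpha> u \<le> energy p \<alpha> v"
  shows "ground_state p \<alpha> \<mu> u"
proof -
  have "ereal (energy p \<alpha> u) = (INF v\<in>H1_mass \<mu>. ereal (energy p \<alpha> v))"
  proof (rule antisym)
    show "ereal (energy p \<alpha> u) \<le> (INF v\<in>H1_mass \<mu>. ereal (energy p \<alpha> v))"
      by (rule INF_greatest) (simp add: assms(2))
    show "(INF v\<in>H1_mass \<mu>. ereal (energy p \<alpha> v)) \<le> ereal (energy p \<alpha> u)"
      by (rule INF_lower[OF assms(1)])
  qed
  then show ?thesis using assms(1) by (simp add: ground_state_def energy_level_def)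
qed

lemma ground_stateD:
  assumes "ground_state p \<alpha> \<mu> u" "v \<in> H1_mass \<mu>"
  shows "energy p \<alpha> u \<le> energy p \<alpha> v"
proof -
  have "ereal (energy p \<alpha> u) \<le> ereal (energy p \<alpha> v)"
    using assms INF_lower[of v "H1_mass \<mu>" "\<lambda>u. ereal (energy p \<alpha> u)"]
    by (simp add: ground_state_def energy_level_def)
  then show ?thesis by simp
qed

context subcubic
begin

abbreviation shifted :: "real \<Rightarrow> real \<Rightarrow> real \<Rightarrow> real" where
  "shifted k a x \<equiv> sol k (x - a)"

abbreviation shifted_deriv :: "real \<Rightarrow> real \<Rightarrow> real \<Rightarrow> real" where
  "shifted_deriv k a x \<equiv> logd k (x - a) * sol k (x - a)"

lemma shifted_H1:
  assumes k: "0 < k" and a: "0 \<le> a"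
  shows "shifted k a \<in> H1" "ae_eq (shifted_deriv k a) (weak_deriv (shifted k a))"
    "mass (shifted k a) = A * q * (trunc_int (q - 1) (k\<^sup>2) k + trunc_int (q - 1) (k\<^sup>2) (k * tanh (kap * k * a)))"
    "energy p \<alpha> (shifted k a) = pair_energy p \<alpha> (shifted k a) (shifted_deriv k a)"
proof -
  note H = sol_H1_pair[OF k a]
  have L: "L1loc_halfline (shifted_deriv k a)" by (intro L1loc_if_continuous continuous_on_sol_shift k)
  show 1: "shifted k a \<in> H1" by (rule H1_pair_imp_H1[OF H L])
  note eq = H1_mass_energy_eq[OF 1 H ae_eq_refl L p_gt]
  show "ae_eq (shifted_deriv k a) (weak_deriv (shifted k a))"
    "energy p \<alpha> (shifted k a) = pair_energy p \<alpha> (shifted k a) (shifted_deriv k a)"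
    by (rule eq)+
  show "mass (shifted k a) = A * q * (trunc_int (q - 1) (k\<^sup>2) k + trunc_int (q - 1) (k\<^sup>2) (k * tanh (kap * k * a)))"
    unfolding eq(2) by (rule integral_unique[OF sol_mass[OF k a]])
qed

text \<open>The matching equation is the boundary condition: \<open>k * tanh (kap * k * a)\<close>
  is the logarithmic derivative of the shifted soliton at 0. As \<open>tanh\<close> stays below 1,
  it can hold only for \<open>\<alpha> < k\<close>, which is the source of the mass
  threshold.\<close>

lemma matched_shift:
  assumes k: "0 < k" and a: "0 \<le> a" and match: "k * tanh (kap * k * a) = \<alpha>"
  shows "\<alpha> < k" "mass (shifted k a) = A * q * two_leg_int (q - 1) \<alpha> (k\<^sup>2)"
    "2 * energy p \<alpha> (shifted k a) = min_level \<alpha> (mass (shifted k a)) k"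
proof -
  show "\<alpha> < k" using match k tanh_real_lt_1[of "kap * k * a"] by (metis mult.right_neutral mult_less_cancel_left_pos)
  have sk: "sqrt (k\<^sup>2) = k" using k by simp
  show m: "mass (shifted k a) = A * q * two_leg_int (q - 1) \<alpha> (k\<^sup>2)"
    unfolding shifted_H1(3)[OF k a] match two_leg_int_def sk ..
  have "integral {0..} (\<lambda>x. (shifted k a x)\<^sup>2) = mass (shifted k a)"
    unfolding shifted_H1(3)[OF k a] by (rule integral_unique[OF sol_mass[OF k a]])
  then show "2 * energy p \<alpha> (shifted k a) = min_level \<alpha> (mass (shifted k a)) k"
    unfolding shifted_H1(4)[OF k a] sol_energy[OF k a] match min_level_def two_leg_int_def sk by simp
qed

lemma shift_unique:
  assumes "0 < k" "k * tanh (kap * k * a) = k * tanh (kap * k * b)"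
  shows "a = b"
proof -
  have "tanh (kap * k * a) = tanh (kap * k * b)" using assms by simp
  then have "kap * k * a = kap * k * b" by (metis artanh_tanh_real)
  then show ?thesis using assms(1) kap_pos by simp
qed

lemma exists_shift:
  assumes k: "0 < k" and z: "0 \<le> z" "z < 1"
  obtains a where "0 \<le> a" "k * tanh (kap * k * a) = k * z"
proof -
  define a where "a = artanh z / (kap * k)"
  have ka: "kap * k * a = artanh z" using k kap_pos by (simp add: a_def)
  have t: "tanh (artanh z) = z" using z by (intro tanh_artanh_real) auto
  have "0 \<le> artanh z"
  proof (rule ccontr)
    assume "\<not> 0 \<le> artanh z"
    then have "tanh (artanh z) < tanh 0" by (intro tanh_real_less_iff[THEN iffD2]) simp
    then show False using t z by simp
  qed
  then have "0 \<le> a" using k kap_pos by (simp add: a_def)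
  then show ?thesis using that[of a] ka t by simp
qed

text \<open>\<open>energy_lower_bound\<close> asks that \<open>|w|\<close> be maximal at a point
  where \<open>w\<close> is nonnegative; otherwise \<open>- w\<close>, which has the same mass and
  energy, takes its place.\<close>

lemma energy_lower_bound_H1:
  assumes u: "u \<in> H1_mass \<mu>" and \<mu>: "0 < \<mu>" and \<alpha>: "0 < \<alpha>"
    and k: "0 < k" "A * q * two_leg_int (q - 1) \<alpha> (k\<^sup>2) = \<mu>"
  shows "min_level \<alpha> \<mu> k \<le> 2 * energy p \<alpha> u"
    and "2 * energy p \<alpha> u = min_level \<alpha> \<mu> k \<Longrightarrow>
      \<exists>a\<ge>0. k * tanh (kap * k * a) = \<alpha> \<and> (ae_eq u (shifted k a) \<or> ae_eq u (\<lambda>x. - shifted k a x))"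
proof -
  obtain w where w: "H1_pair w (weak_deriv u)" "ae_eq w u" "integral {0..} (\<lambda>x. (w x)\<^sup>2) = \<mu>"
    "energy p \<alpha> u = pair_energy p \<alpha> w (weak_deriv u)" using H1_mass_pair[OF u p_gt] by blast
  obtain x0 where x0: "0 \<le> x0" "\<And>x. 0 \<le> x \<Longrightarrow> \<bar>w x\<bar> \<le> \<bar>w x0\<bar>" using H1_pair_attains_max[OF w(1)] by blast
  have ae: "ae_eq u f" if "\<And>x. 0 \<le> x \<Longrightarrow> w x = f x" for f
  proof -
    have "ae_eq w f" using that by (simp add: ae_eq_def)
    then show ?thesis using w(2) ae_eq_sym ae_eq_trans by blast
  qed
  show "min_level \<alpha> \<mu> k \<le> 2 * energy p \<alpha> u"
  proof (cases "0 \<le> w x0")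
    case True
    show ?thesis unfolding w(4)
      by (rule energy_lower_bound(1)[OF w(1,3) \<mu> \<alpha> x0(1) _ k]) (use x0 True in auto)
  next
    case False
    have "min_level \<alpha> \<mu> k \<le> 2 * pair_energy p \<alpha> (\<lambda>x. - w x) (\<lambda>x. - weak_deriv u x)"
      by (rule energy_lower_bound(1)[OF H1_pair_uminus[OF w(1)] _ \<mu> \<alpha> x0(1) _ k]) (use w(3) x0 False in auto)
    then show ?thesis unfolding w(4) pair_energy_uminus .
  qed
  assume eq: "2 * energy p \<alpha> u = min_level \<alpha> \<mu> k"
  show "\<exists>a\<ge>0. k * tanh (kap * k * a) = \<alpha> \<and> (ae_eq u (shifted k a) \<or> ae_eq u (\<lambda>x. - shifted k a x))"
  proof (cases "0 \<le> w x0")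
    case True
    have "\<exists>a\<ge>0. k * tanh (kap * k * a) = \<alpha> \<and> (\<forall>x\<ge>0. w x = shifted k a x)"
      by (rule energy_lower_bound(2)[OF w(1,3) \<mu> \<alpha> x0(1) _ k eq[unfolded w(4)]]) (use x0 True in auto)
    then obtain a where a: "0 \<le> a" "k * tanh (kap * k * a) = \<alpha>" "\<And>x. 0 \<le> x \<Longrightarrow> w x = shifted k a x" by blast
    have "ae_eq u (shifted k a)" by (rule ae) (rule a(3))
    then show ?thesis using a(1,2) by blast
  next
    case False
    have "\<exists>a\<ge>0. k * tanh (kap * k * a) = \<alpha> \<and> (\<forall>x\<ge>0. - w x = shifted k a x)"
    proof (rule energy_lower_bound(2)[OF H1_pair_uminus[OF w(1)] _ \<mu> \<alpha> x0(1) _ k])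
      show "integral {0..} (\<lambda>x. (- w x)\<^sup>2) = \<mu>" using w(3) by simp
      show "\<bar>- w x\<bar> \<le> - w x0" if "0 \<le> x" for x using x0(2)[OF that] False by simp
      show "2 * pair_energy p \<alpha> (\<lambda>x. - w x) (\<lambda>x. - weak_deriv u x) = min_level \<alpha> \<mu> k"
        unfolding pair_energy_uminus using eq w(4) by simp
    qed
    then obtain a where a: "0 \<le> a" "k * tanh (kap * k * a) = \<alpha>" "\<And>x. 0 \<le> x \<Longrightarrow> - w x = shifted k a x" by blast
    have "ae_eq u (\<lambda>x. - shifted k a x)" by (rule ae) (use a(3) in force)
    then show ?thesis using a(1,2) by blast
  qed
qed

text \<open>Below the threshold the level is approached by solitons whose peak escapes to infinity
  (\<open>z \<rightarrow> 1\<close>), the frequency being adjusted to keep the mass.\<close>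

lemma escaping_solitons:
  assumes \<mu>: "0 < \<mu>" and k: "0 < k" "A * q * two_leg_int (q - 1) \<alpha> (k\<^sup>2) = \<mu>" and ka: "k \<le> \<alpha>" and \<epsilon>: "0 < \<epsilon>"
  shows "\<exists>u\<in>H1_mass \<mu>. 2 * energy p \<alpha> u < min_level \<alpha> \<mu> k + \<epsilon>"
proof -
  let ?L = "trunc_int (q - 1) 1"
  \<comment> \<open>The exponent with which the mass scales in \<open>k\<close>.\<close>
  define s where "s = 2 * (q - 1) + 1"
  have s: "0 < s" using q_ge_1 by (simp add: s_def)
  have q1: "0 \<le> q - 1" using q_ge_1 by simp
  have L1: "0 < ?L 1" by (rule trunc_int_pos[OF q1])
  have Lz: "0 \<le> ?L z" if "0 \<le> z" for z using trunc_int_mono_upper[OF q1, of 0 z 1] that by simp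
  \<comment> \<open>\<open>z\<close> is the ratio of the slope at the origin to \<open>f z\<close>.
    At fixed \<open>z\<close> the mass is \<open>A * q * (?L 1 + ?L z)\<close> times the power
    \<open>s\<close> of \<open>f z\<close>, and \<open>m z\<close> is the value of that power for
    mass \<mu>.\<close>
  define m where "m z = \<mu> / (A * q * (?L 1 + ?L z))" for z
  have m: "0 < m z" if "0 \<le> z" for z
    unfolding m_def using \<mu> A_pos q_pos L1 Lz[OF that] by simp
  define f where "f z = m z powr (1 / s)" for z
  have f: "0 < f z" if "0 \<le> z" for z unfolding f_def using m[OF that] by simp
  have fs: "f z powr s = m z" if "0 \<le> z" for z using m[OF that] s by (simp add: f_def powr_powr)
  \<comment> \<open>Twice the energy of that soliton, in a form that remains continuous up to
    \<open>z = 1\<close>, where no soliton corresponds to it.\<close>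
  define G where "G z = A * (f z powr (2 * q + 1) * trunc_int q 1 1 + f z powr (2 * q + 1) * trunc_int q 1 z
    + (\<alpha> - f z * z) * trunc_powr q ((f z)\<^sup>2) (f z * z)) - (f z)\<^sup>2 * \<mu>" for z
  have approx: "\<exists>u\<in>H1_mass \<mu>. 2 * energy p \<alpha> u = G z" if z: "0 \<le> z" "z < 1" for z
  proof -
    note fz = f[OF z(1)]
    obtain a where a: "0 \<le> a" "f z * tanh (kap * f z * a) = f z * z" using exists_shift[OF fz z] by blast
    have mass: "mass (shifted (f z) a) = \<mu>"
    proof -
      have "mass (shifted (f z) a) = A * q * (?L 1 + ?L z) * f z powr s"
        unfolding shifted_H1(3)[OF fz a(1)] a(2) trunc_int_scaling[OF fz] s_def using fz
        by (simp add: algebra_simps)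
      also have "\<dots> = \<mu>" unfolding fs[OF z(1)] m_def using A_pos q_pos L1 Lz[OF z(1)] by simp
      finally show ?thesis .
    qed
    have "integral {0..} (\<lambda>x. (shifted (f z) a x)\<^sup>2) = \<mu>"
      unfolding mass[symmetric] shifted_H1(3)[OF fz a(1)] by (rule integral_unique[OF sol_mass[OF fz a(1)]])
    then have "2 * energy p \<alpha> (shifted (f z) a) = G z"
      unfolding shifted_H1(4)[OF fz a(1)] sol_energy[OF fz a(1)] a(2) trunc_int_scaling[OF fz] G_def
      using fz by simp
    then show ?thesis using mass shifted_H1(1)[OF fz a(1)] by (auto simp: H1_mass_def)
  qed
  have cL: "continuous_on {0..1} (trunc_int r 1)" if "0 \<le> r" for r by (rule continuous_on_trunc_int[OF that])
  have cm: "continuous_on {0..1} m"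
    unfolding m_def using A_pos q_pos L1 Lz
    by (intro continuous_intros cL q1) (auto simp: add_pos_nonneg[THEN less_imp_neq, symmetric])
  have cf: "continuous_on {0..1} f"
    unfolding f_def by (intro continuous_on_powr cm continuous_on_const) (use m in force)
  have cG: "continuous_on {0..1} G"
    unfolding G_def trunc_powr_def
    by (intro continuous_on_diff continuous_on_mult continuous_on_add continuous_on_power continuous_on_powr'
        continuous_on_const continuous_on_id continuous_on_max cf cL) (use f q_pos in \<open>auto simp: less_imp_le\<close>)
  \<comment> \<open>As \<open>k \<le> \<alpha>\<close>, the leg up to \<alpha> is saturated; both
    legs are full, and the limit frequency is the given one.\<close>
  have f1: "f 1 = k"
  proof -
    have "?L (\<alpha> / k) = ?L 1" using trunc_int_saturated[OF q1, of 1 "\<alpha> / k"] ka k by simp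
    then have "A * q * (k powr s * (?L 1 + ?L 1)) = \<mu>"
      using k(2) unfolding two_leg_int_scaling[OF k(1)] s_def by simp
    then have "m 1 = k powr s"
      unfolding m_def using A_pos q_pos L1 by (simp add: field_simps)
    then show ?thesis unfolding f_def using k(1) s by (simp add: powr_powr)
  qed
  have G1: "G 1 = min_level \<alpha> \<mu> k"
  proof -
    have sk: "sqrt (k\<^sup>2) = k" using k by simp
    have 1: "trunc_int q (k\<^sup>2) \<alpha> = trunc_int q (k\<^sup>2) k"
      using trunc_int_saturated[of q "k\<^sup>2" \<alpha>] q_pos ka k(1) by simp
    have 2: "trunc_int q (k\<^sup>2) k = k powr (2 * q + 1) * trunc_int q 1 1"
      using trunc_int_scaling[OF k(1), of q k] k(1) by simp
    have 3: "trunc_powr q (k\<^sup>2) k = 0" by (simp add: trunc_powr_def)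
    show ?thesis unfolding G_def f1 min_level_def two_leg_int_def sk 1 2 by (simp add: 3)
  qed
  obtain d where d: "0 < d" "\<And>z. z \<in> {0..1} \<Longrightarrow> dist z 1 < d \<Longrightarrow> dist (G z) (G 1) < \<epsilon>"
    using cG \<epsilon> unfolding continuous_on_iff by (meson atLeastAtMost_iff order.refl zero_le_one)
  define z where "z = max 0 (1 - d / 2)"
  have z: "0 \<le> z" "z < 1" "dist z 1 < d" using d(1) by (auto simp: z_def dist_real_def)
  then have "G z < G 1 + \<epsilon>" using d(2)[of z] by (simp add: dist_real_def)
  moreover obtain u where u: "u \<in> H1_mass \<mu>" "2 * energy p \<alpha> u = G z" using approx[OF z(1,2)] by blast
  ultimately have "2 * energy p \<alpha> u < min_level \<alpha> \<mu> k + \<epsilon>" using G1 by linarith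
  then show ?thesis using u(1) by blast
qed

section \<open>Bound states\<close>

lemma matched_shift_bound_state:
  assumes k: "0 < k" and a: "0 \<le> a" and match: "k * tanh (kap * k * a) = \<alpha>"
  shows "bound_state p \<alpha> (shifted k a)"
proof -
  let ?u = "shifted k a" and ?v = "shifted_deriv k a"
  let ?f = "\<lambda>x. k\<^sup>2 * ?u x - \<bar>?u x\<bar> powr (p - 2) * ?u x"
  note H = shifted_H1[OF k a]
  obtain z where "has_weak_deriv ?u z" using H(1) by (auto simp: H1_def)
  then have wd: "has_weak_deriv ?u (weak_deriv ?u)" by (rule has_weak_deriv_weak_deriv)
  have cf: "continuous_on S ?f" for S
    using sol_pos[OF k] p_gt by (intro continuous_intros continuous_on_powr' continuous_on_sol_shift k) auto
  have der: "(?v has_real_derivative ?f x) (at x)" for x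
  proof -
    have "((\<lambda>x. x - a) has_real_derivative 1) (at x)" by (auto intro!: derivative_eq_intros)
    from DERIV_chain2[OF logd_deriv this]
    have "((\<lambda>x. logd k (x - a)) has_real_derivative - kap * (k\<^sup>2 - (logd k (x - a))\<^sup>2)) (at x)" by simp
    from DERIV_mult[OF this sol_shift_deriv[OF k]]
    have "(?v has_real_derivative (- kap * (k\<^sup>2 - (logd k (x - a))\<^sup>2)) * ?u x + ?v x * logd k (x - a)) (at x)" .
    moreover have "(- kap * (k\<^sup>2 - (logd k (x - a))\<^sup>2)) * ?u x + ?v x * logd k (x - a) = ?f x"
    proof -
      have "\<bar>?u x\<bar> powr (p - 2) = p / 2 * (k\<^sup>2 - (logd k (x - a))\<^sup>2)"
        using sol_powr[OF k] sol_pos[OF k, of "x - a"] by simp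
      then have "?f x = k\<^sup>2 * ?u x - p / 2 * (k\<^sup>2 - (logd k (x - a))\<^sup>2) * ?u x" by (simp only:)
      then show ?thesis by (simp add: kap_def field_simps power2_eq_square)
    qed
    ultimately show ?thesis by (rule DERIV_cong)
  qed
  have "primitive_on {0<..} ?v ?f"
    by (rule primitive_on_C1[OF has_field_derivative_at_within[OF der] cf]) (simp add: is_interval_oi)
  then have "has_weak_deriv (weak_deriv ?u) ?f"
    by (rule has_weak_deriv_if_primitive[OF _ _ H(2) L1loc_if_continuous[OF cf] ae_eq_refl])
       (use wd in \<open>simp add: has_weak_deriv_def\<close>)
  moreover have "value_at_0 (weak_deriv ?u) = \<alpha> * value_at_0 ?u"
  proof -
    have "value_at_0 (weak_deriv ?u) = ?v 0" by (rule value_at_0_eq[OF continuous_on_sol_shift(2)[OF k] H(2)])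
    moreover have "value_at_0 ?u = ?u 0" by (rule value_at_0_eq[OF continuous_on_sol_shift(1)[OF k] ae_eq_refl])
    moreover have "logd k (0 - a) = \<alpha>" using match by (simp add: logd_def)
    ultimately show ?thesis by simp
  qed
  ultimately show ?thesis
    unfolding bound_state_def using H(1) k by (intro conjI exI[of _ "k\<^sup>2"]) auto
qed

text \<open>Replacing \<open>u\<close> and \<open>weak_deriv u\<close> by continuous representatives
  \<open>w\<close> and \<open>z\<close> turns the distributional equation into a classical system,
  to which \<open>positive_solution_is_soliton\<close> applies; the boundary condition then becomes
  the matching equation.\<close>

lemma positive_bound_state_is_shift:
  assumes b: "bound_state p \<alpha> u" and pos: "positive_halfline u" and \<alpha>: "0 < \<alpha>"
  obtains k a where "0 < k" "0 \<le> a" "k * tanh (kap * k * a) = \<alpha>" "ae_eq u (shifted k a)"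
proof -
  obtain \<omega> where uH: "u \<in> H1" and \<omega>: "0 < \<omega>"
    and ode: "has_weak_deriv (weak_deriv u) (\<lambda>x. \<omega> * u x - \<bar>u x\<bar> powr (p - 2) * u x)"
    and bc: "value_at_0 (weak_deriv u) = \<alpha> * value_at_0 u"
    using b by (auto simp: bound_state_def)
  define k where "k = sqrt \<omega>"
  have k: "0 < k" "k\<^sup>2 = \<omega>" using \<omega> by (auto simp: k_def)
  obtain w where w: "H1_pair w (weak_deriv u)" "ae_eq w u" using H1_imp_pair[OF uH] by blast
  note pr = H1_pair_props[OF w(1)]
  obtain z where z: "primitive_on {0<..} z (\<lambda>x. \<omega> * u x - \<bar>u x\<bar> powr (p - 2) * u x)" "ae_eq z (weak_deriv u)"
    using has_weak_deriv_imp_primitive[OF ode] by blast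
  have cz: "continuous_on {0<..} z" by (rule primitive_on_Ioi_continuous[OF z(1)])
  have cw: "continuous_on {0<..} w" by (rule continuous_on_subset[OF pr(6)]) auto
  have wz: "primitive_on {0..} w z" by (rule primitive_on_ae_cong[OF pr(1) ae_eq_sym[OF z(2)]]) simp
  have "(\<lambda>x. (z x)\<^sup>2) absolutely_integrable_on {0..}"
    using ae_eq_integral(1)[OF ae_eq_cong[OF z(2), of "\<lambda>x y. y\<^sup>2"], of "{0..}"] pr(3) by simp
  then have Hz: "H1_pair w z" using wz pr(2) by (simp add: H1_pair_def)
  let ?f = "\<lambda>x. k\<^sup>2 * w x - \<bar>w x\<bar> powr (p - 2) * w x"
  have "ae_eq (\<lambda>x. \<omega> * u x - \<bar>u x\<bar> powr (p - 2) * u x) ?f"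
    using ae_eq_cong[OF ae_eq_sym[OF w(2)], of "\<lambda>x y. \<omega> * y - \<bar>y\<bar> powr (p - 2) * y"] k by simp
  then have zf: "primitive_on {0<..} z ?f" by (rule primitive_on_ae_cong[OF z(1)]) auto
  have cf: "continuous_on {0<..} ?f" using p_gt by (intro continuous_intros continuous_on_powr' cw) auto
  obtain w' where w': "continuous_on {0..} w'" "ae_eq w' u" "\<And>x. 0 < x \<Longrightarrow> 0 < w' x"
    using pos by (auto simp: positive_halfline_def continuous_rep_def)
  have wpos: "0 < w x" if "0 < x" for x
    using ae_eq_continuous_imp_eq[OF w'(1) pr(6) ae_eq_trans[OF w'(2) ae_eq_sym[OF w(2)]], of x] w'(3)[OF that] that by simp
  have dw: "(w has_real_derivative z x) (at x)" if "0 < x" for x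
    by (rule primitive_on_imp_deriv[OF primitive_on_subset[OF wz, of "{0<..}"] cz]) (use that in \<open>auto simp: is_interval_oi\<close>)
  have dz: "(z has_real_derivative ?f x) (at x)" if "0 < x" for x
    by (rule primitive_on_imp_deriv[OF zf cf]) (use that in \<open>auto simp: is_interval_oi\<close>)
  obtain a where a: "\<And>x. 0 < x \<Longrightarrow> w x = shifted k a x" "\<And>x. 0 < x \<Longrightarrow> z x = shifted_deriv k a x"
    using positive_solution_is_soliton[OF Hz k(1) dw dz wpos] by blast
  have ua: "ae_eq (shifted k a) u"
    using a(1) w(2) by (intro ae_eq_trans[of "shifted k a" w u]) (auto simp: ae_eq_def)
  have va: "ae_eq (shifted_deriv k a) (weak_deriv u)"
    using a(2) z(2) by (intro ae_eq_trans[of "shifted_deriv k a" z "weak_deriv u"]) (auto simp: ae_eq_def)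
  have "shifted_deriv k a 0 = \<alpha> * shifted k a 0"
    using bc value_at_0_eq[OF continuous_on_sol_shift(1)[OF k(1)] ua]
      value_at_0_eq[OF continuous_on_sol_shift(2)[OF k(1)] va] by simp
  then have "logd k (0 - a) = \<alpha>" using sol_pos[OF k(1), of "0 - a"] by simp
  then have m: "k * tanh (kap * k * a) = \<alpha>" by (simp add: logd_def)
  \<comment> \<open>The slope at the origin has the sign of \<open>a\<close>, and \<alpha> is
    positive.\<close>
  have "0 \<le> a"
  proof (rule ccontr)
    assume "\<not> 0 \<le> a"
    then have "kap * k * a < 0" using k kap_pos by (simp add: mult_pos_neg)
    then have "tanh (kap * k * a) < tanh 0" by (intro tanh_real_less_iff[THEN iffD2])
    then have "k * tanh (kap * k * a) < 0" using k(1) by (simp add: mult_pos_neg)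
    then show False using m \<alpha> by simp
  qed
  then show ?thesis using that[OF k(1) _ m ae_eq_sym[OF ua]] by blast
qed

lemma mass_cong:
  assumes "u \<in> H1" "0 < k" "0 \<le> a" "ae_eq u (shifted k a)"
  shows "mass u = mass (shifted k a)"
proof -
  have L: "L1loc_halfline (shifted_deriv k a)" by (intro L1loc_if_continuous continuous_on_sol_shift assms(2))
  show ?thesis
    using H1_mass_energy_eq(2)[OF assms(1) sol_H1_pair[OF assms(2,3)] ae_eq_sym[OF assms(4)] L p_gt]
      H1_mass_energy_eq(2)[OF shifted_H1(1)[OF assms(2,3)] sol_H1_pair[OF assms(2,3)] ae_eq_refl L p_gt] by simp
qed

lemma frequency_unique:
  assumes "0 < k" "0 < l" "A * q * two_leg_int (q - 1) \<alpha> (k\<^sup>2) = A * q * two_leg_int (q - 1) \<alpha> (l\<^sup>2)"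
  shows "k = l"
proof -
  have eq: "two_leg_int (q - 1) \<alpha> (k\<^sup>2) = two_leg_int (q - 1) \<alpha> (l\<^sup>2)" using assms(3) A_pos q_pos by simp
  have "k\<^sup>2 = l\<^sup>2"
    using two_leg_int_strict_mono[of "q - 1" "k\<^sup>2" "l\<^sup>2" \<alpha>] two_leg_int_strict_mono[of "q - 1" "l\<^sup>2" "k\<^sup>2" \<alpha>]
      eq q_ge_1 assms(1,2) by (cases "k\<^sup>2" "l\<^sup>2" rule: linorder_cases) auto
  then show ?thesis using assms(1,2) by simp
qed

text \<open>The level can only be attained by a matched soliton, and matching needs
  \<open>\<alpha> < k\<close>. Every energy therefore lies strictly above the level, and some
  escaping soliton undercuts it.\<close>

lemma no_ground_state:
  assumes \<mu>: "0 < \<mu>" and \<alpha>: "0 < \<alpha>" and k: "0 < k" "A * q * two_leg_int (q - 1) \<alpha> (k\<^sup>2) = \<mu>" and ka: "k \<le> \<alpha>"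
  shows "\<not> ground_state p \<alpha> \<mu> u"
proof
  assume g: "ground_state p \<alpha> \<mu> u"
  then have u: "u \<in> H1_mass \<mu>" by (simp add: ground_state_def)
  note lb = energy_lower_bound_H1[OF u \<mu> \<alpha> k]
  have "2 * energy p \<alpha> u \<noteq> min_level \<alpha> \<mu> k"
  proof
    assume "2 * energy p \<alpha> u = min_level \<alpha> \<mu> k"
    from lb(2)[OF this] obtain a where "0 \<le> a" "k * tanh (kap * k * a) = \<alpha>" by blast
    from matched_shift(1)[OF k(1) this] show False using ka by simp
  qed
  then have "0 < 2 * energy p \<alpha> u - min_level \<alpha> \<mu> k" using lb(1) by simp
  from escaping_solitons[OF \<mu> k ka this]
  obtain v where "v \<in> H1_mass \<mu>" "2 * energy p \<alpha> v < 2 * energy p \<alpha> u" by auto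
  then show False using ground_stateD[OF g, of v] by simp
qed

text \<open>Ground states are the matched soliton up to sign, and positivity fixes the sign. A
  positive bound state is a matched soliton of some frequency, which its mass determines by strict
  monotonicity; the frequency and \<alpha> determine the shift.\<close>

lemma unique_ground_state:
  assumes \<mu>: "0 < \<mu>" and \<alpha>: "0 < \<alpha>" and k: "0 < k" "A * q * two_leg_int (q - 1) \<alpha> (k\<^sup>2) = \<mu>" and ak: "\<alpha> < k"
  shows "\<exists>u. ground_state p \<alpha> \<mu> u \<and> positive_halfline u
    \<and> (\<forall>v. ground_state p \<alpha> \<mu> v \<and> positive_halfline v \<longrightarrow> ae_eq v u)
    \<and> bound_state p \<alpha> u \<and> mass u = \<mu>
    \<and> (\<forall>v. bound_state p \<alpha> v \<and> mass v = \<mu> \<and> positive_halfline v \<longrightarrow> ae_eq v u)"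
proof -
  obtain a where a: "0 \<le> a" "k * tanh (kap * k * a) = k * (\<alpha> / k)"
    by (rule exists_shift[OF k(1), of "\<alpha> / k"]) (use \<alpha> ak k in auto)
  then have m: "k * tanh (kap * k * a) = \<alpha>" using k by simp
  let ?u = "shifted k a"
  note ms = matched_shift[OF k(1) a(1) m]
  have mass: "mass ?u = \<mu>" using ms(2) k(2) by simp
  have uH: "?u \<in> H1_mass \<mu>" using mass shifted_H1(1)[OF k(1) a(1)] by (simp add: H1_mass_def)
  have level: "2 * energy p \<alpha> ?u = min_level \<alpha> \<mu> k" using ms(3) mass by simp
  have g: "ground_state p \<alpha> \<mu> ?u"
    by (rule ground_stateI[OF uH]) (use energy_lower_bound_H1(1)[OF _ \<mu> \<alpha> k] level in force)
  have pos: "positive_halfline ?u"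
    unfolding positive_halfline_def continuous_rep_def
    using continuous_on_sol_shift(1)[OF k(1)] sol_pos[OF k(1)] by (intro exI[of _ ?u]) auto
  have ug: "ae_eq v ?u" if v: "ground_state p \<alpha> \<mu> v" "positive_halfline v" for v
  proof -
    have vH: "v \<in> H1_mass \<mu>" using v(1) by (simp add: ground_state_def)
    note lb = energy_lower_bound_H1[OF vH \<mu> \<alpha> k]
    have "2 * energy p \<alpha> v = min_level \<alpha> \<mu> k"
      using lb(1) ground_stateD[OF v(1) uH] level by simp
    then obtain b where b: "0 \<le> b" "k * tanh (kap * k * b) = \<alpha>" "ae_eq v (shifted k b) \<or> ae_eq v (\<lambda>x. - shifted k b x)"
      using lb(2) by blast
    have "b = a" by (rule shift_unique[OF k(1)]) (simp add: b(2) m)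
    moreover have "\<not> ae_eq v (\<lambda>x. - shifted k b x)"
    proof
      assume ae: "ae_eq v (\<lambda>x. - shifted k b x)"
      obtain w where w: "continuous_on {0..} w" "ae_eq w v" "\<And>x. 0 < x \<Longrightarrow> 0 < w x"
        using v(2) by (auto simp: positive_halfline_def continuous_rep_def)
      have "w 1 = - shifted k b 1"
        by (rule ae_eq_continuous_imp_eq[OF w(1) _ ae_eq_trans[OF w(2) ae]])
           (auto intro!: continuous_on_minus continuous_on_sol_shift k)
      then show False using w(3)[of 1] sol_pos[OF k(1), of "1 - b"] by simp
    qed
    ultimately show ?thesis using b(3) by simp
  qed
  have ub: "ae_eq v ?u" if v: "bound_state p \<alpha> v" "mass v = \<mu>" "positive_halfline v" for v
  proof -
    obtain l b where l: "0 < l" "0 \<le> b" "l * tanh (kap * l * b) = \<alpha>" "ae_eq v (shifted l b)"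
      using positive_bound_state_is_shift[OF v(1,3) \<alpha>] by blast
    have "v \<in> H1" using v(1) by (simp add: bound_state_def)
    from mass_cong[OF this l(1,2,4)] have "A * q * two_leg_int (q - 1) \<alpha> (l\<^sup>2) = \<mu>"
      unfolding matched_shift(2)[OF l(1-3)] v(2) by (rule sym)
    then have "A * q * two_leg_int (q - 1) \<alpha> (l\<^sup>2) = A * q * two_leg_int (q - 1) \<alpha> (k\<^sup>2)"
      unfolding k(2) .
    then have lk: "l = k" by (rule frequency_unique[OF l(1) k(1)])
    have "b = a" by (rule shift_unique[OF k(1)]) (use l(3) m lk in simp)
    then show ?thesis using l(4) lk by simp
  qed
  show ?thesis
    using g pos ug matched_shift_bound_state[OF k(1) a(1) m] mass ub by (intro exI[of _ ?u]) auto
qed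

end

theorem theorem1p2:
  fixes p \<alpha> \<mu> :: real
  assumes "2 < p" and "p \<le> 4" and "0 < \<alpha>" and "0 < \<mu>"
  shows "((\<exists>u. ground_state p \<alpha> \<mu> u) \<longleftrightarrow> \<mu> > (LINT x|lborel. (soliton p (\<alpha>\<^sup>2) x)\<^sup>2))
    \<and> ((\<exists>u. ground_state p \<alpha> \<mu> u) \<longrightarrow>
        (\<exists>u. ground_state p \<alpha> \<mu> u \<and> positive_halfline u
           \<and> (\<forall>v. ground_state p \<alpha> \<mu> v \<and> positive_halfline v \<longrightarrow> ae_eq v u)
           \<and> bound_state p \<alpha> u \<and> mass u = \<mu>
           \<and> (\<forall>v. bound_state p \<alpha> v \<and> mass v = \<mu> \<and> positive_halfline v \<longrightarrow> ae_eq v u)))"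
proof -
  interpret subcubic p using assms(1,2) by unfold_locales
  have Aq: "0 < A * q" using A_pos q_pos by simp
  obtain k where k: "0 < k" "two_leg_int (q - 1) \<alpha> (k\<^sup>2) = \<mu> / (A * q)"
    using exists_two_leg_int_eq[of "q - 1" \<alpha> "\<mu> / (A * q)"] q_ge_1 assms(3,4) Aq by auto
  then have k2: "A * q * two_leg_int (q - 1) \<alpha> (k\<^sup>2) = \<mu>" using A_pos q_pos by (simp add: field_simps)
  let ?T = "LINT x|lborel. (soliton p (\<alpha>\<^sup>2) x)\<^sup>2"
  have T: "?T = A * q * two_leg_int (q - 1) \<alpha> (\<alpha>\<^sup>2)" by (rule full_soliton_mass[OF assms(3)])
  show ?thesis
  \<comment> \<open>The mass is strictly increasing in the frequency and equals \<open>?T\<close> at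
    \<open>k = \<alpha>\<close>, so this case distinction is the comparison of \<mu> with the
    threshold.\<close>
  proof (cases "\<alpha> < k")
    case True
    then have "\<alpha>\<^sup>2 < k\<^sup>2" using assms(3) by (intro power_strict_mono) auto
    then have "two_leg_int (q - 1) \<alpha> (\<alpha>\<^sup>2) < two_leg_int (q - 1) \<alpha> (k\<^sup>2)"
      using q_ge_1 assms(3) by (intro two_leg_int_strict_mono) auto
    then have "?T < \<mu>" unfolding T k2[symmetric] using Aq by (rule mult_strict_left_mono)
    then show ?thesis
      using unique_ground_state[OF assms(4,3) k(1) k2 True] by blast
  next
    case False
    have "two_leg_int (q - 1) \<alpha> (k\<^sup>2) \<le> two_leg_int (q - 1) \<alpha> (\<alpha>\<^sup>2)"
    proof (cases "k = \<alpha>")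
      case False
      then have "k\<^sup>2 < \<alpha>\<^sup>2" using \<open>\<not> \<alpha> < k\<close> k(1) by (intro power_strict_mono) auto
      then show ?thesis
        using q_ge_1 k(1) two_leg_int_strict_mono[of "q - 1" "k\<^sup>2" "\<alpha>\<^sup>2" \<alpha>] by simp
    qed simp
    then have "\<mu> \<le> ?T" unfolding T k2[symmetric] using Aq by (intro mult_left_mono) auto
    then show ?thesis
      using no_ground_state[OF assms(4,3) k(1) k2] False by auto
  qed
qed

end
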